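(* Let $R=S/I$ be of type $(N;d)$ with $d\ge 2$, and assume $I$ is generated by a semi-regular sequence. Then: (1) If $\displaystyle N\ge \frac{\binom{n+2d-3}{2d-2}}{\binom{n+d-3}{d-2}}$, then $R$ has minimal rate. (2) If $R$ has minimal rate and $N>n$, then $\displaystyle N\ge \frac{\binom{n+2d-2}{2d-1}}{\binom{n+d-2}{d-1}}$. (3) If $\displaystyle N\ge \frac{\binom{n+\lfloor \frac{3d-4}{2}\rfloor}{\lfloor \frac{3d-2}{2}\rfloor}}{\binom{n+\lfloor \frac{d-4}{2}\rfloor}{\lfloor \frac{d-2}{2}\rfloor}}$, then $R$ has minimal slant. (4) If $R$ has minimal slant and $N>n$, then $\displaystyle N\ge \frac{\binom{n+\lfloor \frac{3d-2}{2}\rfloor}{\lfloor \frac{3d}{2}\rfloor}}{\binom{n+\lfloor \frac{d-2}{2}\rfloor}{\lfloor \frac{d}{2}\rfloor}}$.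
   Context: $\mathsf k$ is a field, $n\ge 2$, $S=\mathsf k[x_1,\dots,x_n]$ is standard graded, $I$ is a nonzero homogeneous ideal of $S$ contained in $(x_1,\dots,x_n)^2$, $R=S/I$, and $m(I)$ is the largest degree of a minimal generator of $I$. $R$ is of type $(N;d)$ if $I$ is minimally generated by $N$ forms, all of degree $d$ (so $m(I)=d$). A sequence of forms $f_1,\dots,f_N$ of degree $d$ in $S$ is semi-regular if the Hilbert series of $S/(f_1,\dots,f_N)$ equals $\Big[\frac{(1-z^{d})^N}{(1-z)^n}\Big]$, where $[\,\cdot\,]$ denotes truncation of a power series at its first non-positive term (that term and all later ones are removed). For $i\ge 0$ let $t_i^R(\mathsf k)=\sup\{j: \operatorname{Tor}_i^R(\mathsf k,\mathsf k)_j\ne 0\}$, where $j$ is the internal degree. Define $$\operatorname{rate}(R)=\sup_{i\ge 2}\frac{t_i^R(\mathsf k)-1}{i-1},\qquad \operatorname{slant}(R)=\sup_{i\ge 1}\frac{t_i^R(\mathsf k)}{i}.$$ $R$ has minimal rate if $\operatorname{rate}(R)=m(I)-1$, and minimal slant if $\operatorname{slant}(R)=m(I)/2$. *)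

theory Defs
  imports
    Complex_Main
    "HOL-Library.Poly_Mapping"
    "HOL-Library.Extended_Real"
    "HOL-Computational_Algebra.Formal_Power_Series"
begin

text \<open>
  Polynomials over \<open>'k\<close> whose variables are the elements of the finite type \<open>'x\<close>. The whole type
  is the ring \<open>S = k[x_1, ..., x_n]\<close>, with \<open>n\<close> the cardinality of \<open>'x\<close>. The ring \<open>R = S/I\<close> is
  given by \<open>I\<close>: its elements are represented by polynomials, and equality in \<open>R\<close> is congruence
  modulo \<open>I\<close>.
\<close>

type_synonym ('x, 'k) mpoly = "('x \<Rightarrow>\<^sub>0 nat) \<Rightarrow>\<^sub>0 'k"

definition mono_deg :: "('x::finite \<Rightarrow>\<^sub>0 nat) \<Rightarrow> nat" where
  "mono_deg t = (\<Sum>x\<in>UNIV. Poly_Mapping.lookup t x)"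

text \<open>The zero polynomial is homogeneous of every degree.\<close>

definition is_form :: "nat \<Rightarrow> ('x::finite, 'k::field) mpoly \<Rightarrow> bool" where
  "is_form j p \<longleftrightarrow> (\<forall>t\<in>Poly_Mapping.keys p. mono_deg t = j)"

definition forms :: "nat \<Rightarrow> ('x::finite, 'k::field) mpoly set" where
  "forms j = {p. is_form j p}"

definition const_coeff :: "('x::finite, 'k::field) mpoly \<Rightarrow> 'k" where
  "const_coeff p = Poly_Mapping.lookup p 0"

definition var :: "'x::finite \<Rightarrow> ('x, 'k::field) mpoly" where
  "var x = Poly_Mapping.single (Poly_Mapping.single x 1) 1"

definition scale_poly :: "'k::field \<Rightarrow> ('x::finite, 'k) mpoly \<Rightarrow> ('x, 'k) mpoly" where
  "scale_poly c p = Poly_Mapping.single 0 c * p"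

text \<open>Ideals are the submodules of the ring as a module over itself.\<close>

abbreviation ideal_gen :: "'a::comm_ring_1 set \<Rightarrow> 'a set" where
  "ideal_gen G \<equiv> module.span (*) G"

definition max_ideal :: "('x::finite, 'k::field) mpoly set" where
  "max_ideal = ideal_gen (range var)"

definition ideal_prod :: "'a::comm_ring_1 set \<Rightarrow> 'a set \<Rightarrow> 'a set" where
  "ideal_prod A B = ideal_gen {a * b | a b. a \<in> A \<and> b \<in> B}"

definition homogeneous_ideal :: "('x::finite, 'k::field) mpoly set \<Rightarrow> bool" where
  "homogeneous_ideal I \<longleftrightarrow> (\<exists>G. (\<forall>g\<in>G. \<exists>j. is_form j g) \<and> I = ideal_gen G)"

text \<open>Elements of a minimal generating set are nonzero, so they have a unique degree.\<close>

definition min_hom_gens :: "('x::finite, 'k::field) mpoly set \<Rightarrow> ('x, 'k) mpoly set \<Rightarrow> bool" where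
  "min_hom_gens G I \<longleftrightarrow>
     finite G \<and> (\<forall>g\<in>G. \<exists>j. is_form j g) \<and> ideal_gen G = I \<and> (\<forall>H. H \<subset> G \<longrightarrow> ideal_gen H \<noteq> I)"

definition max_gen_deg :: "('x::finite, 'k::field) mpoly set \<Rightarrow> nat" where
  "max_gen_deg I = Max {j. \<exists>G g. min_hom_gens G I \<and> g \<in> G \<and> is_form j g}"

definition of_type :: "('x::finite, 'k::field) mpoly set \<Rightarrow> nat \<Rightarrow> nat \<Rightarrow> bool" where
  "of_type I N d \<longleftrightarrow> (\<exists>G. min_hom_gens G I \<and> card G = N \<and> (\<forall>g\<in>G. is_form d g))"

text \<open>The dimension of \<open>(S/I)_j = S_j / (I \<inter> S_j)\<close>, where \<open>S_j\<close> is finite-dimensional.\<close>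

definition hilbert_fun :: "('x::finite, 'k::field) mpoly set \<Rightarrow> nat \<Rightarrow> nat" where
  "hilbert_fun I j =
     vector_space.dim scale_poly (forms j :: ('x, 'k) mpoly set)
     - vector_space.dim scale_poly (I \<inter> forms j)"

definition hilbert_series :: "('x::finite, 'k::field) mpoly set \<Rightarrow> rat fps" where
  "hilbert_series I = Abs_fps (\<lambda>j. of_nat (hilbert_fun I j))"

definition truncate_nonpos :: "rat fps \<Rightarrow> rat fps" where
  "truncate_nonpos A = Abs_fps (\<lambda>j. if \<forall>i\<le>j. fps_nth A i > 0 then fps_nth A j else 0)"

definition semi_regular :: "nat \<Rightarrow> ('x::finite, 'k::field) mpoly list \<Rightarrow> bool" where
  "semi_regular d fs \<longleftrightarrow>
     (\<forall>f\<in>set fs. is_form d f) \<and>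
     hilbert_series (ideal_gen (set fs)) =
       truncate_nonpos ((1 - fps_X ^ d) ^ length fs / (1 - fps_X) ^ card (UNIV :: 'x set))"

text \<open>
  A complex of graded free \<open>R\<close>-modules augmented to \<open>k\<close>. The module \<open>F_i\<close> has the basis
  \<open>cbasis F i\<close>, possibly infinite, where \<open>b\<close> has degree \<open>cdeg F i b\<close>. For \<open>i \<ge> 1\<close>,
  \<open>cdiff F i b c\<close> represents the coefficient at \<open>c\<close> of the image of \<open>b\<close> in \<open>F_(i-1)\<close>; for
  \<open>i = 0\<close> it is unused. The augmentation \<open>F_0 \<longrightarrow> k\<close> sends \<open>b\<close> to \<open>caug F b\<close>.
\<close>

record (overloaded) ('x, 'k) free_cx =
  cbasis :: "nat \<Rightarrow> nat set"
  cdeg :: "nat \<Rightarrow> nat \<Rightarrow> nat"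
  cdiff :: "nat \<Rightarrow> nat \<Rightarrow> nat \<Rightarrow> ('x, 'k) mpoly"
  caug :: "nat \<Rightarrow> 'k"

definition free_vecs :: "nat set \<Rightarrow> (nat \<Rightarrow> 'a::zero) set" where
  "free_vecs B = {v. finite {b. v b \<noteq> 0} \<and> {b. v b \<noteq> 0} \<subseteq> B}"

definition lin_ext :: "(nat \<Rightarrow> nat \<Rightarrow> 'a::comm_ring_1) \<Rightarrow> (nat \<Rightarrow> 'a) \<Rightarrow> nat \<Rightarrow> 'a" where
  "lin_ext M v c = (\<Sum>b | v b \<noteq> 0. v b * M b c)"

definition vec_cong :: "'a::comm_ring_1 set \<Rightarrow> (nat \<Rightarrow> 'a) \<Rightarrow> (nat \<Rightarrow> 'a) \<Rightarrow> bool" where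
  "vec_cong I v w \<longleftrightarrow> (\<forall>b. v b - w b \<in> I)"

text \<open>The ring \<open>R\<close> acts on \<open>k\<close> through constant coefficients (for \<open>I\<close> in the maximal ideal).\<close>

definition aug_map :: "(nat \<Rightarrow> 'k) \<Rightarrow> (nat \<Rightarrow> ('x::finite, 'k::field) mpoly) \<Rightarrow> 'k" where
  "aug_map e v = (\<Sum>b | v b \<noteq> 0. const_coeff (v b) * e b)"

text \<open>
  The first three conjuncts say that the maps are defined and homogeneous of degree \<open>0\<close>, the others
  that \<open>... \<longrightarrow> F_1 \<longrightarrow> F_0 \<longrightarrow> k \<longrightarrow> 0\<close> is exact over \<open>R = S/I\<close>.
\<close>

definition graded_free_res_of_k ::
  "('x::finite, 'k::field) mpoly set \<Rightarrow> ('x, 'k) free_cx \<Rightarrow> bool" where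
  "graded_free_res_of_k I F \<longleftrightarrow>
     (\<forall>i. \<forall>b\<in>cbasis F (Suc i). cdiff F (Suc i) b \<in> free_vecs (cbasis F i)) \<and>
     (\<forall>i. \<forall>b\<in>cbasis F (Suc i). \<forall>c. \<forall>t\<in>Poly_Mapping.keys (cdiff F (Suc i) b c).
        mono_deg t + cdeg F i c = cdeg F (Suc i) b) \<and>
     (\<forall>b\<in>cbasis F 0. caug F b \<noteq> 0 \<longrightarrow> cdeg F 0 b = 0) \<and>
     (\<exists>b\<in>cbasis F 0. caug F b \<noteq> 0) \<and>
     (\<forall>v\<in>free_vecs (cbasis F 0).
        aug_map (caug F) v = 0 \<longleftrightarrow>
        (\<exists>w\<in>free_vecs (cbasis F (Suc 0)). vec_cong I v (lin_ext (cdiff F (Suc 0)) w))) \<and>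
     (\<forall>i. \<forall>v\<in>free_vecs (cbasis F (Suc i)).
        vec_cong I (lin_ext (cdiff F (Suc i)) v) (\<lambda>_. 0) \<longleftrightarrow>
        (\<exists>w\<in>free_vecs (cbasis F (Suc (Suc i))).
           vec_cong I v (lin_ext (cdiff F (Suc (Suc i))) w)))"

text \<open>
  The degree \<open>j\<close> part of \<open>F \<otimes>_R k\<close>: in homological degree \<open>i\<close> it is the \<open>k\<close>-vector space on the
  basis elements of \<open>F_i\<close> of degree \<open>j\<close>, and its differential is given by the constant coefficients
  of the entries of the differential of \<open>F\<close>.
\<close>

definition tensor_k :: "('x::finite, 'k::field) free_cx \<Rightarrow> nat \<Rightarrow> nat \<Rightarrow> (nat \<Rightarrow> 'k) set" where
  "tensor_k F i j = free_vecs {b \<in> cbasis F i. cdeg F i b = j}"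

definition tensor_k_diff ::
  "('x::finite, 'k::field) free_cx \<Rightarrow> nat \<Rightarrow> (nat \<Rightarrow> 'k) \<Rightarrow> nat \<Rightarrow> 'k" where
  "tensor_k_diff F i = lin_ext (\<lambda>b c. const_coeff (cdiff F i b c))"

definition tensor_k_cycles ::
  "('x::finite, 'k::field) free_cx \<Rightarrow> nat \<Rightarrow> nat \<Rightarrow> (nat \<Rightarrow> 'k) set" where
  "tensor_k_cycles F i j =
     {z \<in> tensor_k F i j. i > 0 \<longrightarrow> tensor_k_diff F i z = (\<lambda>_. 0)}"

definition tensor_k_boundaries ::
  "('x::finite, 'k::field) free_cx \<Rightarrow> nat \<Rightarrow> nat \<Rightarrow> (nat \<Rightarrow> 'k) set" where
  "tensor_k_boundaries F i j = tensor_k_diff F (Suc i) ` tensor_k F (Suc i) j"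

text \<open>
  \<open>Tor_i^R(k,k)_j \<noteq> 0\<close> for \<open>R = S/I\<close>. The homology of \<open>F \<otimes>_R k\<close> does not depend on the graded free
  resolution \<open>F\<close>, so any choice of \<open>F\<close> gives the same condition.
\<close>

definition tor_nonzero :: "('x::finite, 'k::field) mpoly set \<Rightarrow> nat \<Rightarrow> nat \<Rightarrow> bool" where
  "tor_nonzero I i j \<longleftrightarrow>
     (\<exists>F. graded_free_res_of_k I F \<and>
          \<not> tensor_k_cycles F i j \<subseteq> tensor_k_boundaries F i j)"

text \<open>The supremum over the empty set is \<open>-\<infinity>\<close>.\<close>

definition t_inv :: "('x::finite, 'k::field) mpoly set \<Rightarrow> nat \<Rightarrow> ereal" where
  "t_inv I i = (SUP j\<in>{j. tor_nonzero I i j}. ereal (real j))"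

definition rate :: "('x::finite, 'k::field) mpoly set \<Rightarrow> ereal" where
  "rate I = (SUP i\<in>{2..}. (t_inv I i - 1) / ereal (real i - 1))"

definition slant :: "('x::finite, 'k::field) mpoly set \<Rightarrow> ereal" where
  "slant I = (SUP i\<in>{1..}. t_inv I i / ereal (real i))"

definition minimal_rate :: "('x::finite, 'k::field) mpoly set \<Rightarrow> bool" where
  "minimal_rate I \<longleftrightarrow> rate I = ereal (real (max_gen_deg I) - 1)"

definition minimal_slant :: "('x::finite, 'k::field) mpoly set \<Rightarrow> bool" where
  "minimal_slant I \<longleftrightarrow> slant I = ereal (real (max_gen_deg I) / 2)"

end

theory Submission
  imports Defs "HOL-Library.Function_Algebras" "HOL-Computational_Algebra.Polynomial_FPS"
begin

text \<open>Every \<open>Tor_i(k, k)\<close> is studied by dimension shifting along the Koszul complex \<open>K\<close> of \<open>R\<close> on the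
  variables, whose homology is annihilated by the variables. With \<open>h_s\<close> the top degree of \<open>H_s(K)\<close>,
  this gives \<open>t_i \<le> max (i, h_s + t_(i-1-s))\<close> over \<open>1 \<le> s < i\<close>. The hypotheses of (1) and (3) say
  that the expected Hilbert series is not positive in degree \<open>e = 2d - 2\<close> or \<open>e = (3d - 2) div 2\<close>, so
  \<open>R_e = 0\<close>, hence \<open>h_s \<le> s + e - 1\<close>, while \<open>h_1 = d\<close>; the bounds on \<open>t_i\<close> follow by induction, and
  \<open>t_2 \<ge> d\<close> makes them sharp.

  For (2) and (4), minimality bounds \<open>t_3\<close> by \<open>e = 2d - 1\<close> or \<open>e = 3d div 2\<close>. If the expected Hilbert
  series were positive in degree \<open>e\<close>, then the forms would have no syzygies up to degree \<open>e\<close>. As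
  \<open>Tor_3(k, k)\<close> vanishes above \<open>e\<close>, all syzygies of the forms would be Koszul syzygies. Then the forms
  are a regular sequence, and comparing Hilbert series gives \<open>N \<le> n\<close>.\<close>

subsection \<open>Homogeneous components of polynomials\<close>

text \<open>The degrees \<open>e\<close> come from \<open>s = 2\<close>: if \<open>R_e = 0\<close>,
  then \<open>h_2 \<le> e + 1\<close>, and \<open>h_2\<close> must stay within what minimality
  allows for \<open>t_3\<close>, namely \<open>2d - 1\<close> for the rate and \<open>3d/2\<close>
  for the slant. With \<open>s\<close> the permitted value grows by at least 1 and the bound on
  \<open>h_s\<close> by 1. In (2) and (4) \<open>e\<close> is the permitted \<open>t_3\<close>
  itself, one degree higher. All these \<open>e\<close> are below \<open>2d\<close>, where
  \<open>(1 - z^d)^N\<close> contributes only \<open>1 - N z^d\<close>; the sign of the expected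
  coefficient thus compares \<open>dim S_e\<close> with \<open>N dim S_(e-d)\<close>, the binomials
  of the theorem.

  The obstacle in (2) and (4): independence is known up to degree \<open>e\<close> only, while
  regularity concerns syzygies of all degrees. \<open>Tor_3\<close> closes the gap, as it measures
  the minimal relations on the second syzygy module of \<open>k\<close>; above \<open>e\<close>
  there are none, so every relation comes from low degrees.

  A module over \<open>R\<close> is a pair \<open>B \<subseteq> A\<close> of graded submodules of a
  free module over \<open>S\<close>. As \<open>tor_nonzero\<close> asks for some resolution, upper
  bounds are proved for every \<open>F\<close>; non-vanishing and the converses require that an
  \<open>F\<close> exists.\<close>

lemma mono_deg_zero [simp]: "mono_deg 0 = 0"
  by (simp add: mono_deg_def)

lemma mono_deg_add [simp]: "mono_deg (s + t) = mono_deg s + mono_deg t"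
  by (simp add: mono_deg_def lookup_add sum.distrib)

lemma mono_deg_single [simp]: "mono_deg (Poly_Mapping.single x k) = k"
proof -
  have "mono_deg (Poly_Mapping.single x k) = (\<Sum>y\<in>UNIV. if y = x then k else 0)"
    unfolding mono_deg_def by (rule sum.cong) (auto simp: lookup_single when_def)
  then show ?thesis by simp
qed

lemma mono_deg_eq_0_iff [simp]: "mono_deg t = 0 \<longleftrightarrow> t = 0"
  by (auto simp: mono_deg_def intro!: poly_mapping_eqI)

text \<open>Forms are indexed by integers, so that shifted degrees need no truncated subtraction.\<close>

definition homog :: "int \<Rightarrow> ('x::finite, 'k::field) mpoly set" where
  "homog s = {p. \<forall>t\<in>Poly_Mapping.keys p. int (mono_deg t) = s}"

lemma homog_iff_lookup:
  "p \<in> homog s \<longleftrightarrow> (\<forall>t. Poly_Mapping.lookup p t \<noteq> 0 \<longrightarrow> int (mono_deg t) = s)"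
  by (auto simp: homog_def in_keys_iff)

lemma homog_int: "homog (int j) = forms j"
  by (auto simp: homog_def forms_def is_form_def)

lemma is_form_iff_homog: "is_form j p \<longleftrightarrow> p \<in> homog (int j)"
  by (simp add: forms_def homog_int)

lemma homog_zero [simp, intro]: "0 \<in> homog s"
  by (simp add: homog_def)

lemma homog_add: "p \<in> homog s \<Longrightarrow> q \<in> homog s \<Longrightarrow> p + q \<in> homog s"
  using keys_add[of p q] by (auto simp: homog_def)

lemma homog_uminus: "p \<in> homog s \<Longrightarrow> - p \<in> homog s"
  by (auto simp: homog_iff_lookup)

lemma homog_diff: "p \<in> homog s \<Longrightarrow> q \<in> homog s \<Longrightarrow> p - q \<in> homog s"
  using homog_add[of p s "- q"] homog_uminus by force

lemma homog_sum: "(\<And>a. a \<in> A \<Longrightarrow> f a \<in> homog s) \<Longrightarrow> sum f A \<in> homog s"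
  by (induction A rule: infinite_finite_induct) (auto intro: homog_add)

lemma homog_mult: "p \<in> homog a \<Longrightarrow> q \<in> homog b \<Longrightarrow> p * q \<in> homog (a + b)"
  using keys_mult[of p q] by (fastforce simp: homog_def)

lemma homog_mult': "p \<in> homog a \<Longrightarrow> q \<in> homog b \<Longrightarrow> c = a + b \<Longrightarrow> p * q \<in> homog c"
  using homog_mult by blast

lemma homog_neg: "s < 0 \<Longrightarrow> p \<in> homog s \<longleftrightarrow> p = 0"
  by (force simp: homog_iff_lookup intro: poly_mapping_eqI)

lemma homog_disjoint: "p \<in> homog s \<Longrightarrow> p \<in> homog t \<Longrightarrow> s \<noteq> t \<Longrightarrow> p = 0"
  by (force simp: homog_iff_lookup intro: poly_mapping_eqI)

lemma homog_single: "Poly_Mapping.single t c \<in> homog (int (mono_deg t))"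
  by (auto simp: homog_iff_lookup lookup_single when_def)

lemma homog_const: "Poly_Mapping.single 0 c \<in> homog 0"
  using homog_single[of 0 c] by simp

lemma homog_one [simp]: "1 \<in> homog 0"
  using homog_const[of 1] by simp

lemma homog_var: "var x \<in> homog 1"
  using homog_single[of "Poly_Mapping.single x 1"] by (simp add: var_def)

lemma const_coeff_add [simp]: "const_coeff (p + q) = const_coeff p + const_coeff q"
  by (simp add: const_coeff_def lookup_add)

lemma const_coeff_zero [simp]: "const_coeff 0 = 0"
  by (simp add: const_coeff_def)

lemma const_coeff_minus [simp]: "const_coeff (p - q) = const_coeff p - const_coeff q"
  by (simp add: const_coeff_def lookup_minus)

lemma const_coeff_single_0 [simp]: "const_coeff (Poly_Mapping.single 0 c) = c"
  by (simp add: const_coeff_def)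

lemma const_coeff_sum: "const_coeff (sum f A) = (\<Sum>a\<in>A. const_coeff (f a))"
  by (induction A rule: infinite_finite_induct) auto

lemma const_coeff_homog: "p \<in> homog s \<Longrightarrow> s \<noteq> 0 \<Longrightarrow> const_coeff p = 0"
  by (auto simp: homog_iff_lookup const_coeff_def)

lemma homog_0_eq:
  assumes "p \<in> homog 0"
  shows "p = Poly_Mapping.single 0 (const_coeff p)"
proof (rule poly_mapping_eqI)
  fix t
  show "Poly_Mapping.lookup p t = Poly_Mapping.lookup (Poly_Mapping.single 0 (const_coeff p)) t"
    using assms by (cases "t = 0") (auto simp: homog_iff_lookup const_coeff_def lookup_single when_def)
qed

lemma sum_monomials:
  "(\<Sum>t\<in>Poly_Mapping.keys p. Poly_Mapping.single t (Poly_Mapping.lookup p t)) = p"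
proof (rule poly_mapping_eqI)
  fix t
  have "Poly_Mapping.lookup (\<Sum>t\<in>Poly_Mapping.keys p. Poly_Mapping.single t (Poly_Mapping.lookup p t)) t
     = (\<Sum>u\<in>Poly_Mapping.keys p. if u = t then Poly_Mapping.lookup p u else 0)"
    unfolding lookup_sum by (rule sum.cong) (auto simp: lookup_single when_def)
  also have "\<dots> = Poly_Mapping.lookup p t"
    by (simp add: in_keys_iff)
  finally show "Poly_Mapping.lookup
     (\<Sum>t\<in>Poly_Mapping.keys p. Poly_Mapping.single t (Poly_Mapping.lookup p t)) t = Poly_Mapping.lookup p t" .
qed

text \<open>Each factor is its constant plus a part without constant term; a sum of exponents
  vanishes only if both do, so products with such a part contribute nothing.
  \<open>const_coeff\<close> is the ring homomorphism through which \<open>R\<close> acts on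
  \<open>k\<close>.\<close>

lemma const_coeff_mult [simp]:
  fixes p q :: "('x::finite, 'k::field) mpoly"
  shows "const_coeff (p * q) = const_coeff p * const_coeff q"
proof -
  have split: "\<exists>p'. p = Poly_Mapping.single 0 (const_coeff p) + p' \<and> 0 \<notin> Poly_Mapping.keys p'"
    for p :: "('x, 'k) mpoly"
    by (rule exI[of _ "p - Poly_Mapping.single 0 (const_coeff p)"])
       (simp add: in_keys_iff lookup_minus const_coeff_def)
  obtain p' where p': "p = Poly_Mapping.single 0 (const_coeff p) + p'" "0 \<notin> Poly_Mapping.keys p'"
    using split[of p] by (elim exE conjE)
  obtain q' where q': "q = Poly_Mapping.single 0 (const_coeff q) + q'" "0 \<notin> Poly_Mapping.keys q'"
    using split[of q] by (elim exE conjE)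
  have nz: "const_coeff (a * b) = 0" if "0 \<notin> Poly_Mapping.keys a \<or> 0 \<notin> Poly_Mapping.keys b"
    for a b :: "('x, 'k) mpoly"
  proof -
    have "s + t \<noteq> 0" if "s \<noteq> 0 \<or> t \<noteq> 0" for s t :: "'x \<Rightarrow>\<^sub>0 nat"
    proof -
      have "mono_deg (s + t) \<noteq> 0"
        using that by (auto simp del: One_nat_def)
      then show ?thesis by (metis mono_deg_zero)
    qed
    then have "0 \<notin> Poly_Mapping.keys (a * b)"
      using that keys_mult[of a b] by (smt (verit, best) mem_Collect_eq subsetD)
    then show ?thesis by (simp add: const_coeff_def in_keys_iff)
  qed
  have "p * q = Poly_Mapping.single 0 (const_coeff p * const_coeff q)
      + (Poly_Mapping.single 0 (const_coeff p) * q' + p' * Poly_Mapping.single 0 (const_coeff q) + p' * q')"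
    (is "_ = _ + (?a + ?b + ?c)")
  proof -
    have "(Poly_Mapping.single 0 (const_coeff p) + p') * (Poly_Mapping.single 0 (const_coeff q) + q')
      = Poly_Mapping.single 0 (const_coeff p * const_coeff q) + (?a + ?b + ?c)"
      by (simp add: distrib_left distrib_right mult_single ac_simps)
    with arg_cong2[where f = "(*)", OF p'(1) q'(1)] show ?thesis by (rule trans)
  qed
  moreover have "const_coeff ?a = 0" "const_coeff ?b = 0" "const_coeff ?c = 0"
    using nz p'(2) q'(2) by blast+
  ultimately show ?thesis
    by (metis add.right_neutral const_coeff_add const_coeff_single_0)
qed

section \<open>Projection onto a homogeneous component\<close>

definition hcomp :: "int \<Rightarrow> ('x::finite, 'k::field) mpoly \<Rightarrow> ('x, 'k) mpoly" where
  "hcomp s p = (\<Sum>t\<in>{t\<in>Poly_Mapping.keys p. int (mono_deg t) = s}.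
     Poly_Mapping.single t (Poly_Mapping.lookup p t))"

lemma lookup_hcomp:
  "Poly_Mapping.lookup (hcomp s p) t = (if int (mono_deg t) = s then Poly_Mapping.lookup p t else 0)"
proof -
  have "Poly_Mapping.lookup (hcomp s p) t
     = (\<Sum>u\<in>{u\<in>Poly_Mapping.keys p. int (mono_deg u) = s}. if u = t then Poly_Mapping.lookup p u else 0)"
    unfolding hcomp_def lookup_sum by (rule sum.cong) (auto simp: lookup_single when_def)
  then show ?thesis
    by (auto simp: in_keys_iff)
qed

lemma hcomp_homog: "hcomp s p \<in> homog s"
  by (simp add: homog_iff_lookup lookup_hcomp)

lemma hcomp_zero [simp]: "hcomp s 0 = 0"
  by (simp add: hcomp_def)

lemma hcomp_add: "hcomp s (p + q) = hcomp s p + hcomp s q"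
  by (rule poly_mapping_eqI) (simp add: lookup_hcomp lookup_add)

lemma hcomp_diff: "hcomp s (p - q) = hcomp s p - hcomp s q"
  by (rule poly_mapping_eqI) (simp add: lookup_hcomp lookup_minus)

lemma hcomp_sum: "hcomp s (sum f A) = (\<Sum>a\<in>A. hcomp s (f a))"
  by (induction A rule: infinite_finite_induct) (auto simp: hcomp_add)

lemma hcomp_id: "p \<in> homog s \<Longrightarrow> hcomp s p = p"
  by (rule poly_mapping_eqI) (auto simp: lookup_hcomp homog_iff_lookup)

lemma hcomp_other: "p \<in> homog t \<Longrightarrow> s \<noteq> t \<Longrightarrow> hcomp s p = 0"
  by (rule poly_mapping_eqI) (auto simp: lookup_hcomp homog_iff_lookup)

lemma sum_hcomp:
  assumes "finite U" "\<And>t. t \<in> Poly_Mapping.keys p \<Longrightarrow> int (mono_deg t) \<in> U"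
  shows "(\<Sum>s\<in>U. hcomp s p) = p"
proof (rule poly_mapping_eqI)
  fix t
  have "Poly_Mapping.lookup (\<Sum>s\<in>U. hcomp s p) t
      = (\<Sum>s\<in>U. if int (mono_deg t) = s then Poly_Mapping.lookup p t else 0)"
    by (simp add: lookup_sum lookup_hcomp)
  also have "\<dots> = Poly_Mapping.lookup p t"
    using assms by (auto simp: in_keys_iff)
  finally show "Poly_Mapping.lookup (\<Sum>s\<in>U. hcomp s p) t = Poly_Mapping.lookup p t" .
qed

text \<open>Only the component of \<open>p\<close> in degree \<open>s - a\<close> can contribute.
  This rule cuts identities down to one degree and so turns arbitrary witnesses into homogeneous
  ones.\<close>

lemma hcomp_mult:
  assumes "r \<in> homog a"
  shows "hcomp s (r * p) = r * hcomp (s - a) p"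
proof -
  \<comment> \<open>The degree \<open>s - a\<close> is included even if \<open>p\<close> has no such
    component, so that the final sum meets it.\<close>
  define U where "U = insert (s - a) ((\<lambda>t. int (mono_deg t)) ` Poly_Mapping.keys p)"
  have U: "finite U" "(\<Sum>u\<in>U. hcomp u p) = p"
    by (auto simp: U_def intro!: sum_hcomp)
  have "hcomp s (r * p) = hcomp s (\<Sum>u\<in>U. r * hcomp u p)"
    by (metis U(2) sum_distrib_left)
  also have "\<dots> = (\<Sum>u\<in>U. if u = s - a then r * hcomp u p else 0)"
    unfolding hcomp_sum
  proof (rule sum.cong)
    fix u
    have "r * hcomp u p \<in> homog (a + u)"
      using assms hcomp_homog homog_mult by blast
    then show "hcomp s (r * hcomp u p) = (if u = s - a then r * hcomp u p else 0)"
      using hcomp_id hcomp_other by fastforce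
  qed simp
  also have "\<dots> = r * hcomp (s - a) p"
    using U(1) by (simp add: U_def)
  finally show ?thesis .
qed

lemma hcomp_mult_right: "r \<in> homog a \<Longrightarrow> hcomp s (p * r) = hcomp (s - a) p * r"
  using hcomp_mult[of r a s p] by (simp add: mult.commute)

text \<open>A polynomial without constant term is a combination of the variables; the
  monomial \<open>t \<noteq> 0\<close> is assigned to one variable \<open>pick_var t\<close> dividing it.\<close>

definition pick_var :: "('x \<Rightarrow>\<^sub>0 nat) \<Rightarrow> 'x" where
  "pick_var t = (SOME x. Poly_Mapping.lookup t x \<noteq> 0)"

lemma pick_var: "t \<noteq> 0 \<Longrightarrow> Poly_Mapping.lookup t (pick_var t) \<noteq> 0"
  unfolding pick_var_def by (rule someI_ex) (auto intro: poly_mapping_eqI)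

abbreviation expo :: "'x \<Rightarrow> ('x \<Rightarrow>\<^sub>0 nat)" where
  "expo x \<equiv> Poly_Mapping.single x 1"

lemma split_expo:
  assumes "Poly_Mapping.lookup t x \<noteq> 0"
  obtains t' where "t = t' + expo x"
proof
  show "t = (t - expo x) + expo x"
    using assms by (intro poly_mapping_eqI) (auto simp: lookup_add lookup_minus lookup_single when_def)
qed

text \<open>The monomials of \<open>p\<close> assigned to \<open>x\<close>, divided by
  \<open>x\<close>. The map is additive, but not linear over the polynomial ring:
  \<open>coord 1 x = 0\<close>, while \<open>coord (var x) x = 1\<close>.\<close>

definition coord :: "('x::finite, 'k::field) mpoly \<Rightarrow> 'x \<Rightarrow> ('x, 'k) mpoly" where
  "coord p x = Abs_poly_mapping
     (\<lambda>t. if pick_var (t + expo x) = x then Poly_Mapping.lookup p (t + expo x) else 0)"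

lemma lookup_coord: "Poly_Mapping.lookup (coord p x) t =
  (if pick_var (t + expo x) = x then Poly_Mapping.lookup p (t + expo x) else 0)"
proof -
  have "{t. Poly_Mapping.lookup p (t + expo x) \<noteq> 0} \<subseteq> (\<lambda>t. t - expo x) ` Poly_Mapping.keys p"
    by (force simp: in_keys_iff)
  then have "finite {t. (if pick_var (t + expo x) = x then Poly_Mapping.lookup p (t + expo x) else 0) \<noteq> 0}"
    using finite_subset[of _ "(\<lambda>t. t - expo x) ` Poly_Mapping.keys p"]
    by (smt (verit, best) Collect_mono finite_imageI finite_keys subset_trans)
  then show ?thesis
    unfolding coord_def by (subst Abs_poly_mapping_inverse) auto
qed

lemma coord_add: "coord (p + q) x = coord p x + coord q x"
  by (rule poly_mapping_eqI) (simp add: lookup_coord lookup_add)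

lemma coord_zero [simp]: "coord 0 x = 0"
  by (rule poly_mapping_eqI) (simp add: lookup_coord)

lemma coord_sum: "coord (sum f A) x = (\<Sum>a\<in>A. coord (f a) x)"
  by (induction A rule: infinite_finite_induct) (auto simp: coord_add)

lemma coord_homog: "p \<in> homog s \<Longrightarrow> coord p x \<in> homog (s - 1)"
  by (auto simp: homog_iff_lookup lookup_coord split: if_splits)

lemma coord_single:
  fixes t :: "'x::finite \<Rightarrow>\<^sub>0 nat"
  assumes "t \<noteq> 0"
  obtains t' where "t = t' + expo (pick_var t)"
    "\<And>x (c :: 'k::field). coord (Poly_Mapping.single t c) x = (if x = pick_var t then Poly_Mapping.single t' c else 0)"
proof -
  obtain t' where t': "t = t' + expo (pick_var t)"
    using split_expo[OF pick_var[OF assms]] .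
  have "coord (Poly_Mapping.single t c) x = (if x = pick_var t then Poly_Mapping.single t' c else 0)" for x and c :: 'k
  proof (rule poly_mapping_eqI)
    fix u
    have "t = u + expo (pick_var t) \<longleftrightarrow> t' = u"
      by (subst t'(1)) auto
    then show "Poly_Mapping.lookup (coord (Poly_Mapping.single t c) x) u =
       Poly_Mapping.lookup (if x = pick_var t then Poly_Mapping.single t' c else 0) u"
      by (auto simp: lookup_coord lookup_single when_def)
  qed
  then show thesis using t' that by blast
qed

lemma single_add_expo: "Poly_Mapping.single (t + expo x) c = Poly_Mapping.single t c * var x"
  by (simp add: var_def mult_single)

lemma sum_coord:
  fixes p :: "('x::finite, 'k::field) mpoly"
  assumes "const_coeff p = 0"
  shows "(\<Sum>x\<in>UNIV. var x * coord p x) = p"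
proof -
  have mono: "(\<Sum>x\<in>UNIV. var x * coord (Poly_Mapping.single t c) x) = Poly_Mapping.single t c"
    if "t \<noteq> 0" for t :: "'x \<Rightarrow>\<^sub>0 nat" and c :: 'k
  proof -
    obtain t' where t': "t = t' + expo (pick_var t)"
      "\<And>x (c::'k). coord (Poly_Mapping.single t c) x = (if x = pick_var t then Poly_Mapping.single t' c else 0)"
      using coord_single[OF \<open>t \<noteq> 0\<close>, where ?'k = 'k] by blast
    have "(\<Sum>x\<in>UNIV. var x * coord (Poly_Mapping.single t c) x)
        = (\<Sum>x\<in>UNIV. if x = pick_var t then var x * Poly_Mapping.single t' c else 0)"
      by (rule sum.cong) (auto simp: t'(2))
    also have "\<dots> = Poly_Mapping.single t' c * var (pick_var t)"
      by (simp add: mult.commute)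
    also have "\<dots> = Poly_Mapping.single (t' + expo (pick_var t)) c"
      by (simp only: single_add_expo)
    also have "t' + expo (pick_var t) = t"
      using t'(1) by (rule sym)
    finally show ?thesis .
  qed
  have "coord p x = (\<Sum>t\<in>Poly_Mapping.keys p. coord (Poly_Mapping.single t (Poly_Mapping.lookup p t)) x)" for x
    by (metis coord_sum sum_monomials)
  then have "(\<Sum>x\<in>UNIV. var x * coord p x) =
     (\<Sum>x\<in>UNIV. \<Sum>t\<in>Poly_Mapping.keys p. var x * coord (Poly_Mapping.single t (Poly_Mapping.lookup p t)) x)"
    by (simp add: sum_distrib_left)
  also have "\<dots> = (\<Sum>t\<in>Poly_Mapping.keys p. \<Sum>x\<in>UNIV. var x * coord (Poly_Mapping.single t (Poly_Mapping.lookup p t)) x)"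
    by (rule sum.swap)
  also have "\<dots> = (\<Sum>t\<in>Poly_Mapping.keys p. Poly_Mapping.single t (Poly_Mapping.lookup p t))"
    using assms by (intro sum.cong mono) (auto simp: const_coeff_def in_keys_iff)
  finally show ?thesis by (simp add: sum_monomials)
qed

text \<open>Multiplication by \<open>x\<close> moves the coefficient at \<open>t\<close> to
  \<open>t + expo x\<close>, and this shift is injective. It serves to raise the degree of a syzygy
  without killing it.\<close>

lemma var_mult_eq_0_iff: "var x * p = 0 \<longleftrightarrow> p = 0"
proof
  assume "var x * p = 0"
  have "Poly_Mapping.lookup p t = 0" for t
  proof -
    have "var x * p = (\<Sum>u\<in>Poly_Mapping.keys p. Poly_Mapping.single (u + expo x) (Poly_Mapping.lookup p u))"
      unfolding single_add_expo sum_distrib_right[symmetric] sum_monomials by (rule mult.commute)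
    then have "(\<Sum>u\<in>Poly_Mapping.keys p. Poly_Mapping.single (u + expo x) (Poly_Mapping.lookup p u)) = 0"
      using \<open>var x * p = 0\<close> by simp
    then have "0 = (\<Sum>u\<in>Poly_Mapping.keys p. Poly_Mapping.lookup (Poly_Mapping.single (u + expo x) (Poly_Mapping.lookup p u)) (t + expo x))"
      unfolding lookup_sum[symmetric] by simp
    also have "\<dots> = (\<Sum>u\<in>Poly_Mapping.keys p. if u = t then Poly_Mapping.lookup p u else 0)"
      by (rule sum.cong) (auto simp: lookup_single when_def)
    finally show ?thesis by (simp add: in_keys_iff split: if_splits)
  qed
  then show "p = 0" by (intro poly_mapping_eqI) simp
qed simp

subsection \<open>Homogeneous ideals\<close>

lemma module_mult: "module ((*) :: 'a::comm_ring_1 \<Rightarrow> 'a \<Rightarrow> 'a)"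
  by unfold_locales (simp_all add: algebra_simps)

lemmas ideal_gen_zero = module.span_zero[OF module_mult]
  and ideal_gen_add = module.span_add[OF module_mult]
  and ideal_gen_scale = module.span_scale[OF module_mult]
  and ideal_gen_base = module.span_base[OF module_mult]
  and ideal_gen_induct =
    module.span_induct_alt[OF module_mult, consumes 1, case_names base step]

lemma ideal_gen_hcomp:
  fixes G :: "('x::finite, 'k::field) mpoly set"
  assumes "\<And>g. g \<in> G \<Longrightarrow> \<exists>j. is_form j g" and "p \<in> ideal_gen G"
  shows "hcomp s p \<in> ideal_gen G"
  using assms(2)
proof (induction rule: ideal_gen_induct)
  case base
  then show ?case by (simp add: ideal_gen_zero)
next
  case (step c g y)
  obtain j where "g \<in> homog (int j)"
    using assms(1)[OF step(1)] by (auto simp: is_form_iff_homog)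
  then have "hcomp s (c * g + y) = hcomp (s - int j) c * g + hcomp s y"
    by (simp add: hcomp_add hcomp_mult_right)
  then show ?case
    using step by (simp add: ideal_gen_add ideal_gen_scale ideal_gen_base)
qed

locale graded_ideal =
  fixes I :: "('x::finite, 'k::field) mpoly set"
  assumes zero_mem: "0 \<in> I"
    and add_mem: "p \<in> I \<Longrightarrow> q \<in> I \<Longrightarrow> p + q \<in> I"
    and mult_mem: "p \<in> I \<Longrightarrow> r * p \<in> I"
    and hcomp_mem: "p \<in> I \<Longrightarrow> hcomp s p \<in> I"
begin

lemma mult_mem_right: "p \<in> I \<Longrightarrow> p * r \<in> I"
  using mult_mem[of p r] by (simp add: mult.commute)

lemma sum_mem: "(\<And>a. a \<in> A \<Longrightarrow> f a \<in> I) \<Longrightarrow> sum f A \<in> I"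
  by (induction A rule: infinite_finite_induct) (auto intro: zero_mem add_mem)

end

lemma graded_ideal_ideal_gen:
  fixes G :: "('x::finite, 'k::field) mpoly set"
  assumes "\<And>g. g \<in> G \<Longrightarrow> \<exists>j. is_form j g"
  shows "graded_ideal (ideal_gen G)"
  using ideal_gen_hcomp[OF assms]
  by unfold_locales (auto simp: ideal_gen_zero ideal_gen_add ideal_gen_scale)

subsection \<open>Graded submodules and chains with coefficients\<close>

definition smul :: "'a::comm_ring_1 \<Rightarrow> ('e \<Rightarrow> 'a) \<Rightarrow> 'e \<Rightarrow> 'a" where
  "smul r v = (\<lambda>e. r * v e)"

lemma smul_apply [simp]: "smul r v e = r * v e"
  by (simp add: smul_def)

lemma sum_fun_apply: "sum f A x = (\<Sum>a\<in>A. f a x)"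
  by (induction A rule: infinite_finite_induct) auto

lemma smul_smul [simp]: "smul r (smul s v) = smul (r * s) v"
  by (rule ext) (simp add: mult.assoc)

lemma smul_zero_left [simp]: "smul 0 v = 0"
  by (rule ext) simp

lemma smul_zero_right [simp]: "smul r 0 = 0"
  by (rule ext) simp

lemma smul_minus_one [simp]: "smul (- 1) v = - v"
  by (rule ext) simp

lemma smul_add_right: "smul r (v + w) = smul r v + smul r w"
  by (rule ext) (simp add: distrib_left)

lemma smul_diff_right: "smul r (v - w) = smul r v - smul r w"
  by (rule ext) (simp add: right_diff_distrib)

lemma smul_add_left: "smul (r + s) v = smul r v + smul s v"
  by (rule ext) (simp add: distrib_right)

lemma smul_sum_right: "smul r (sum f A) = (\<Sum>a\<in>A. smul r (f a))"
  by (rule ext) (simp add: sum_fun_apply sum_distrib_left)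

lemma smul_sum_left: "smul (sum f A) v = (\<Sum>a\<in>A. smul (f a) v)"
  by (rule ext) (simp add: sum_fun_apply sum_distrib_right)

text \<open>A graded submodule of the free module with basis \<open>'e\<close> is given by its homogeneous parts.\<close>

definition graded_sub :: "(int \<Rightarrow> ('e \<Rightarrow> ('x::finite, 'k::field) mpoly) set) \<Rightarrow> bool" where
  "graded_sub A \<longleftrightarrow> (\<forall>q. 0 \<in> A q) \<and> (\<forall>q. \<forall>v\<in>A q. \<forall>w\<in>A q. v + w \<in> A q) \<and>
     (\<forall>q s. \<forall>r\<in>homog s. \<forall>v\<in>A q. smul r v \<in> A (s + q))"

lemma graded_sub_0: "graded_sub A \<Longrightarrow> 0 \<in> A q"
  by (simp add: graded_sub_def)

lemma graded_sub_add: "graded_sub A \<Longrightarrow> v \<in> A q \<Longrightarrow> w \<in> A q \<Longrightarrow> v + w \<in> A q"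
  by (simp add: graded_sub_def)

lemma graded_sub_smul: "graded_sub A \<Longrightarrow> r \<in> homog s \<Longrightarrow> v \<in> A q \<Longrightarrow> u = s + q \<Longrightarrow> smul r v \<in> A u"
  by (simp add: graded_sub_def)

lemma graded_sub_uminus: "graded_sub A \<Longrightarrow> v \<in> A q \<Longrightarrow> - v \<in> A q"
  using graded_sub_smul[of A "- 1" 0 v q q] by (simp add: homog_uminus)

lemma graded_sub_diff: "graded_sub A \<Longrightarrow> v \<in> A q \<Longrightarrow> w \<in> A q \<Longrightarrow> v - w \<in> A q"
  using graded_sub_add[of A v q "- w"] graded_sub_uminus[of A w q] by simp

lemma graded_sub_sum: "graded_sub A \<Longrightarrow> (\<And>a. a \<in> S \<Longrightarrow> f a \<in> A q) \<Longrightarrow> sum f S \<in> A q"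
  by (induction S rule: infinite_finite_induct) (auto intro: graded_sub_0 graded_sub_add)

definition free_mod :: "('e \<Rightarrow> int) \<Rightarrow> 'e set \<Rightarrow> int \<Rightarrow> ('e \<Rightarrow> ('x::finite, 'k::field) mpoly) set" where
  "free_mod wt E q = {v. (\<forall>e. v e \<in> homog (q - wt e)) \<and> (\<forall>e. e \<notin> E \<longrightarrow> v e = 0)}"

lemma graded_sub_free_mod: "graded_sub (free_mod wt E)"
  by (auto simp: graded_sub_def free_mod_def intro: homog_add homog_mult')

text \<open>The maximal ideal at the basis element \<open>e0\<close>: the free module on
  \<open>e0\<close> modulo \<open>max_line e0\<close> is the residue field, the form in which
  \<open>k\<close> occurs as a coefficient module.\<close>

definition max_line :: "'e \<Rightarrow> int \<Rightarrow> ('e \<Rightarrow> ('x::finite, 'k::field) mpoly) set" where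
  "max_line e0 q = {v \<in> free_mod (\<lambda>_. 0) {e0} q. const_coeff (v e0) = 0}"

lemma graded_sub_max_line: "graded_sub (max_line e0)"
  using graded_sub_free_mod[of "\<lambda>_. 0" "{e0}"]
  by (auto simp: graded_sub_def max_line_def)

lemma lin_ext_eq:
  assumes "finite T" "{b. v b \<noteq> 0} \<subseteq> T"
  shows "lin_ext M v c = (\<Sum>b\<in>T. v b * M b c)"
  unfolding lin_ext_def using assms by (intro sum.mono_neutral_left) auto

lemma lin_ext_unit: "lin_ext M (\<lambda>b. if b = a then 1 else (0 :: 'a::comm_ring_1)) = M a"
proof
  fix c
  show "lin_ext M (\<lambda>b. if b = a then 1 else (0 :: 'a)) c = M a c"
    by (subst lin_ext_eq[of "{a}"]) auto
qed

lemma unit_free_vecs: "a \<in> B \<Longrightarrow> (\<lambda>b. if b = a then 1 else (0 :: 'a::comm_ring_1)) \<in> free_vecs B"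
  by (auto simp: free_vecs_def)

context graded_ideal
begin

definition ideal_mod :: "('e \<Rightarrow> int) \<Rightarrow> 'e set \<Rightarrow> int \<Rightarrow> ('e \<Rightarrow> ('x, 'k) mpoly) set" where
  "ideal_mod wt E q = {v \<in> free_mod wt E q. \<forall>e. v e \<in> I}"

lemma graded_sub_ideal_mod: "graded_sub (ideal_mod wt E)"
  using graded_sub_free_mod[of wt E]
  by (auto simp: graded_sub_def ideal_mod_def zero_mem intro: add_mem mult_mem)

text \<open>For \<open>B\<close> inside \<open>A\<close> this makes the quotient a module over
  \<open>R\<close>. The differential of \<open>F\<close> squares to zero only modulo
  \<open>I\<close>, so coefficients in the quotient need this property to form a complex.\<close>

definition ideal_kills where
  "ideal_kills A B \<longleftrightarrow> (\<forall>q s. \<forall>r\<in>homog s \<inter> I. \<forall>v\<in>A q. smul r v \<in> B (s + q))"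

lemma ideal_kills_free_mod: "ideal_kills (free_mod wt E) (ideal_mod wt E)"
  by (auto simp: ideal_kills_def ideal_mod_def
      intro: graded_sub_smul[OF graded_sub_free_mod] mult_mem_right)

lemma ideal_kills_mono:
  "ideal_kills A B \<Longrightarrow> (\<And>q. A' q \<subseteq> A q) \<Longrightarrow> (\<And>q. B q \<subseteq> B' q) \<Longrightarrow> ideal_kills A' B'"
  unfolding ideal_kills_def by blast

end

section \<open>Tensoring a free resolution of the residue field with a subquotient\<close>

locale resolution = graded_ideal I for I :: "('x::finite, 'k::field) mpoly set" +
  fixes F :: "('x, 'k) free_cx"
  assumes res: "graded_free_res_of_k I F"
begin

lemma cdiff_free: "b \<in> cbasis F (Suc i) \<Longrightarrow> cdiff F (Suc i) b \<in> free_vecs (cbasis F i)"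
  using res by (simp add: graded_free_res_of_k_def)

lemma cdiff_homog:
  "b \<in> cbasis F (Suc i) \<Longrightarrow> cdiff F (Suc i) b c \<in> homog (int (cdeg F (Suc i) b) - int (cdeg F i c))"
  using res by (fastforce simp: graded_free_res_of_k_def homog_def)

lemma caug_deg: "b \<in> cbasis F 0 \<Longrightarrow> caug F b \<noteq> 0 \<Longrightarrow> cdeg F 0 b = 0"
  using res by (simp add: graded_free_res_of_k_def)

lemma caug_nonzero: obtains b where "b \<in> cbasis F 0" "caug F b \<noteq> 0"
  using res by (auto simp: graded_free_res_of_k_def)

lemma exact_0: "v \<in> free_vecs (cbasis F 0) \<Longrightarrow> aug_map (caug F) v = 0 \<longleftrightarrow>
    (\<exists>w\<in>free_vecs (cbasis F (Suc 0)). vec_cong I v (lin_ext (cdiff F (Suc 0)) w))"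
  using res by (simp add: graded_free_res_of_k_def)

lemma exact_Suc: "v \<in> free_vecs (cbasis F (Suc i)) \<Longrightarrow>
    vec_cong I (lin_ext (cdiff F (Suc i)) v) (\<lambda>_. 0) \<longleftrightarrow>
    (\<exists>w\<in>free_vecs (cbasis F (Suc (Suc i))). vec_cong I v (lin_ext (cdiff F (Suc (Suc i))) w))"
  using res by (simp add: graded_free_res_of_k_def)

lemma vec_cong_refl: "vec_cong I v v"
  by (simp add: vec_cong_def zero_mem)

lemma cdiff_cdiff:
  assumes "a \<in> cbasis F (Suc (Suc i))"
  shows "lin_ext (cdiff F (Suc i)) (cdiff F (Suc (Suc i)) a) c \<in> I"
proof -
  have "vec_cong I (lin_ext (cdiff F (Suc i)) (cdiff F (Suc (Suc i)) a)) (\<lambda>_. 0)"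
    using exact_Suc[OF cdiff_free[OF assms]] unit_free_vecs[OF assms] vec_cong_refl
    by (metis lin_ext_unit)
  then show ?thesis by (simp add: vec_cong_def)
qed

lemma caug_cdiff:
  assumes "a \<in> cbasis F (Suc 0)"
  shows "aug_map (caug F) (cdiff F (Suc 0) a) = 0"
  using exact_0[OF cdiff_free[OF assms]] unit_free_vecs[OF assms] vec_cong_refl
  by (metis lin_ext_unit)

text \<open>This is the degree \<open>j\<close> part of \<open>F_i\<close> tensored with
  \<open>A\<close> over \<open>S\<close>, and \<open>bd\<close> is the induced differential; the
  quotient \<open>A/B\<close> enters only through congruences.\<close>

definition chains :: "nat \<Rightarrow> int \<Rightarrow> (int \<Rightarrow> ('e \<Rightarrow> ('x, 'k) mpoly) set) \<Rightarrow> (nat \<Rightarrow> 'e \<Rightarrow> ('x, 'k) mpoly) set" where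
  "chains i j A = {v. finite {b. v b \<noteq> 0} \<and> {b. v b \<noteq> 0} \<subseteq> cbasis F i \<and>
     (\<forall>b. v b \<in> A (j - int (cdeg F i b)))}"

definition bd :: "nat \<Rightarrow> (nat \<Rightarrow> 'e \<Rightarrow> ('x, 'k) mpoly) \<Rightarrow> nat \<Rightarrow> 'e \<Rightarrow> ('x, 'k) mpoly" where
  "bd i v c = (\<Sum>b | v b \<noteq> 0. smul (cdiff F i b c) (v b))"

text \<open>\<open>Tor_i(k, A/B)_j = 0\<close>, computed from the resolution \<open>F\<close> of \<open>k\<close>.\<close>

definition tor_zero :: "nat \<Rightarrow> int \<Rightarrow> (int \<Rightarrow> ('e \<Rightarrow> ('x, 'k) mpoly) set) \<Rightarrow> (int \<Rightarrow> ('e \<Rightarrow> ('x, 'k) mpoly) set) \<Rightarrow> bool" where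
  "tor_zero i j A B \<longleftrightarrow> (\<forall>v\<in>chains i j A.
     (\<forall>i'. i = Suc i' \<longrightarrow> (\<forall>c. bd i v c \<in> B (j - int (cdeg F i' c)))) \<longrightarrow>
     (\<exists>w\<in>chains (Suc i) j A. \<forall>b. v b - bd (Suc i) w b \<in> B (j - int (cdeg F i b))))"

lemma tor_zeroD:
  assumes "tor_zero i j A B" "v \<in> chains i j A"
    "\<And>i' c. i = Suc i' \<Longrightarrow> bd i v c \<in> B (j - int (cdeg F i' c))"
  obtains w where "w \<in> chains (Suc i) j A" "\<And>b. v b - bd (Suc i) w b \<in> B (j - int (cdeg F i b))"
  using assms unfolding tor_zero_def by blast

lemma tor_zeroI:
  assumes "\<And>v. v \<in> chains i j A \<Longrightarrow> (\<And>i' c. i = Suc i' \<Longrightarrow> bd i v c \<in> B (j - int (cdeg F i' c))) \<Longrightarrow>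
     \<exists>w\<in>chains (Suc i) j A. \<forall>b. v b - bd (Suc i) w b \<in> B (j - int (cdeg F i b))"
  shows "tor_zero i j A B"
  using assms unfolding tor_zero_def by blast

lemma bd_eq:
  assumes "finite T" "{b. v b \<noteq> 0} \<subseteq> T"
  shows "bd i v c = (\<Sum>b\<in>T. smul (cdiff F i b c) (v b))"
  unfolding bd_def using assms by (intro sum.mono_neutral_left) auto

lemma chains_finite: "v \<in> chains i j A \<Longrightarrow> finite {b. v b \<noteq> 0}"
  by (simp add: chains_def)

lemma chains_basis: "v \<in> chains i j A \<Longrightarrow> v b \<noteq> 0 \<Longrightarrow> b \<in> cbasis F i"
  by (auto simp: chains_def)

lemma chains_mem: "v \<in> chains i j A \<Longrightarrow> v b \<in> A (j - int (cdeg F i b))"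
  by (simp add: chains_def)

lemma chains_mono: "v \<in> chains i j A \<Longrightarrow> (\<And>q. A q \<subseteq> A' q) \<Longrightarrow> v \<in> chains i j A'"
  unfolding chains_def by blast

lemma chainsI:
  assumes "finite {b. v b \<noteq> 0}" "\<And>b. v b \<noteq> 0 \<Longrightarrow> b \<in> cbasis F i"
    "\<And>b. v b \<in> A (j - int (cdeg F i b))"
  shows "v \<in> chains i j A"
  using assms by (auto simp: chains_def)

lemma chains_add:
  assumes "graded_sub A" "v \<in> chains i j A" "w \<in> chains i j A"
  shows "v + w \<in> chains i j A"
proof (rule chainsI)
  show "finite {b. (v + w) b \<noteq> 0}"
    by (rule finite_subset[of _ "{b. v b \<noteq> 0} \<union> {b. w b \<noteq> 0}"]) (use assms chains_finite in auto)
  show "(v + w) b \<in> A (j - int (cdeg F i b))" for b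
    using assms by (simp add: chains_mem graded_sub_add)
  show "b \<in> cbasis F i" if "(v + w) b \<noteq> 0" for b
    using that assms chains_basis[of v] chains_basis[of w] by (metis add.right_neutral plus_fun_apply)
qed

lemma chains_diff:
  assumes "graded_sub A" "v \<in> chains i j A" "w \<in> chains i j A"
  shows "v - w \<in> chains i j A"
proof (rule chainsI)
  show "finite {b. (v - w) b \<noteq> 0}"
    by (rule finite_subset[of _ "{b. v b \<noteq> 0} \<union> {b. w b \<noteq> 0}"]) (use assms chains_finite in auto)
  show "(v - w) b \<in> A (j - int (cdeg F i b))" for b
    using assms by (simp add: chains_mem graded_sub_diff)
  show "b \<in> cbasis F i" if "(v - w) b \<noteq> 0" for b
    using that assms chains_basis[of v] chains_basis[of w]
    by (metis diff_zero minus_apply)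
qed

lemma bd_add:
  assumes "finite {b. v b \<noteq> 0}" "finite {b. w b \<noteq> 0}"
  shows "bd i (v + w) c = bd i v c + bd i w c"
proof -
  define T where "T = {b. v b \<noteq> 0} \<union> {b. w b \<noteq> 0}"
  have T: "finite T" "{b. v b \<noteq> 0} \<subseteq> T" "{b. w b \<noteq> 0} \<subseteq> T" "{b. (v + w) b \<noteq> 0} \<subseteq> T"
    using assms by (auto simp: T_def)
  show ?thesis
    using T by (simp add: bd_eq[of T] smul_add_right sum.distrib)
qed

lemma bd_diff:
  assumes "finite {b. v b \<noteq> 0}" "finite {b. w b \<noteq> 0}"
  shows "bd i (v - w) c = bd i v c - bd i w c"
proof -
  define T where "T = {b. v b \<noteq> 0} \<union> {b. w b \<noteq> 0}"
  have T: "finite T" "{b. v b \<noteq> 0} \<subseteq> T" "{b. w b \<noteq> 0} \<subseteq> T" "{b. (v - w) b \<noteq> 0} \<subseteq> T"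
    using assms by (auto simp: T_def)
  show ?thesis
    using T by (simp add: bd_eq[of T] smul_diff_right sum_subtractf)
qed

lemma bd_mem:
  assumes A: "graded_sub A" and v: "v \<in> chains (Suc i) j A"
  shows "bd (Suc i) v c \<in> A (j - int (cdeg F i c))"
  unfolding bd_def
proof (rule graded_sub_sum[OF A])
  fix b assume "b \<in> {b. v b \<noteq> 0}"
  then have "b \<in> cbasis F (Suc i)" using v chains_basis by blast
  then show "smul (cdiff F (Suc i) b c) (v b) \<in> A (j - int (cdeg F i c))"
    by (intro graded_sub_smul[OF A cdiff_homog chains_mem[OF v]]) auto
qed

lemma bd_chains:
  assumes A: "graded_sub A" and v: "v \<in> chains (Suc i) j A"
  shows "bd (Suc i) v \<in> chains i j A"
proof -
  have *: "{c. bd (Suc i) v c \<noteq> 0} \<subseteq> (\<Union>b\<in>{b. v b \<noteq> 0}. {c. cdiff F (Suc i) b c \<noteq> 0})"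
  proof
    fix c assume "c \<in> {c. bd (Suc i) v c \<noteq> 0}"
    then obtain b where "v b \<noteq> 0" "smul (cdiff F (Suc i) b c) (v b) \<noteq> 0"
      unfolding bd_def by (auto elim: sum.not_neutral_contains_not_neutral)
    then have "v b \<noteq> 0" "cdiff F (Suc i) b c \<noteq> 0" by auto
    then show "c \<in> (\<Union>b\<in>{b. v b \<noteq> 0}. {c. cdiff F (Suc i) b c \<noteq> 0})" by auto
  qed
  have fin: "finite {c. cdiff F (Suc i) b c \<noteq> 0}" "{c. cdiff F (Suc i) b c \<noteq> 0} \<subseteq> cbasis F i" if "v b \<noteq> 0" for b
    using cdiff_free[OF chains_basis[OF v that]] by (auto simp: free_vecs_def)
  show ?thesis
  proof (rule chainsI)
    show "finite {c. bd (Suc i) v c \<noteq> 0}"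
      by (rule finite_subset[OF *]) (use fin chains_finite[OF v] in auto)
    show "b \<in> cbasis F i" if "bd (Suc i) v b \<noteq> 0" for b
      using * that fin(2) by blast
  qed (rule bd_mem[OF A v])
qed

text \<open>After the two sums are exchanged, the coefficient of \<open>v a\<close> is an entry of
  the square of the differential, a form in \<open>I\<close>; \<open>ideal_kills\<close> moves its
  multiple of \<open>v a\<close> into \<open>B\<close>.\<close>

lemma bd_bd:
  assumes A: "graded_sub A" and B: "graded_sub B" and kills: "ideal_kills A B"
    and v: "v \<in> chains (Suc (Suc i)) j A"
  shows "bd (Suc i) (bd (Suc (Suc i)) v) c \<in> B (j - int (cdeg F i c))"
proof -
  define S where "S = {b. v b \<noteq> 0}"
  have S: "finite S" "\<And>a. a \<in> S \<Longrightarrow> a \<in> cbasis F (Suc (Suc i))"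
    using v by (auto simp: S_def chains_def)
  define T where "T = (\<Union>a\<in>S. {b. cdiff F (Suc (Suc i)) a b \<noteq> 0})"
  have T: "finite T" "\<And>a. a \<in> S \<Longrightarrow> {b. cdiff F (Suc (Suc i)) a b \<noteq> 0} \<subseteq> T"
    using S cdiff_free by (auto simp: T_def free_vecs_def)
  have bdv: "bd (Suc (Suc i)) v b = (\<Sum>a\<in>S. smul (cdiff F (Suc (Suc i)) a b) (v a))" for b
    using S by (intro bd_eq) (auto simp: S_def)
  have sub: "{b. bd (Suc (Suc i)) v b \<noteq> 0} \<subseteq> T"
  proof
    fix b assume "b \<in> {b. bd (Suc (Suc i)) v b \<noteq> 0}"
    then obtain a where "a \<in> S" "smul (cdiff F (Suc (Suc i)) a b) (v a) \<noteq> 0"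
      unfolding bdv by (auto elim: sum.not_neutral_contains_not_neutral)
    then have "cdiff F (Suc (Suc i)) a b \<noteq> 0" by auto
    then show "b \<in> T" using \<open>a \<in> S\<close> by (auto simp: T_def)
  qed
  have "bd (Suc i) (bd (Suc (Suc i)) v) c
      = (\<Sum>b\<in>T. \<Sum>a\<in>S. smul (cdiff F (Suc i) b c * cdiff F (Suc (Suc i)) a b) (v a))"
    by (subst bd_eq[OF T(1) sub]) (simp add: bdv smul_sum_right)
  also have "\<dots> = (\<Sum>a\<in>S. \<Sum>b\<in>T. smul (cdiff F (Suc i) b c * cdiff F (Suc (Suc i)) a b) (v a))"
    by (rule sum.swap)
  also have "\<dots> = (\<Sum>a\<in>S. smul (lin_ext (cdiff F (Suc i)) (cdiff F (Suc (Suc i)) a) c) (v a))"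
  proof (rule sum.cong)
    fix a assume "a \<in> S"
    show "(\<Sum>b\<in>T. smul (cdiff F (Suc i) b c * cdiff F (Suc (Suc i)) a b) (v a))
      = smul (lin_ext (cdiff F (Suc i)) (cdiff F (Suc (Suc i)) a) c) (v a)"
      by (subst lin_ext_eq[OF T(1) T(2)[OF \<open>a \<in> S\<close>]]) (simp add: smul_sum_left mult.commute)
  qed simp
  also have "\<dots> \<in> B (j - int (cdeg F i c))"
  proof (rule graded_sub_sum[OF B])
    fix a assume a: "a \<in> S"
    let ?r = "lin_ext (cdiff F (Suc i)) (cdiff F (Suc (Suc i)) a) c"
    have "?r \<in> homog (int (cdeg F (Suc (Suc i)) a) - int (cdeg F i c))"
      unfolding lin_ext_def
    proof (rule homog_sum)
      fix b assume "b \<in> {b. cdiff F (Suc (Suc i)) a b \<noteq> 0}"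
      then have "b \<in> cbasis F (Suc i)"
        using cdiff_free[OF S(2)[OF a]] by (auto simp: free_vecs_def)
      then show "cdiff F (Suc (Suc i)) a b * cdiff F (Suc i) b c
          \<in> homog (int (cdeg F (Suc (Suc i)) a) - int (cdeg F i c))"
        by (intro homog_mult'[OF cdiff_homog[OF S(2)[OF a]] cdiff_homog]) auto
    qed
    moreover have "?r \<in> I" by (rule cdiff_cdiff[OF S(2)[OF a]])
    moreover have "j - int (cdeg F i c)
        = (int (cdeg F (Suc (Suc i)) a) - int (cdeg F i c)) + (j - int (cdeg F (Suc (Suc i)) a))" by simp
    ultimately show "smul ?r (v a) \<in> B (j - int (cdeg F i c))"
      using kills chains_mem[OF v, of a] unfolding ideal_kills_def by (metis IntI)
  qed
  finally show ?thesis .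
qed

subsection \<open>Short exact sequences\<close>

text \<open>Middle of \<open>Tor_i(k, B/C) \<rightarrow> Tor_i(k, A/C) \<rightarrow> Tor_i(k,
  A/B)\<close>: a cycle is a boundary up to coefficients in \<open>B\<close>, and the remainder is a
  cycle with values in \<open>B/C\<close>.\<close>

lemma tor_zero_extension:
  assumes A: "graded_sub A" and B: "graded_sub B" and C: "graded_sub C"
    and BA: "\<And>q. B q \<subseteq> A q" and CB: "\<And>q. C q \<subseteq> B q" and kills: "ideal_kills A C"
    and AB: "tor_zero i j A B" and BC: "tor_zero i j B C"
  shows "tor_zero i j A C"
proof (rule tor_zeroI)
  fix v assume v: "v \<in> chains i j A"
    and cyc: "\<And>i' c. i = Suc i' \<Longrightarrow> bd i v c \<in> C (j - int (cdeg F i' c))"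
  have cycB: "bd i v c \<in> B (j - int (cdeg F i' c))" if "i = Suc i'" for i' c
    using cyc[OF that] CB by blast
  obtain w where w: "w \<in> chains (Suc i) j A" "\<And>b. v b - bd (Suc i) w b \<in> B (j - int (cdeg F i b))"
    using tor_zeroD[OF AB v cycB] by blast
  define u where "u = v - bd (Suc i) w"
  have bdw: "bd (Suc i) w \<in> chains i j A" by (rule bd_chains[OF A w(1)])
  have "u \<in> chains i j A" unfolding u_def by (rule chains_diff[OF A v bdw])
  then have u: "u \<in> chains i j B" using w(2) by (auto simp: chains_def u_def)
  have cycu: "bd i u c \<in> C (j - int (cdeg F i' c))" if "i = Suc i'" for i' c
  proof -
    have "bd i u c = bd i v c - bd i (bd (Suc i) w) c"
      unfolding u_def using chains_finite v bdw by (intro bd_diff) blast+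
    moreover have "bd i (bd (Suc i) w) c \<in> C (j - int (cdeg F i' c))"
      using bd_bd[OF A C kills] w(1) that by blast
    ultimately show ?thesis using cyc[OF that] C by (simp add: graded_sub_diff)
  qed
  obtain w' where w': "w' \<in> chains (Suc i) j B" "\<And>b. u b - bd (Suc i) w' b \<in> C (j - int (cdeg F i b))"
    using tor_zeroD[OF BC u cycu] by blast
  have w'A: "w' \<in> chains (Suc i) j A" using w'(1) BA by (rule chains_mono)
  have "bd (Suc i) (w + w') b = bd (Suc i) w b + bd (Suc i) w' b" for b
    using chains_finite w(1) w'(1) by (intro bd_add) blast+
  then have "v b - bd (Suc i) (w + w') b \<in> C (j - int (cdeg F i b))" for b
    using w'(2)[of b] by (simp add: u_def algebra_simps)
  then show "\<exists>w\<in>chains (Suc i) j A. \<forall>b. v b - bd (Suc i) w b \<in> C (j - int (cdeg F i b))"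
    using chains_add[OF A w(1) w'A] by blast
qed

text \<open>Middle of \<open>Tor_i(k, A/C) \<rightarrow> Tor_i(k, A/B) \<rightarrow> Tor_(i-1)(k,
  B/C)\<close>. For \<open>i = 0\<close> there is no third term, hence the guard in
  \<open>BC\<close>.\<close>

lemma tor_zero_quotient:
  assumes A: "graded_sub A" and B: "graded_sub B" and C: "graded_sub C"
    and BA: "\<And>q. B q \<subseteq> A q" and CB: "\<And>q. C q \<subseteq> B q" and kills: "ideal_kills A C"
    and AC: "tor_zero i j A C" and BC: "\<And>i'. i = Suc i' \<Longrightarrow> tor_zero i' j B C"
  shows "tor_zero i j A B"
proof (rule tor_zeroI)
  fix v assume v: "v \<in> chains i j A"
    and cyc: "\<And>i' c. i = Suc i' \<Longrightarrow> bd i v c \<in> B (j - int (cdeg F i' c))"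
  \<comment> \<open>The connecting map: the boundary of \<open>v\<close> is a cycle with values in
    \<open>B/C\<close>, so it is the boundary of some \<open>w\<close> there, and
    \<open>v - w\<close> becomes a cycle modulo \<open>C\<close>.\<close>
  have "\<exists>w\<in>chains i j B. \<forall>i' c. i = Suc i' \<longrightarrow> bd i v c - bd i w c \<in> C (j - int (cdeg F i' c))"
  proof (cases i)
    case 0
    have "0 \<in> chains i j B" by (rule chainsI) (auto simp: graded_sub_0[OF B])
    then show ?thesis using 0 by auto
  next
    case (Suc i')
    have "bd i v \<in> chains i' j A" using bd_chains[OF A] v Suc by blast
    then have bdv: "bd i v \<in> chains i' j B" using cyc Suc by (auto simp: chains_def)
    have cyc2: "bd i' (bd i v) c \<in> C (j - int (cdeg F i'' c))" if "i' = Suc i''" for i'' c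
      using bd_bd[OF A C kills] v Suc that by blast
    obtain w where "w \<in> chains (Suc i') j B"
      "\<And>b. bd i v b - bd (Suc i') w b \<in> C (j - int (cdeg F i' b))"
      using tor_zeroD[OF BC[OF Suc] bdv cyc2] by blast
    then show ?thesis using Suc by (intro bexI[of _ w]) auto
  qed
  then obtain w where w: "w \<in> chains i j B"
    "\<And>i' c. i = Suc i' \<Longrightarrow> bd i v c - bd i w c \<in> C (j - int (cdeg F i' c))" by blast
  have wA: "w \<in> chains i j A" using w(1) BA by (rule chains_mono)
  have vw: "v - w \<in> chains i j A" by (rule chains_diff[OF A v wA])
  have "bd i (v - w) c = bd i v c - bd i w c" for c
    using chains_finite v w(1) by (intro bd_diff) blast+
  then have cyc3: "bd i (v - w) c \<in> C (j - int (cdeg F i' c))" if "i = Suc i'" for i' c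
    using w(2)[OF that] by simp
  obtain w' where w': "w' \<in> chains (Suc i) j A"
     "\<And>b. (v - w) b - bd (Suc i) w' b \<in> C (j - int (cdeg F i b))"
    using tor_zeroD[OF AC vw cyc3] by blast
  have "v b - bd (Suc i) w' b \<in> B (j - int (cdeg F i b))" for b
  proof -
    have "v b - bd (Suc i) w' b = ((v - w) b - bd (Suc i) w' b) + w b" by simp
    moreover have "(v - w) b - bd (Suc i) w' b \<in> B (j - int (cdeg F i b))"
      using w'(2)[of b] CB by blast
    ultimately show ?thesis using graded_sub_add[OF B _ chains_mem[OF w(1)]] by metis
  qed
  then show "\<exists>w\<in>chains (Suc i) j A. \<forall>b. v b - bd (Suc i) w b \<in> B (j - int (cdeg F i b))"
    using w'(1) by blast
qed

text \<open>Middle of \<open>Tor_(i+1)(k, A/B) \<rightarrow> Tor_i(k, B/C) \<rightarrow> Tor_i(k,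
  A/C)\<close>. The bounding chain has coefficients in \<open>A\<close>; it is itself a cycle modulo
  \<open>B\<close>, and subtracting a boundary moves its coefficients into \<open>B\<close>.\<close>

lemma tor_zero_sub:
  assumes A: "graded_sub A" and B: "graded_sub B" and C: "graded_sub C"
    and BA: "\<And>q. B q \<subseteq> A q" and CB: "\<And>q. C q \<subseteq> B q" and kills: "ideal_kills A C"
    and AB: "tor_zero (Suc i) j A B" and AC: "tor_zero i j A C"
  shows "tor_zero i j B C"
proof (rule tor_zeroI)
  fix v assume v: "v \<in> chains i j B"
    and cyc: "\<And>i' c. i = Suc i' \<Longrightarrow> bd i v c \<in> C (j - int (cdeg F i' c))"
  have vA: "v \<in> chains i j A" using v BA by (rule chains_mono)
  obtain w where w: "w \<in> chains (Suc i) j A" "\<And>b. v b - bd (Suc i) w b \<in> C (j - int (cdeg F i b))"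
    using tor_zeroD[OF AC vA cyc] by blast
  have "bd (Suc i) w b \<in> B (j - int (cdeg F i b))" for b
  proof -
    have "bd (Suc i) w b = v b - (v b - bd (Suc i) w b)" by simp
    moreover have "v b - bd (Suc i) w b \<in> B (j - int (cdeg F i b))"
      using w(2)[of b] CB by blast
    ultimately show ?thesis using graded_sub_diff[OF B chains_mem[OF v, of b]] by metis
  qed
  then have cycw: "bd (Suc i) w b \<in> B (j - int (cdeg F i' b))" if "Suc i = Suc i'" for i' b
    using that by simp
  obtain w' where w': "w' \<in> chains (Suc (Suc i)) j A"
    "\<And>b. w b - bd (Suc (Suc i)) w' b \<in> B (j - int (cdeg F (Suc i) b))"
    using tor_zeroD[OF AB w(1) cycw] by blast
  define u where "u = w - bd (Suc (Suc i)) w'"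
  have bdw': "bd (Suc (Suc i)) w' \<in> chains (Suc i) j A" by (rule bd_chains[OF A w'(1)])
  have "u \<in> chains (Suc i) j A" unfolding u_def by (rule chains_diff[OF A w(1) bdw'])
  then have u: "u \<in> chains (Suc i) j B" using w'(2) by (auto simp: chains_def u_def)
  have "v b - bd (Suc i) u b \<in> C (j - int (cdeg F i b))" for b
  proof -
    have "bd (Suc i) u b = bd (Suc i) w b - bd (Suc i) (bd (Suc (Suc i)) w') b"
      unfolding u_def using chains_finite w(1) bdw' by (intro bd_diff) blast+
    then have "v b - bd (Suc i) u b = (v b - bd (Suc i) w b) + bd (Suc i) (bd (Suc (Suc i)) w') b" by simp
    then show ?thesis
      using graded_sub_add[OF C w(2)[of b] bd_bd[OF A C kills w'(1), of b]] by metis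
  qed
  then show "\<exists>w\<in>chains (Suc i) j B. \<forall>b. v b - bd (Suc i) w b \<in> C (j - int (cdeg F i b))"
    using u by blast
qed

subsection \<open>Isomorphic subquotients\<close>

lemma chains_lift:
  assumes v: "v' \<in> chains i j A'" and A: "graded_sub A" and B': "graded_sub B'"
    and \<phi>: "\<phi> 0 = 0" and lift: "\<And>q y. y \<in> A' q \<Longrightarrow> \<exists>x\<in>A q. y - \<phi> x \<in> B' q"
  obtains v where "v \<in> chains i j A" "(\<lambda>b. v' b - \<phi> (v b)) \<in> chains i j B'"
proof -
  \<comment> \<open>Zero is lifted to zero, which keeps the support of the lifted chain
    finite.\<close>
  have "\<exists>x. x \<in> A (j - int (cdeg F i b)) \<and> v' b - \<phi> x \<in> B' (j - int (cdeg F i b)) \<and> (v' b = 0 \<longrightarrow> x = 0)" for b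
  proof (cases "v' b = 0")
    case True
    then show ?thesis using \<phi> graded_sub_0[OF A] graded_sub_0[OF B'] by (intro exI[of _ 0]) simp
  next
    case False
    then show ?thesis using lift[OF chains_mem[OF v]] by blast
  qed
  then obtain x where x: "\<And>b. x b \<in> A (j - int (cdeg F i b))"
    "\<And>b. v' b - \<phi> (x b) \<in> B' (j - int (cdeg F i b))" "\<And>b. v' b = 0 \<Longrightarrow> x b = 0"
    by metis
  have "x \<in> chains i j A"
  proof (rule chainsI)
    show "finite {b. x b \<noteq> 0}"
      by (rule finite_subset[OF _ chains_finite[OF v]]) (use x(3) in auto)
    show "b \<in> cbasis F i" if "x b \<noteq> 0" for b
      using that x(3) chains_basis[OF v] by blast
  qed (rule x(1))
  moreover have "(\<lambda>b. v' b - \<phi> (x b)) \<in> chains i j B'"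
  proof (rule chainsI)
    show "finite {b. v' b - \<phi> (x b) \<noteq> 0}"
      by (rule finite_subset[OF _ chains_finite[OF v]]) (use x(3) \<phi> in auto)
    show "b \<in> cbasis F i" if "v' b - \<phi> (x b) \<noteq> 0" for b
      using that x(3) \<phi> chains_basis[OF v] by fastforce
  qed (rule x(2))
  ultimately show thesis using that by blast
qed

text \<open>The assumptions make \<open>\<phi>\<close> an isomorphism from \<open>A/B\<close> onto
  \<open>A'/B'\<close>: \<open>lift\<close> is surjectivity, and \<open>iff\<close> gives
  well-definedness and injectivity. Lifts are chosen coefficientwise, so they match only modulo
  \<open>B'\<close>; \<open>split\<close> controls the boundary of the error.\<close>

lemma
  fixes \<phi> :: "('e \<Rightarrow> ('x, 'k) mpoly) \<Rightarrow> ('f \<Rightarrow> ('x, 'k) mpoly)"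
  assumes A: "graded_sub A" and B: "graded_sub B" and A': "graded_sub A'" and B': "graded_sub B'"
    and \<phi>: "\<And>v w. \<phi> (v + w) = \<phi> v + \<phi> w" "\<And>r v. \<phi> (smul r v) = smul r (\<phi> v)"
    and img: "\<And>q x. x \<in> A q \<Longrightarrow> \<phi> x \<in> A' q"
    and lift: "\<And>q y. y \<in> A' q \<Longrightarrow> \<exists>x\<in>A q. y - \<phi> x \<in> B' q"
    and iff: "\<And>q x. x \<in> A q \<Longrightarrow> \<phi> x \<in> B' q \<longleftrightarrow> x \<in> B q"
    and BA: "\<And>q. B q \<subseteq> A q" and BA': "\<And>q. B' q \<subseteq> A' q"
  shows tor_zero_iso1: "tor_zero i j A B \<Longrightarrow> tor_zero i j A' B'"
    and tor_zero_iso2: "tor_zero i j A' B' \<Longrightarrow> tor_zero i j A B"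
proof -
  have \<phi>0: "\<phi> 0 = 0" using \<phi>(2)[of 0 0] by simp
  have \<phi>_diff: "\<phi> (v - w) = \<phi> v - \<phi> w" for v w
    using \<phi>(1)[of "v - w" w] by simp
  have \<phi>_sum: "\<phi> (sum f S) = (\<Sum>a\<in>S. \<phi> (f a))" for f and S :: "nat set"
    by (induction S rule: infinite_finite_induct)
       (simp_all only: sum.infinite sum.empty sum.insert \<phi>0 \<phi>(1) not_False_eq_True)
  have \<phi>_chains: "(\<lambda>b. \<phi> (v b)) \<in> chains i j A'" if "v \<in> chains i j A" for v i
  proof (rule chainsI)
    show "finite {b. \<phi> (v b) \<noteq> 0}"
      by (rule finite_subset[OF _ chains_finite[OF that]]) (use \<phi>0 in auto)
    show "b \<in> cbasis F i" if "\<phi> (v b) \<noteq> 0" for b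
      using that \<phi>0 chains_basis[OF \<open>v \<in> chains i j A\<close>] by metis
  qed (use img chains_mem[OF that] in blast)
  have bd_\<phi>: "bd i (\<lambda>b. \<phi> (v b)) c = \<phi> (bd i v c)" if "finite {b. v b \<noteq> 0}" for v i c
  proof -
    have "bd i (\<lambda>b. \<phi> (v b)) c = (\<Sum>b | v b \<noteq> 0. smul (cdiff F i b c) (\<phi> (v b)))"
      using that \<phi>0 by (intro bd_eq) auto
    then show ?thesis by (simp add: bd_def \<phi>_sum \<phi>(2))
  qed
  have split: "bd i v' c - \<phi> (bd i v c) = bd i (\<lambda>b. v' b - \<phi> (v b)) c"
    if "v' \<in> chains i j A'" "v \<in> chains i j A" for v v' i c
  proof -
    have "bd i (\<lambda>b. v' b - \<phi> (v b)) c = bd i (v' - (\<lambda>b. \<phi> (v b))) c"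
      by (rule arg_cong[of _ _ "\<lambda>u. bd i u c"]) (simp add: fun_eq_iff)
    also have "\<dots> = bd i v' c - bd i (\<lambda>b. \<phi> (v b)) c"
      using chains_finite[OF that(1)] chains_finite[OF \<phi>_chains[OF that(2)]] by (rule bd_diff)
    finally show ?thesis using bd_\<phi>[OF chains_finite[OF that(2)]] by simp
  qed
  show "tor_zero i j A' B'" if V: "tor_zero i j A B"
  proof (rule tor_zeroI)
    fix v' assume v': "v' \<in> chains i j A'"
      and cyc: "\<And>i' c. i = Suc i' \<Longrightarrow> bd i v' c \<in> B' (j - int (cdeg F i' c))"
    obtain v where v: "v \<in> chains i j A" "(\<lambda>b. v' b - \<phi> (v b)) \<in> chains i j B'"
      using chains_lift[where \<phi> = \<phi>, OF v' A B' \<phi>0 lift] by blast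
    have cyc1: "bd i v c \<in> B (j - int (cdeg F i' c))" if i: "i = Suc i'" for i' c
    proof -
      have "bd i v' c - \<phi> (bd i v c) \<in> B' (j - int (cdeg F i' c))"
        unfolding split[OF v' v(1)] using bd_mem[OF B'] v(2) i by blast
      then have "\<phi> (bd i v c) \<in> B' (j - int (cdeg F i' c))"
        using graded_sub_diff[OF B' cyc[OF i]] by fastforce
      then show ?thesis using iff bd_mem[OF A] v(1) i by blast
    qed
    obtain w where w: "w \<in> chains (Suc i) j A" "\<And>b. v b - bd (Suc i) w b \<in> B (j - int (cdeg F i b))"
      using tor_zeroD[OF V v(1) cyc1] by blast
    have "v' b - bd (Suc i) (\<lambda>b. \<phi> (w b)) b \<in> B' (j - int (cdeg F i b))" for b
    proof -
      have "\<phi> (v b - bd (Suc i) w b) \<in> B' (j - int (cdeg F i b))"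
        using w(2)[of b] iff BA by blast
      moreover have "v' b - \<phi> (v b) \<in> B' (j - int (cdeg F i b))"
        using chains_mem[OF v(2), of b] by simp
      moreover have "v' b - bd (Suc i) (\<lambda>b. \<phi> (w b)) b = (v' b - \<phi> (v b)) + \<phi> (v b - bd (Suc i) w b)"
        using bd_\<phi>[OF chains_finite[OF w(1)]] by (simp add: \<phi>_diff)
      ultimately show ?thesis using graded_sub_add[OF B'] by metis
    qed
    then show "\<exists>w\<in>chains (Suc i) j A'. \<forall>b. v' b - bd (Suc i) w b \<in> B' (j - int (cdeg F i b))"
      using \<phi>_chains[OF w(1)] by blast
  qed
  show "tor_zero i j A B" if V: "tor_zero i j A' B'"
  proof (rule tor_zeroI)
    fix v assume v: "v \<in> chains i j A"
      and cyc: "\<And>i' c. i = Suc i' \<Longrightarrow> bd i v c \<in> B (j - int (cdeg F i' c))"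
    have cyc2: "bd i (\<lambda>b. \<phi> (v b)) c \<in> B' (j - int (cdeg F i' c))" if "i = Suc i'" for i' c
      unfolding bd_\<phi>[OF chains_finite[OF v]] using iff cyc[OF that] BA by blast
    obtain w' where w': "w' \<in> chains (Suc i) j A'"
      "\<And>b. \<phi> (v b) - bd (Suc i) w' b \<in> B' (j - int (cdeg F i b))"
      using tor_zeroD[OF V \<phi>_chains[OF v] cyc2] by blast
    obtain w where w: "w \<in> chains (Suc i) j A" "(\<lambda>b. w' b - \<phi> (w b)) \<in> chains (Suc i) j B'"
      using chains_lift[where \<phi> = \<phi>, OF w'(1) A B' \<phi>0 lift] by blast
    have "v b - bd (Suc i) w b \<in> B (j - int (cdeg F i b))" for b
    proof -
      have "bd (Suc i) w' b - \<phi> (bd (Suc i) w b) \<in> B' (j - int (cdeg F i b))"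
        unfolding split[OF w'(1) w(1)] using bd_mem[OF B' w(2)] .
      from graded_sub_add[OF B' w'(2) this]
      have "\<phi> (v b - bd (Suc i) w b) \<in> B' (j - int (cdeg F i b))"
        by (simp only: \<phi>_diff add_diff_eq diff_add_cancel)
      then show ?thesis
        using iff graded_sub_diff[OF A chains_mem[OF v] bd_mem[OF A w(1)]] by blast
    qed
    then show "\<exists>w\<in>chains (Suc i) j A. \<forall>b. v b - bd (Suc i) w b \<in> B (j - int (cdeg F i b))"
      using w(1) by blast
  qed
qed

lemma tor_zero_shift: "tor_zero i j (\<lambda>q. A (q - s)) (\<lambda>q. B (q - s)) \<longleftrightarrow> tor_zero i (j - s) A B"
proof -
  have "j - int m - s = j - s - int m" for m by simp
  then show ?thesis unfolding tor_zero_def chains_def by (simp only:)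
qed

end

subsection \<open>Free modules, the residue field, and vector spaces as coefficients\<close>

context resolution
begin

lemma chains_column:
  assumes "v \<in> chains i j A"
  shows "(\<lambda>b. v b e) \<in> free_vecs (cbasis F i)"
  unfolding free_vecs_def mem_Collect_eq
proof
  show "finite {b. v b e \<noteq> 0}"
    by (rule finite_subset[OF _ chains_finite[OF assms]]) auto
  show "{b. v b e \<noteq> 0} \<subseteq> cbasis F i"
    using chains_basis[OF assms] by force
qed

lemma bd_column:
  assumes "finite {b. v b \<noteq> 0}"
  shows "bd i v c e = lin_ext (cdiff F i) (\<lambda>b. v b e) c"
proof -
  have "lin_ext (cdiff F i) (\<lambda>b. v b e) c = (\<Sum>b | v b \<noteq> 0. v b e * cdiff F i b c)"
    using assms by (intro lin_ext_eq) auto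
  then show ?thesis by (simp add: bd_def sum_fun_apply mult.commute)
qed

text \<open>A free coefficient module of finite rank gives one copy of \<open>F\<close> for each
  \<open>e\<close>, so exactness of \<open>F\<close> applies column by column. The preimages it
  supplies need not be homogeneous and are replaced by their components of the right degree.\<close>

lemma free_mod_lift:
  assumes v: "v \<in> chains i j (free_mod wt E)" and E: "finite E"
    and ex: "\<And>e. e \<in> E \<Longrightarrow>
      \<exists>w\<in>free_vecs (cbasis F (Suc i)). vec_cong I (\<lambda>b. v b e) (lin_ext (cdiff F (Suc i)) w)"
  shows "\<exists>w\<in>chains (Suc i) j (free_mod wt E).
     \<forall>b. v b - bd (Suc i) w b \<in> ideal_mod wt E (j - int (cdeg F i b))"
proof -
  obtain W where W: "\<And>e. e \<in> E \<Longrightarrow> W e \<in> free_vecs (cbasis F (Suc i))"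
    "\<And>e. e \<in> E \<Longrightarrow> vec_cong I (\<lambda>b. v b e) (lin_ext (cdiff F (Suc i)) (W e))"
    using ex by metis
  define w where "w = (\<lambda>b e. if e \<in> E then hcomp (j - int (cdeg F (Suc i) b) - wt e) (W e b) else 0)"
  have sub: "{b. w b \<noteq> 0} \<subseteq> (\<Union>e\<in>E. {b. W e b \<noteq> 0})"
  proof
    fix b assume "b \<in> {b. w b \<noteq> 0}"
    then obtain e where "w b e \<noteq> 0" by (auto simp: fun_eq_iff)
    then have "e \<in> E" "W e b \<noteq> 0" by (auto simp: w_def split: if_splits)
    then show "b \<in> (\<Union>e\<in>E. {b. W e b \<noteq> 0})" by blast
  qed
  have w: "w \<in> chains (Suc i) j (free_mod wt E)"
  proof (rule chainsI)
    show "finite {b. w b \<noteq> 0}"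
      by (rule finite_subset[OF sub]) (use W(1) E in \<open>auto simp: free_vecs_def\<close>)
    show "b \<in> cbasis F (Suc i)" if "w b \<noteq> 0" for b
    proof -
      from that have "b \<in> (\<Union>e\<in>E. {b. W e b \<noteq> 0})" using sub by blast
      then obtain e where "e \<in> E" "W e b \<noteq> 0" by blast
      then show ?thesis using W(1)[of e] by (auto simp: free_vecs_def)
    qed
    show "w b \<in> free_mod wt E (j - int (cdeg F (Suc i) b))" for b
      by (auto simp: free_mod_def w_def hcomp_homog)
  qed
  have "v b - bd (Suc i) w b \<in> ideal_mod wt E (j - int (cdeg F i b))" for b
  proof -
    have mem: "v b - bd (Suc i) w b \<in> free_mod wt E (j - int (cdeg F i b))"
      by (rule graded_sub_diff[OF graded_sub_free_mod chains_mem[OF v] bd_mem[OF graded_sub_free_mod w]])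
    have "(v b - bd (Suc i) w b) e \<in> I" for e
    proof (cases "e \<in> E")
      case True
      define T where "T = {a. W e a \<noteq> 0}"
      have T: "finite T" "\<And>a. a \<in> T \<Longrightarrow> a \<in> cbasis F (Suc i)"
        using W(1)[OF True] by (auto simp: T_def free_vecs_def)
      let ?s = "j - int (cdeg F i b) - wt e"
      have "bd (Suc i) w b e = lin_ext (cdiff F (Suc i)) (\<lambda>b. w b e) b"
        by (rule bd_column[OF chains_finite[OF w]])
      also have "\<dots> = (\<Sum>a\<in>T. w a e * cdiff F (Suc i) a b)"
        using T(1) by (intro lin_ext_eq) (auto simp: T_def w_def split: if_splits)
      also have "\<dots> = (\<Sum>a\<in>T. hcomp ?s (W e a * cdiff F (Suc i) a b))"
        using True by (intro sum.cong refl) (simp add: hcomp_mult_right[OF cdiff_homog[OF T(2)]] w_def algebra_simps)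
      also have "\<dots> = hcomp ?s (lin_ext (cdiff F (Suc i)) (W e) b)"
        unfolding hcomp_sum[symmetric] by (simp add: lin_ext_def T_def)
      finally have "bd (Suc i) w b e = hcomp ?s (lin_ext (cdiff F (Suc i)) (W e) b)" .
      moreover have "v b e = hcomp ?s (v b e)"
        using chains_mem[OF v, of b] by (simp add: free_mod_def hcomp_id)
      ultimately have "(v b - bd (Suc i) w b) e = hcomp ?s (v b e - lin_ext (cdiff F (Suc i)) (W e) b)"
        by (simp add: hcomp_diff)
      also have "\<dots> \<in> I"
        using W(2)[OF True] by (intro hcomp_mem) (simp add: vec_cong_def)
      finally show ?thesis .
    next
      case False
      then have "(v b - bd (Suc i) w b) e = 0" using mem unfolding free_mod_def by blast
      then show ?thesis using zero_mem by simp
    qed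
    then show ?thesis using mem unfolding ideal_mod_def by blast
  qed
  then show ?thesis using w by blast
qed

text \<open>Free modules have no higher \<open>Tor\<close>, and \<open>Tor_0\<close> is one copy of
  \<open>k\<close> in each degree \<open>wt e\<close>: the entries at basis elements with
  \<open>caug F b \<noteq> 0\<close> are forms of degree \<open>j - wt e\<close>, without constant
  term unless \<open>j = wt e\<close>.\<close>

lemma tor_zero_free_mod:
  assumes "finite E" "i \<noteq> 0 \<or> j \<notin> wt ` E"
  shows "tor_zero i j (free_mod wt E) (ideal_mod wt E)"
proof (rule tor_zeroI)
  fix v assume v: "v \<in> chains i j (free_mod wt E)"
    and cyc: "\<And>i' c. i = Suc i' \<Longrightarrow> bd i v c \<in> ideal_mod wt E (j - int (cdeg F i' c))"
  have "\<exists>w\<in>free_vecs (cbasis F (Suc i)). vec_cong I (\<lambda>b. v b e) (lin_ext (cdiff F (Suc i)) w)"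
    if "e \<in> E" for e
  proof (cases i)
    case 0
    have "const_coeff (v b e) * caug F b = 0" for b
    proof (cases "v b e = 0 \<or> caug F b = 0")
      case False
      then have "b \<in> cbasis F 0" using chains_column[OF v, of e] 0 by (auto simp: free_vecs_def)
      then have "v b e \<in> homog (j - wt e)"
        using chains_mem[OF v, of b] caug_deg False 0 by (auto simp: free_mod_def)
      moreover have "j - wt e \<noteq> 0" using assms(2) 0 that by auto
      ultimately show ?thesis by (simp add: const_coeff_homog)
    qed auto
    then have "aug_map (caug F) (\<lambda>b. v b e) = 0"
      unfolding aug_map_def by (intro sum.neutral ballI)
    then show ?thesis using exact_0 chains_column[OF v, of e] 0 by blast
  next
    case (Suc i')
    have "vec_cong I (lin_ext (cdiff F (Suc i')) (\<lambda>b. v b e)) (\<lambda>_. 0)"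
      using cyc[OF Suc] Suc by (simp add: vec_cong_def ideal_mod_def bd_column[OF chains_finite[OF v], symmetric])
    then show ?thesis using exact_Suc chains_column[OF v, of e] Suc by blast
  qed
  then show "\<exists>w\<in>chains (Suc i) j (free_mod wt E).
     \<forall>b. v b - bd (Suc i) w b \<in> ideal_mod wt E (j - int (cdeg F i b))"
    by (rule free_mod_lift[OF v assms(1)])
qed

section \<open>Coefficients in the residue field\<close>

definition res_field_chain :: "'e \<Rightarrow> (nat \<Rightarrow> 'k) \<Rightarrow> nat \<Rightarrow> 'e \<Rightarrow> ('x, 'k) mpoly" where
  "res_field_chain e0 z b = (\<lambda>e. if e = e0 then Poly_Mapping.single 0 (z b) else 0)"

lemma res_field_chain_chains:
  assumes "z \<in> tensor_k F i j"
  shows "res_field_chain e0 z \<in> chains i (int j) (free_mod (\<lambda>_. 0) {e0})"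
proof (rule chainsI)
  have eq: "res_field_chain e0 z b \<noteq> 0 \<longleftrightarrow> z b \<noteq> 0" for b
    by (auto simp: res_field_chain_def fun_eq_iff single_zero)
       (metis const_coeff_single_0 const_coeff_zero)
  show "finite {b. res_field_chain e0 z b \<noteq> 0}"
    unfolding eq using assms by (simp add: tensor_k_def free_vecs_def)
  show "b \<in> cbasis F i" if "res_field_chain e0 z b \<noteq> 0" for b
    using that assms unfolding eq by (auto simp: tensor_k_def free_vecs_def)
  show "res_field_chain e0 z b \<in> free_mod (\<lambda>_. 0) {e0} (int j - int (cdeg F i b))" for b
  proof (cases "z b = 0")
    case False
    then have "cdeg F i b = j" using assms by (auto simp: tensor_k_def free_vecs_def)
    then show ?thesis by (auto simp: free_mod_def res_field_chain_def homog_const)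
  qed (simp add: res_field_chain_def free_mod_def)
qed

lemma tensor_k_const_coeff:
  assumes "v \<in> chains i (int j) (free_mod (\<lambda>_. 0) {e0})"
  shows "(\<lambda>b. const_coeff (v b e0)) \<in> tensor_k F i j"
  unfolding tensor_k_def free_vecs_def mem_Collect_eq
proof
  show "finite {b. const_coeff (v b e0) \<noteq> 0}"
    by (rule finite_subset[OF _ chains_finite[OF assms]]) auto
  show "{b. const_coeff (v b e0) \<noteq> 0} \<subseteq> {b \<in> cbasis F i. cdeg F i b = j}"
  proof
    fix b assume "b \<in> {b. const_coeff (v b e0) \<noteq> 0}"
    then have nz: "const_coeff (v b e0) \<noteq> 0" by simp
    then have "b \<in> cbasis F i" using chains_basis[OF assms] by (metis const_coeff_zero zero_fun_apply)
    moreover have "v b e0 \<in> homog (int j - int (cdeg F i b))"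
      using chains_mem[OF assms, of b] by (simp add: free_mod_def)
    then have "int j - int (cdeg F i b) = 0" using nz const_coeff_homog by blast
    ultimately show "b \<in> {b \<in> cbasis F i. cdeg F i b = j}" by simp
  qed
qed

lemma tensor_k_diff_const_coeff:
  assumes "finite {b. v b \<noteq> 0}"
  shows "tensor_k_diff F i (\<lambda>b. const_coeff (v b e0)) c = const_coeff (bd i v c e0)"
proof -
  have "tensor_k_diff F i (\<lambda>b. const_coeff (v b e0)) c
     = (\<Sum>b | v b \<noteq> 0. const_coeff (v b e0) * const_coeff (cdiff F i b c))"
    unfolding tensor_k_diff_def using assms by (intro lin_ext_eq) auto
  then show ?thesis
    by (simp add: bd_def sum_fun_apply const_coeff_sum mult.commute)
qed

text \<open>Entries of nonzero degree vanish in \<open>k\<close>, so modulo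
  \<open>max_line e0\<close> a chain is determined by its constant coefficients, and these form the
  complex used by \<open>tor_nonzero\<close>.\<close>

lemma tor_zero_res_field:
  "tor_zero i (int j) (free_mod (\<lambda>_. 0) {e0}) (max_line e0) \<longleftrightarrow>
    tensor_k_cycles F i j \<subseteq> tensor_k_boundaries F i j"
proof
  assume V: "tor_zero i (int j) (free_mod (\<lambda>_. 0) {e0}) (max_line e0)"
  show "tensor_k_cycles F i j \<subseteq> tensor_k_boundaries F i j"
  proof
    fix z assume "z \<in> tensor_k_cycles F i j"
    then have z: "z \<in> tensor_k F i j" "i > 0 \<longrightarrow> tensor_k_diff F i z = (\<lambda>_. 0)"
      by (auto simp: tensor_k_cycles_def)
    let ?v = "res_field_chain e0 z"
    have v: "?v \<in> chains i (int j) (free_mod (\<lambda>_. 0) {e0})" by (rule res_field_chain_chains[OF z(1)])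
    have zv: "z = (\<lambda>b. const_coeff (?v b e0))" by (simp add: res_field_chain_def)
    have cyc: "bd i ?v c \<in> max_line e0 (int j - int (cdeg F i' c))" if i: "i = Suc i'" for i' c
    proof -
      have "const_coeff (bd i ?v c e0) = tensor_k_diff F i z c"
        by (subst zv) (rule tensor_k_diff_const_coeff[OF chains_finite[OF v], symmetric])
      moreover have "bd i ?v c \<in> free_mod (\<lambda>_. 0) {e0} (int j - int (cdeg F i' c))"
        using bd_mem[OF graded_sub_free_mod] v i by blast
      ultimately show ?thesis using z(2) i by (simp add: max_line_def)
    qed
    obtain w where w: "w \<in> chains (Suc i) (int j) (free_mod (\<lambda>_. 0) {e0})"
      "\<And>b. ?v b - bd (Suc i) w b \<in> max_line e0 (int j - int (cdeg F i b))"
      using tor_zeroD[OF V v cyc] by blast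
    have "z b = tensor_k_diff F (Suc i) (\<lambda>b. const_coeff (w b e0)) b" for b
    proof -
      have "const_coeff ((?v b - bd (Suc i) w b) e0) = 0" using w(2)[of b] by (simp add: max_line_def)
      then show ?thesis
        using tensor_k_diff_const_coeff[OF chains_finite[OF w(1)]] zv by (metis const_coeff_minus minus_apply right_minus_eq)
    qed
    then show "z \<in> tensor_k_boundaries F i j"
      unfolding tensor_k_boundaries_def using tensor_k_const_coeff[OF w(1)] by blast
  qed
next
  assume sub: "tensor_k_cycles F i j \<subseteq> tensor_k_boundaries F i j"
  show "tor_zero i (int j) (free_mod (\<lambda>_. 0) {e0}) (max_line e0)"
  proof (rule tor_zeroI)
    fix v assume v: "v \<in> chains i (int j) (free_mod (\<lambda>_. 0) {e0})"
      and cyc: "\<And>i' c. i = Suc i' \<Longrightarrow> bd i v c \<in> max_line e0 (int j - int (cdeg F i' c))"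
    let ?z = "\<lambda>b. const_coeff (v b e0)"
    have "tensor_k_diff F i ?z = (\<lambda>_. 0)" if pos: "i > 0"
    proof
      fix c
      obtain i' where "i = Suc i'" using pos by (cases i) auto
      then have "const_coeff (bd i v c e0) = 0"
        using cyc[of i' c] unfolding max_line_def by blast
      then show "tensor_k_diff F i ?z c = 0"
        using tensor_k_diff_const_coeff[OF chains_finite[OF v], of i e0 c] by (simp only:)
    qed
    then have "?z \<in> tensor_k_cycles F i j"
      using tensor_k_const_coeff[OF v] by (simp add: tensor_k_cycles_def)
    then obtain y where y: "y \<in> tensor_k F (Suc i) j" "?z = tensor_k_diff F (Suc i) y"
      using sub by (auto simp: tensor_k_boundaries_def)
    let ?w = "res_field_chain e0 y"
    have w: "?w \<in> chains (Suc i) (int j) (free_mod (\<lambda>_. 0) {e0})" by (rule res_field_chain_chains[OF y(1)])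
    have yw: "y = (\<lambda>b. const_coeff (?w b e0))" by (simp add: res_field_chain_def)
    have "v b - bd (Suc i) ?w b \<in> max_line e0 (int j - int (cdeg F i b))" for b
    proof -
      have "const_coeff (bd (Suc i) ?w b e0) = tensor_k_diff F (Suc i) y b"
        by (subst yw) (rule tensor_k_diff_const_coeff[OF chains_finite[OF w], symmetric])
      also have "\<dots> = ?z b" using y(2) by metis
      finally have "const_coeff ((v b - bd (Suc i) ?w b) e0) = 0" by simp
      moreover have "v b - bd (Suc i) ?w b \<in> free_mod (\<lambda>_. 0) {e0} (int j - int (cdeg F i b))"
        by (rule graded_sub_diff[OF graded_sub_free_mod chains_mem[OF v] bd_mem[OF graded_sub_free_mod w]])
      ultimately show ?thesis by (simp add: max_line_def)
    qed
    then show "\<exists>w\<in>chains (Suc i) (int j) (free_mod (\<lambda>_. 0) {e0}).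
       \<forall>b. v b - bd (Suc i) w b \<in> max_line e0 (int j - int (cdeg F i b))"
      using w by blast
  qed
qed

text \<open>If \<open>A/B\<close> is annihilated by the variables, then it is a vector space, and it suffices to
  adjoin finitely many elements to \<open>B\<close>, each of which spans a copy of \<open>k\<close> modulo the previous ones.\<close>

definition adjoin :: "int \<times> ('e \<Rightarrow> ('x, 'k) mpoly) \<Rightarrow> (int \<Rightarrow> ('e \<Rightarrow> ('x, 'k) mpoly) set) \<Rightarrow>
    int \<Rightarrow> ('e \<Rightarrow> ('x, 'k) mpoly) set" where
  "adjoin qa B s = (if s = fst qa then {b + smul (Poly_Mapping.single 0 c) (snd qa) | b c. b \<in> B s} else B s)"

lemma adjoinI: "b \<in> B q \<Longrightarrow> b + smul (Poly_Mapping.single 0 c) a \<in> adjoin (q, a) B q"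
  by (auto simp: adjoin_def)

lemma adjoin_supset: "B s \<subseteq> adjoin (q, a) B s"
proof
  fix b assume b: "b \<in> B s"
  have "b + smul (Poly_Mapping.single 0 0) a = b" by simp
  then show "b \<in> adjoin (q, a) B s"
    using b adjoinI[of b B q 0 a] by (cases "s = q") (auto simp: adjoin_def)
qed

lemma adjoin_mem:
  assumes "graded_sub B"
  shows "a \<in> adjoin (q, a) B q"
proof -
  have "0 + smul (Poly_Mapping.single 0 1) a = a" by (simp add: fun_eq_iff)
  then show ?thesis
    using adjoinI[of 0 B q 1 a] graded_sub_0[OF assms, of q] by (simp only:)
qed

lemma adjoin_subset:
  assumes "graded_sub A" "\<And>q. B q \<subseteq> A q" "a \<in> A q"
  shows "adjoin (q, a) B s \<subseteq> A s"
proof -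
  have "b + smul (Poly_Mapping.single 0 c) a \<in> A q" if "b \<in> B q" for b c
    using assms that by (intro graded_sub_add[OF assms(1)] graded_sub_smul[OF assms(1) homog_const assms(3)]) auto
  then show ?thesis using assms(2)[of s] by (auto simp: adjoin_def)
qed

lemma graded_sub_adjoin:
  assumes B: "graded_sub B" and kills: "\<And>s r. s \<noteq> 0 \<Longrightarrow> r \<in> homog s \<Longrightarrow> smul r a \<in> B (s + q)"
  shows "graded_sub (adjoin (q, a) B)"
proof -
  have add: "v + w \<in> adjoin (q, a) B s" if vw: "v \<in> adjoin (q, a) B s" "w \<in> adjoin (q, a) B s" for v w s
  proof (cases "s = q")
    case True
    then obtain b c b' c' where "v = b + smul (Poly_Mapping.single 0 c) a" "b \<in> B q"
      "w = b' + smul (Poly_Mapping.single 0 c') a" "b' \<in> B q"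
      using vw by (auto simp: adjoin_def)
    moreover from this have "v + w = (b + b') + smul (Poly_Mapping.single 0 (c + c')) a"
      by (simp add: single_add smul_add_left)
    ultimately show ?thesis
      using adjoinI[of "b + b'" B q "c + c'" a] graded_sub_add[OF B \<open>b \<in> B q\<close> \<open>b' \<in> B q\<close>] True
      by (simp only:)
  next
    case False
    then show ?thesis using vw graded_sub_add[OF B] by (auto simp: adjoin_def)
  qed
  have scale: "smul r v \<in> adjoin (q, a) B (t + s)" if r: "r \<in> homog t" and v: "v \<in> adjoin (q, a) B s" for r t v s
  proof (cases "s = q")
    case True
    then obtain b c where bc: "v = b + smul (Poly_Mapping.single 0 c) a" "b \<in> B q"
      using v by (auto simp: adjoin_def)
    have eq: "smul r v = smul r b + smul (r * Poly_Mapping.single 0 c) a"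
      by (simp add: bc smul_add_right)
    have rb: "smul r b \<in> B (t + q)" using graded_sub_smul[OF B r bc(2)] by simp
    show ?thesis
    proof (cases "t = 0")
      case t: True
      then have "r * Poly_Mapping.single 0 c = Poly_Mapping.single 0 (const_coeff r * c)"
        using homog_0_eq[of r] r by (metis mult_single add.right_neutral)
      then show ?thesis
        using adjoinI[of "smul r b" B q "const_coeff r * c" a] rb eq t True by (simp only: add_0)
    next
      case False
      have "smul (r * Poly_Mapping.single 0 c) a \<in> B (t + q)"
        using kills[OF False] homog_mult[OF r homog_const[of c]] by simp
      then have "smul r v \<in> B (t + s)" unfolding eq True by (rule graded_sub_add[OF B rb])
      then show ?thesis using adjoin_supset by blast
    qed
  next
    case False
    then have "smul r v \<in> B (t + s)" using v graded_sub_smul[OF B r] by (auto simp: adjoin_def)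
    then show ?thesis using adjoin_supset by blast
  qed
  show ?thesis
    unfolding graded_sub_def using add scale graded_sub_0[OF B] adjoin_supset by blast
qed

lemma tor_zero_trivial:
  assumes "graded_sub A" "\<And>q. A q \<subseteq> B q"
  shows "tor_zero i j A B"
proof (rule tor_zeroI)
  fix v assume v: "v \<in> chains i j A"
  have "v b - bd (Suc i) 0 b \<in> B (j - int (cdeg F i b))" for b
    using chains_mem[OF v, of b] assms(2) by (auto simp: bd_def)
  moreover have "0 \<in> chains (Suc i) j A"
    by (rule chainsI) (auto simp: graded_sub_0[OF assms(1)])
  ultimately show "\<exists>w\<in>chains (Suc i) j A. \<forall>b. v b - bd (Suc i) w b \<in> B (j - int (cdeg F i b))"
    by blast
qed

text \<open>Modulo \<open>B\<close> the element \<open>a\<close> spans either nothing or a copy of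
  \<open>k\<close> in degree \<open>q\<close>, embedded by scaling \<open>a\<close>; injectivity
  holds because a nonzero constant can be inverted.\<close>

lemma tor_zero_adjoin:
  fixes e0 :: 'f and B :: "int \<Rightarrow> ('e \<Rightarrow> ('x, 'k) mpoly) set"
  assumes B: "graded_sub B" and kills: "\<And>s r. s \<noteq> 0 \<Longrightarrow> r \<in> homog s \<Longrightarrow> smul r a \<in> B (s + q)"
    and V: "a \<notin> B q \<Longrightarrow> tor_zero i (j - q) (free_mod (\<lambda>_. 0) {e0}) (max_line e0)"
  shows "tor_zero i j (adjoin (q, a) B) B"
proof (cases "a \<in> B q")
  case True
  show ?thesis
  proof (rule tor_zero_trivial[OF graded_sub_adjoin[OF B kills]])
    show "adjoin (q, a) B s \<subseteq> B s" for s
      by (rule adjoin_subset[OF B]) (use True in auto)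
  qed
next
  case False
  let ?A = "\<lambda>s. free_mod (\<lambda>_. 0) {e0} (s - q) :: ('f \<Rightarrow> ('x, 'k) mpoly) set"
    and ?M = "\<lambda>s. max_line e0 (s - q) :: ('f \<Rightarrow> ('x, 'k) mpoly) set"
  let ?\<phi> = "\<lambda>v :: 'f \<Rightarrow> ('x, 'k) mpoly. smul (v e0) a"
  have shift: "graded_sub (\<lambda>s. C (s - q))" if "graded_sub C" for C :: "int \<Rightarrow> ('f \<Rightarrow> ('x, 'k) mpoly) set"
    using that unfolding graded_sub_def by (simp add: add_diff_eq[symmetric])
  have mem: "?\<phi> v \<in> adjoin (q, a) B s" "?\<phi> v \<in> B s \<longleftrightarrow> v \<in> ?M s" if v: "v \<in> ?A s" for v s
  proof -
    have hom: "v e0 \<in> homog (s - q)" using v by (simp add: free_mod_def)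
    have "?\<phi> v \<in> adjoin (q, a) B s \<and> (?\<phi> v \<in> B s \<longleftrightarrow> v \<in> ?M s)"
    proof (cases "s = q")
      case True
      then have c: "v e0 = Poly_Mapping.single 0 (const_coeff (v e0))"
        using hom homog_0_eq by simp
      let ?c = "const_coeff (v e0)"
      have 1: "?\<phi> v \<in> adjoin (q, a) B s"
        using adjoinI[of 0 B q ?c a] graded_sub_0[OF B, of q] c True by (simp only: add_0)
      have "?c = 0" if "?\<phi> v \<in> B s"
      proof (rule ccontr)
        assume "?c \<noteq> 0"
        then have "a = smul (Poly_Mapping.single 0 (inverse ?c)) (smul (Poly_Mapping.single 0 ?c) a)"
          by (simp add: mult_single fun_eq_iff)
        also have "\<dots> \<in> B q"
          using that True c graded_sub_smul[OF B homog_const[of "inverse ?c"], of "smul (Poly_Mapping.single 0 ?c) a" q q] by simp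
        finally show False using False by simp
      qed
      moreover have "?\<phi> v \<in> B s" if "?c = 0"
        using c that graded_sub_0[OF B] by (simp add: single_zero)
      ultimately have "?\<phi> v \<in> B s \<longleftrightarrow> ?c = 0" by blast
      then show ?thesis using 1 v by (simp add: max_line_def)
    next
      case False
      then have "?\<phi> v \<in> B s" using kills[OF _ hom] by simp
      moreover from this have "?\<phi> v \<in> adjoin (q, a) B s" by (rule subsetD[OF adjoin_supset])
      moreover have "const_coeff (v e0) = 0" using const_coeff_homog[OF hom] False by simp
      ultimately show ?thesis using v by (simp add: max_line_def)
    qed
    then show "?\<phi> v \<in> adjoin (q, a) B s" "?\<phi> v \<in> B s \<longleftrightarrow> v \<in> ?M s" by blast+
  qed
  have lift: "\<exists>x\<in>?A s. y - ?\<phi> x \<in> B s" if y: "y \<in> adjoin (q, a) B s" for y s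
  proof (cases "s = q")
    case True
    then obtain b c where bc: "y = b + smul (Poly_Mapping.single 0 c) a" "b \<in> B s"
      using y by (auto simp: adjoin_def)
    define x where "x = (\<lambda>e. if e = e0 then Poly_Mapping.single 0 c else (0 :: ('x, 'k) mpoly))"
    have "x \<in> ?A s" using True by (simp add: x_def free_mod_def homog_const)
    moreover have "y - ?\<phi> x \<in> B s" using bc by (simp add: x_def)
    ultimately show ?thesis by (intro bexI[of _ x])
  next
    case False
    then have "y - ?\<phi> 0 \<in> B s" using y by (simp add: adjoin_def)
    moreover have "0 \<in> ?A s" by (rule graded_sub_0[OF graded_sub_free_mod])
    ultimately show ?thesis by blast
  qed
  show ?thesis
  proof (rule tor_zero_iso1[where \<phi> = ?\<phi> and A = ?A and B = ?M])
    show "graded_sub ?A" by (rule shift[OF graded_sub_free_mod])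
    show "graded_sub ?M" by (rule shift[OF graded_sub_max_line])
    show "graded_sub (adjoin (q, a) B)" by (rule graded_sub_adjoin[OF B kills])
    show "graded_sub B" by (rule B)
    show "tor_zero i j ?A ?M" unfolding tor_zero_shift by (rule V[OF False])
    show "?\<phi> (v + w) = ?\<phi> v + ?\<phi> w" for v w by (simp add: smul_add_left)
    show "?\<phi> (smul r v) = smul r (?\<phi> v)" for r v by simp
    show "?M s \<subseteq> ?A s" for s by (auto simp: max_line_def)
    show "B s \<subseteq> adjoin (q, a) B s" for s by (rule adjoin_supset)
    show "?\<phi> v \<in> adjoin (q, a) B s" if "v \<in> ?A s" for v s by (rule mem(1)[OF that])
    show "?\<phi> v \<in> B s \<longleftrightarrow> v \<in> ?M s" if "v \<in> ?A s" for v s by (rule mem(2)[OF that])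
    show "\<exists>x\<in>?A s. y - ?\<phi> x \<in> B s" if "y \<in> adjoin (q, a) B s" for y s by (rule lift[OF that])
  qed
qed

lemma tor_zero_killed:
  fixes e0 :: 'f
  assumes A: "graded_sub A" and B: "graded_sub B" and BA: "\<And>q. B q \<subseteq> A q"
    and kills: "\<And>s r v q. s \<noteq> 0 \<Longrightarrow> r \<in> homog s \<Longrightarrow> v \<in> A q \<Longrightarrow> smul r v \<in> B (s + q)"
    and V: "\<And>q. \<not> A q \<subseteq> B q \<Longrightarrow> tor_zero i (j - q) (free_mod (\<lambda>_. 0) {e0}) (max_line e0)"
    and IAB: "ideal_kills A B"
  shows "tor_zero i j A B"
proof (rule tor_zeroI)
  fix v assume v: "v \<in> chains i j A"
    and cyc: "\<And>i' c. i = Suc i' \<Longrightarrow> bd i v c \<in> B (j - int (cdeg F i' c))"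
  have ind: "\<exists>C. graded_sub C \<and> (\<forall>q. B q \<subseteq> C q \<and> C q \<subseteq> A q) \<and> (\<forall>(q, a)\<in>T. a \<in> C q) \<and> tor_zero i j C B"
    if "finite T" "\<forall>(q, a)\<in>T. a \<in> A q" for T
    using that
  proof (induction T rule: finite_induct)
    case empty
    have "tor_zero i j B B" by (rule tor_zero_trivial[OF B]) simp
    then show ?case using B BA by blast
  next
    case (insert qa T)
    obtain q a where qa: "qa = (q, a)" by fastforce
    have a: "a \<in> A q" using insert.prems qa by simp
    obtain C where C: "graded_sub C" "\<And>q. B q \<subseteq> C q" "\<And>q. C q \<subseteq> A q"
      "\<And>q a. (q, a) \<in> T \<Longrightarrow> a \<in> C q" "tor_zero i j C B"
    proof -
      have "\<forall>(q, a)\<in>T. a \<in> A q" using insert.prems by simp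
      from insert.IH[OF this] show thesis using that by (elim exE conjE) blast
    qed
    have killC: "smul r a \<in> C (s + q)" if "s \<noteq> 0" "r \<in> homog s" for s r
      using kills[OF that a] C(2) by blast
    let ?D = "adjoin (q, a) C"
    have D: "graded_sub ?D" by (rule graded_sub_adjoin[OF C(1) killC])
    have DA: "?D s \<subseteq> A s" for s by (rule adjoin_subset[OF A C(3) a])
    have "tor_zero i j ?D C"
    proof (rule tor_zero_adjoin[OF C(1) killC])
      assume "a \<notin> C q"
      then have "\<not> A q \<subseteq> B q" using a C(2) by blast
      then show "tor_zero i (j - q) (free_mod (\<lambda>_. 0) {e0}) (max_line e0)" by (rule V)
    qed
    then have "tor_zero i j ?D B"
      using C(5) by (intro tor_zero_extension[OF D C(1) B adjoin_supset C(2)] ideal_kills_mono[OF IAB DA]) auto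
    moreover have "B s \<subseteq> ?D s" for s using C(2) adjoin_supset by blast
    moreover have "\<forall>(q, a)\<in>insert qa T. a \<in> ?D q"
      using C(4) adjoin_supset adjoin_mem[OF C(1)] qa by blast
    ultimately show ?case using D DA by (intro exI[of _ ?D]) blast
  qed
  \<comment> \<open>A chain has finitely many coefficients; adjoining them to \<open>B\<close>, each
    in its degree, gives a \<open>C\<close> that contains the chain and whose quotient by
    \<open>B\<close> is built from copies of \<open>k\<close>.\<close>
  define T where "T = (\<lambda>b. (j - int (cdeg F i b), v b)) ` {b. v b \<noteq> 0}"
  obtain C where C: "graded_sub C" "\<And>q. B q \<subseteq> C q" "\<And>q. C q \<subseteq> A q"
      "\<And>q a. (q, a) \<in> T \<Longrightarrow> a \<in> C q" "tor_zero i j C B"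
  proof -
    have "finite T" "\<forall>(q, a)\<in>T. a \<in> A q"
      using chains_finite[OF v] chains_mem[OF v] by (auto simp: T_def)
    from ind[OF this] show thesis using that by (elim exE conjE) blast
  qed
  have "v \<in> chains i j C"
  proof (rule chainsI[OF chains_finite[OF v] chains_basis[OF v]])
    show "v b \<in> C (j - int (cdeg F i b))" for b
      using C(4) graded_sub_0[OF C(1)] by (cases "v b = 0") (auto simp: T_def)
  qed auto
  then obtain w where "w \<in> chains (Suc i) j C" "\<And>b. v b - bd (Suc i) w b \<in> B (j - int (cdeg F i b))"
    using tor_zeroD[OF C(5) _ cyc] by blast
  then show "\<exists>w\<in>chains (Suc i) j A. \<forall>b. v b - bd (Suc i) w b \<in> B (j - int (cdeg F i b))"
    using chains_mono C(3) by blast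
qed

text \<open>Applying the augmentation of \<open>F\<close> turns the vanishing of \<open>Tor_0\<close> in degree \<open>j\<close> into
  the absence of generators of degree \<open>j\<close>.\<close>

lemma tor_zero_0_generated:
  assumes A: "graded_sub A" and B: "graded_sub B" and BA: "\<And>q. B q \<subseteq> A q"
    and V: "tor_zero 0 j A B" and a: "a \<in> A j"
  obtains y b where "\<And>x. y x \<in> A (j - 1)" "b \<in> B j" "a = (\<Sum>x\<in>UNIV. smul (var x) (y x)) + b"
proof -
  obtain b0 where b0: "b0 \<in> cbasis F 0" "caug F b0 \<noteq> 0" by (rule caug_nonzero)
  define v where "v = (\<lambda>b. if b = b0 then a else 0)"
  have v: "v \<in> chains 0 j A"
    by (rule chainsI) (use b0 a caug_deg[OF b0] graded_sub_0[OF A] in \<open>auto simp: v_def split: if_splits\<close>)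
  have cyc: "bd 0 v c \<in> B (j - int (cdeg F i' c))" if "0 = Suc i'" for i' c
    using that by simp
  obtain w where w: "w \<in> chains (Suc 0) j A" "\<And>b. v b - bd (Suc 0) w b \<in> B (j - int (cdeg F 0 b))"
    using tor_zeroD[OF V v cyc] by blast
  define S where "S = {b. w b \<noteq> 0}"
  have S: "finite S" "\<And>b. b \<in> S \<Longrightarrow> b \<in> cbasis F (Suc 0)"
    using w(1) by (auto simp: S_def chains_def)
  define T where "T = insert b0 (\<Union>b\<in>S. {c. cdiff F (Suc 0) b c \<noteq> 0})"
  have T: "finite T" "b0 \<in> T" "\<And>b. b \<in> S \<Longrightarrow> {c. cdiff F (Suc 0) b c \<noteq> 0} \<subseteq> T" "T \<subseteq> cbasis F 0"
    using S cdiff_free b0(1) by (auto simp: T_def free_vecs_def)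
  let ?k = "\<lambda>c. Poly_Mapping.single (0 :: 'x \<Rightarrow>\<^sub>0 nat) (c :: 'k)"
  \<comment> \<open>\<open>\<mu> b\<close> is the augmentation applied to the entries of the first
    differential. Its constant term vanishes because the augmentation kills boundaries, so
    \<open>coord\<close> can divide it by the variables. \<open>\<beta>\<close> is the same
    combination of the errors in \<open>B\<close>.\<close>
  define \<mu> where "\<mu> = (\<lambda>b. \<Sum>c\<in>T. ?k (caug F c) * cdiff F (Suc 0) b c)"
  define \<beta> where "\<beta> = (\<Sum>c\<in>T. smul (?k (caug F c)) (v c - bd (Suc 0) w c))"
  have \<beta>: "\<beta> \<in> B j" unfolding \<beta>_def
  proof (rule graded_sub_sum[OF B])
    fix c assume c: "c \<in> T"
    show "smul (?k (caug F c)) (v c - bd (Suc 0) w c) \<in> B j"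
    proof (cases "caug F c = 0")
      case True
      then show ?thesis using graded_sub_0[OF B] by (simp add: single_zero)
    next
      case False
      then have "cdeg F 0 c = 0" using caug_deg c T(4) by blast
      then show ?thesis by (intro graded_sub_smul[OF B homog_const w(2)]) simp
    qed
  qed
  have "\<mu> b \<in> homog (int (cdeg F (Suc 0) b))" "const_coeff (\<mu> b) = 0" if b: "b \<in> S" for b
  proof -
    show "\<mu> b \<in> homog (int (cdeg F (Suc 0) b))"
      unfolding \<mu>_def
    proof (rule homog_sum)
      fix c assume c: "c \<in> T"
      show "?k (caug F c) * cdiff F (Suc 0) b c \<in> homog (int (cdeg F (Suc 0) b))"
      proof (cases "caug F c = 0")
        case False
        then have "cdeg F 0 c = 0" using caug_deg c T(4) by blast
        then show ?thesis by (intro homog_mult'[OF homog_const cdiff_homog[OF S(2)[OF b]]]) simp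
      qed (simp add: single_zero)
    qed
    have "aug_map (caug F) (cdiff F (Suc 0) b) = (\<Sum>c\<in>T. const_coeff (cdiff F (Suc 0) b c) * caug F c)"
      unfolding aug_map_def using T(1) T(3)[OF b] by (intro sum.mono_neutral_left) auto
    then show "const_coeff (\<mu> b) = 0"
      using caug_cdiff[OF S(2)[OF b]] by (simp add: \<mu>_def const_coeff_sum mult.commute)
  qed
  note \<mu> = this
  have "(\<Sum>c\<in>T. smul (?k (caug F c)) (bd (Suc 0) w c)) = (\<Sum>c\<in>T. \<Sum>b\<in>S. smul (?k (caug F c) * cdiff F (Suc 0) b c) (w b))"
    by (simp add: bd_def S_def smul_sum_right)
  also have "\<dots> = (\<Sum>b\<in>S. smul (\<mu> b) (w b))"
    unfolding \<mu>_def smul_sum_left by (rule sum.swap)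
  finally have bdw: "(\<Sum>c\<in>T. smul (?k (caug F c)) (bd (Suc 0) w c)) = (\<Sum>b\<in>S. smul (\<mu> b) (w b))" .
  have "(\<Sum>c\<in>T. smul (?k (caug F c)) (v c)) = (\<Sum>c\<in>T. if c = b0 then smul (?k (caug F b0)) a else 0)"
    by (rule sum.cong) (auto simp: v_def)
  then have "(\<Sum>c\<in>T. smul (?k (caug F c)) (v c)) = smul (?k (caug F b0)) a"
    using T(1,2) by simp
  then have main: "smul (?k (caug F b0)) a = (\<Sum>b\<in>S. smul (\<mu> b) (w b)) + \<beta>"
    unfolding \<beta>_def bdw[symmetric] by (simp add: smul_diff_right sum_subtractf)
  let ?\<kappa> = "?k (inverse (caug F b0))"
  define y where "y = (\<lambda>x. \<Sum>b\<in>S. smul (?\<kappa> * coord (\<mu> b) x) (w b))"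
  have "a = smul (?\<kappa> * ?k (caug F b0)) a"
    using b0(2) by (simp add: mult_single fun_eq_iff)
  also have "\<dots> = smul ?\<kappa> (smul (?k (caug F b0)) a)" by simp
  also have "\<dots> = (\<Sum>b\<in>S. smul (?\<kappa> * \<mu> b) (w b)) + smul ?\<kappa> \<beta>"
    unfolding main by (simp add: smul_add_right smul_sum_right)
  also have "(\<Sum>b\<in>S. smul (?\<kappa> * \<mu> b) (w b)) = (\<Sum>b\<in>S. \<Sum>x\<in>UNIV. smul (var x * (?\<kappa> * coord (\<mu> b) x)) (w b))"
  proof (rule sum.cong[OF refl])
    fix b assume "b \<in> S"
    then have "?\<kappa> * \<mu> b = ?\<kappa> * (\<Sum>x\<in>UNIV. var x * coord (\<mu> b) x)"
      by (simp add: sum_coord \<mu>(2))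
    then show "smul (?\<kappa> * \<mu> b) (w b) = (\<Sum>x\<in>UNIV. smul (var x * (?\<kappa> * coord (\<mu> b) x)) (w b))"
      by (simp add: sum_distrib_left smul_sum_left mult.left_commute)
  qed
  also have "\<dots> = (\<Sum>x\<in>UNIV. smul (var x) (y x))"
    unfolding y_def smul_sum_right smul_smul by (rule sum.swap)
  finally have "a = (\<Sum>x\<in>UNIV. smul (var x) (y x)) + smul ?\<kappa> \<beta>" .
  moreover have "smul ?\<kappa> \<beta> \<in> B j" by (rule graded_sub_smul[OF B homog_const \<beta>]) simp
  moreover have "y x \<in> A (j - 1)" for x
    unfolding y_def
  proof (rule graded_sub_sum[OF A])
    fix b assume "b \<in> S"
    then have "?\<kappa> * coord (\<mu> b) x \<in> homog (0 + (int (cdeg F (Suc 0) b) - 1))"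
      by (intro homog_mult homog_const coord_homog \<mu>(1))
    then show "smul (?\<kappa> * coord (\<mu> b) x) (w b) \<in> A (j - 1)"
      by (rule graded_sub_smul[OF A _ chains_mem[OF w(1)]]) simp
  qed
  ultimately show thesis using that by blast
qed

end

lemma free_mod_cong:
  assumes "\<And>e. e \<in> E \<Longrightarrow> wt e = wt' e"
  shows "free_mod wt E = free_mod wt' E"
proof (intro ext set_eqI)
  fix q and v :: "'a \<Rightarrow> ('b, 'c) mpoly"
  have "v e \<in> homog (q - wt e) \<longleftrightarrow> v e \<in> homog (q - wt' e)" if "e \<notin> E \<longrightarrow> v e = 0" for e
    by (cases "e \<in> E") (use assms that in auto)
  then show "v \<in> free_mod wt E q \<longleftrightarrow> v \<in> free_mod wt' E q"
    by (auto simp: free_mod_def)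
qed

subsection \<open>The Koszul complex on the variables\<close>

text \<open>An element of exterior degree \<open>p\<close> is a function on the sets of \<open>p\<close> variables. The
  signs come from an arbitrary enumeration of the variables.\<close>

definition var_idx :: "'x::finite \<Rightarrow> nat" where
  "var_idx = (SOME f. inj f)"

lemma var_idx_eq_iff [simp]: "var_idx x = var_idx y \<longleftrightarrow> x = y"
proof -
  have "\<exists>f :: 'a \<Rightarrow> nat. inj f"
    using finite_imp_inj_to_nat_seg[OF finite[of "UNIV :: 'a set"]] by blast
  then have "inj (var_idx :: 'a \<Rightarrow> nat)"
    unfolding var_idx_def by (rule someI_ex)
  then show ?thesis by (auto dest: injD)
qed

definition ksign :: "'x::finite \<Rightarrow> 'x set \<Rightarrow> 'a::comm_ring_1" where
  "ksign x A = (- 1) ^ card {y \<in> A. var_idx y < var_idx x}"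

lemma ksign_empty [simp]: "ksign x {} = 1"
  by (simp add: ksign_def)

lemma ksign_square [simp]: "ksign x A * ksign x A = 1"
  by (simp add: ksign_def flip: power_mult_distrib)

lemma ksign_square_left [simp]: "ksign x A * (ksign x A * p) = p"
  by (simp flip: mult.assoc)

lemma ksign_insert:
  assumes "x \<notin> A"
  shows "ksign y (insert x A) = (if var_idx x < var_idx y then - ksign y A else ksign y A)"
proof -
  have "{z \<in> insert x A. var_idx z < var_idx y} =
      (if var_idx x < var_idx y then insert x {z \<in> A. var_idx z < var_idx y} else {z \<in> A. var_idx z < var_idx y})"
    by auto
  then show ?thesis using assms by (simp add: ksign_def)
qed

text \<open>In exactly one of the two orders the insertion changes the sign of the other variable.
  This makes the square of \<open>kdiff\<close> vanish.\<close>

lemma ksign_swap: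
  assumes "x \<notin> A" "y \<notin> A" "x \<noteq> y"
  shows "ksign x A * ksign y (insert x A) = - (ksign y A * ksign x (insert y A))"
proof -
  have "var_idx x < var_idx y \<longleftrightarrow> \<not> var_idx y < var_idx x"
    using assms(3) var_idx_eq_iff[of x y] by linarith
  then show ?thesis by (simp add: ksign_insert assms mult.commute)
qed

lemma ksign_swap':
  assumes "x \<notin> A" "y \<notin> A" "x \<noteq> y"
  shows "ksign y (insert x A) * ksign x (insert y A) = - (ksign x A * ksign y A)"
proof -
  have "var_idx x < var_idx y \<longleftrightarrow> \<not> var_idx y < var_idx x"
    using assms(3) var_idx_eq_iff[of x y] by linarith
  then show ?thesis by (simp add: ksign_insert assms mult.commute)
qed

lemma ksign_homog: "ksign x A \<in> homog 0"
  by (simp add: ksign_def minus_one_power_iff homog_uminus)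

type_synonym ('x, 'k) kvec = "'x set \<Rightarrow> ('x, 'k) mpoly"

text \<open>The usual Koszul differential sends the basis element of a set \<open>B\<close> to a
  signed sum over \<open>x \<in> B\<close> of \<open>var x\<close> times that of
  \<open>B - {x}\<close>; here the result is read off at \<open>A\<close>.\<close>

definition kdiff :: "('x::finite, 'k::field) kvec \<Rightarrow> ('x, 'k) kvec" where
  "kdiff v A = (\<Sum>x\<in>-A. ksign x A * var x * v (insert x A))"

text \<open>Exterior multiplication by the basis element of \<open>x\<close>.\<close>

definition khom :: "'x \<Rightarrow> ('x::finite, 'k::field) kvec \<Rightarrow> ('x, 'k) kvec" where
  "khom x v A = (if x \<in> A then ksign x (A - {x}) * v (A - {x}) else 0)"

lemma kdiff_add: "kdiff (v + w) = kdiff v + kdiff w"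
  by (rule ext) (simp add: kdiff_def distrib_left sum.distrib)

lemma kdiff_smul: "kdiff (smul r v) = smul r (kdiff v)"
  by (rule ext) (simp add: kdiff_def sum_distrib_left mult.left_commute)

lemma kdiff_zero [simp]: "kdiff 0 = 0"
  by (rule ext) (simp add: kdiff_def)

lemma kdiff_uminus: "kdiff (- v) = - kdiff v"
  using kdiff_smul[of "- 1" v] by simp

lemma kdiff_diff: "kdiff (v - w) = kdiff v - kdiff w"
  using kdiff_add[of v "- w"] by (simp only: kdiff_uminus diff_conv_add_uminus)

lemma kdiff_sum: "kdiff (sum f S) = (\<Sum>a\<in>S. kdiff (f a))"
  by (induction S rule: infinite_finite_induct)
     (simp_all only: sum.infinite sum.empty sum.insert kdiff_zero kdiff_add not_False_eq_True)

lemma kdiff_empty: "kdiff v {} = (\<Sum>x\<in>UNIV. var x * v {x})"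
  by (simp add: kdiff_def)

lemma kdiff_kdiff:
  fixes v :: "('x::finite, 'k::field) kvec"
  shows "kdiff (kdiff v) = 0"
proof
  fix A
  define g where "g = (\<lambda>(x, y). ksign x A * ksign y (insert x A) * (var x * var y * v (insert y (insert x A))))"
  \<comment> \<open>Ordered pairs of distinct new variables are split by order; exchanging the two
    entries pairs each term with one of opposite sign.\<close>
  define L where "L = {(x, y). x \<notin> A \<and> y \<notin> A \<and> var_idx x < var_idx y}"
  define U where "U = {(x, y). x \<notin> A \<and> y \<notin> A \<and> var_idx y < var_idx x}"
  have "kdiff (kdiff v) A = (\<Sum>x\<in>-A. \<Sum>y\<in>-insert x A. g (x, y))"
    by (simp add: kdiff_def g_def sum_distrib_left mult_ac)
  also have "\<dots> = (\<Sum>p\<in>(SIGMA x:-A. -insert x A). g p)"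
    by (subst sum.Sigma) auto
  also have "(SIGMA x:-A. -insert x A) = L \<union> U"
    by (auto simp: L_def U_def) (metis linorder_neqE_nat var_idx_eq_iff)
  also have "(\<Sum>p\<in>L \<union> U. g p) = (\<Sum>p\<in>L. g p) + (\<Sum>p\<in>U. g p)"
    by (rule sum.union_disjoint) (auto simp: L_def U_def)
  also have "(\<Sum>p\<in>U. g p) = (\<Sum>p\<in>L. g (prod.swap p))"
    by (rule sum.reindex_bij_witness[of _ prod.swap prod.swap]) (auto simp: L_def U_def)
  also have "\<dots> = (\<Sum>p\<in>L. - g p)"
  proof (rule sum.cong[OF refl])
    fix p assume "p \<in> L"
    then obtain x y where p: "p = (x, y)" "x \<notin> A" "y \<notin> A" "x \<noteq> y" by (auto simp: L_def)
    have "ksign y A * ksign x (insert y A) = (- (ksign x A * ksign y (insert x A)) :: ('x, 'k) mpoly)"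
      by (rule ksign_swap) (use p in auto)
    then show "g (prod.swap p) = - g p"
      by (simp add: p(1) g_def insert_commute mult.commute)
  qed
  finally show "kdiff (kdiff v) A = 0 A" by (simp add: sum_negf)
qed

text \<open>Terms with \<open>y \<noteq> x\<close> cancel or vanish, and the term with
  \<open>y = x\<close> leaves \<open>var x * v A\<close>. So multiplication by a variable is
  null-homotopic, which is why the variables annihilate Koszul homology.\<close>

lemma khom_homotopy: "kdiff (khom x v) + khom x (kdiff v) = smul (var x) v"
proof
  fix A
  show "(kdiff (khom x v) + khom x (kdiff v)) A = smul (var x) v A"
  proof (cases "x \<in> A")
    case True
    define B where "B = A - {x}"
    have B: "A = insert x B" "x \<notin> B" using True by (auto simp: B_def)
    have C: "- B = insert x (- A)" "x \<notin> - A" using B by auto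
    have "khom x (kdiff v) A = ksign x B * (\<Sum>y\<in>-B. ksign y B * var y * v (insert y B))"
      using True by (simp add: khom_def B_def kdiff_def)
    also have "\<dots> = ksign x B * ksign x B * var x * v A + (\<Sum>y\<in>-A. ksign x B * ksign y B * var y * v (insert y B))"
      unfolding C(1) using C(2) B(1)[symmetric] by (simp add: sum_distrib_left distrib_left mult.assoc)
    finally have 1: "khom x (kdiff v) A = var x * v A + (\<Sum>y\<in>-A. ksign x B * ksign y B * var y * v (insert y B))"
      by (simp only: ksign_square mult_1_left)
    have "kdiff (khom x v) A = (\<Sum>y\<in>-A. - (ksign x B * ksign y B * var y * v (insert y B)))"
      unfolding kdiff_def
    proof (rule sum.cong[OF refl])
      fix y assume "y \<in> - A"
      then have y: "y \<notin> B" "x \<noteq> y" using B by auto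
      have "insert y A - {x} = insert y B" using B y by auto
      then have "ksign y A * var y * khom x v (insert y A)
          = (ksign y (insert x B) * ksign x (insert y B)) * (var y * v (insert y B))"
        using B(1) by (simp add: khom_def mult_ac)
      then show "ksign y A * var y * khom x v (insert y A) = - (ksign x B * ksign y B * var y * v (insert y B))"
        by (simp only: ksign_swap'[OF B(2) y] mult_minus_left mult.assoc)
    qed
    then show ?thesis using 1 by (simp add: sum_negf)
  next
    case False
    have "kdiff (khom x v) A = (\<Sum>y\<in>-A. if y = x then var x * v A else 0)"
      unfolding kdiff_def
    proof (rule sum.cong[OF refl])
      fix y assume "y \<in> - A"
      show "ksign y A * var y * khom x v (insert y A) = (if y = x then var x * v A else 0)"
      proof (cases "y = x")
        case True
        have "insert x A - {x} = A" using False by simp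
        then have "ksign y A * var y * khom x v (insert y A) = (ksign x A * ksign x A) * (var x * v A)"
          using True by (simp add: khom_def mult_ac)
        then show ?thesis using True by simp
      qed (use False in \<open>simp add: khom_def\<close>)
    qed
    then show ?thesis using False by (simp add: khom_def)
  qed
qed

abbreviation kwt :: "'x set \<Rightarrow> int" where "kwt \<equiv> (\<lambda>A. int (card A))"

abbreviation koszul :: "nat \<Rightarrow> int \<Rightarrow> ('x::finite, 'k::field) kvec set" where
  "koszul p \<equiv> free_mod kwt {A. card A = p}"

lemma kdiff_koszul:
  assumes "v \<in> koszul (Suc p) q"
  shows "kdiff v \<in> koszul p q"
proof -
  have "ksign x A * var x * v (insert x A) \<in> homog (q - int (card A))" if "x \<notin> A" for x A
  proof -
    have "v (insert x A) \<in> homog (q - int (card (insert x A)))" using assms unfolding free_mod_def by blast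
    then have "ksign x A * var x * v (insert x A) \<in> homog ((0 + 1) + (q - int (card (insert x A))))"
      by (intro homog_mult ksign_homog homog_var)
    then show ?thesis using that by simp
  qed
  moreover have "v (insert x A) = 0" if "x \<notin> A" "card A \<noteq> p" for x A
    using assms that by (simp add: free_mod_def)
  ultimately show ?thesis
    by (auto simp: free_mod_def kdiff_def intro!: homog_sum sum.neutral)
qed

lemma khom_koszul:
  assumes "v \<in> koszul p q"
  shows "khom x v \<in> koszul (Suc p) (q + 1)"
proof -
  have "khom x v A \<in> homog (q + 1 - int (card A))" for A
  proof (cases "x \<in> A")
    case True
    then have "int (card A) = int (card (A - {x})) + 1"
      by (metis card.remove finite of_nat_Suc add.commute)
    moreover have "ksign x (A - {x}) * v (A - {x}) \<in> homog (0 + (q - int (card (A - {x}))))"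
      using assms by (intro homog_mult ksign_homog) (simp add: free_mod_def)
    moreover have "0 + (q - int (card (A - {x}))) = q + 1 - int (card A)"
      using calculation(1) by linarith
    ultimately show ?thesis using True by (simp only: khom_def if_True)
  qed (simp add: khom_def)
  moreover have "khom x v A = 0" if "card A \<noteq> Suc p" for A
  proof (cases "x \<in> A")
    case True
    then have "card (A - {x}) \<noteq> p" using that by (metis card.remove finite)
    then have "v (A - {x}) = 0" using assms unfolding free_mod_def by blast
    then show ?thesis by (simp add: khom_def)
  qed (simp add: khom_def)
  ultimately show ?thesis by (simp add: free_mod_def)
qed

text \<open>Exactness in exterior degree 1: \<open>koszul_lift\<close> is a section of the differential, and every
  element of degree 1 is a boundary plus an element in the image of the section.\<close>

definition koszul_lift :: "('x::finite, 'k::field) mpoly \<Rightarrow> ('x, 'k) kvec" where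
  "koszul_lift p A = (\<Sum>x\<in>UNIV. if A = {x} then coord p x else 0)"

lemma koszul_lift_singleton [simp]: "koszul_lift p {x} = coord p x"
  by (simp add: koszul_lift_def)

lemma koszul_lift_other: "(\<And>x. A \<noteq> {x}) \<Longrightarrow> koszul_lift p A = 0"
  by (simp add: koszul_lift_def)

lemma koszul_lift_koszul: "p \<in> homog q \<Longrightarrow> koszul_lift p \<in> koszul 1 q"
  by (auto simp: free_mod_def koszul_lift_def card_1_singleton_iff intro!: homog_sum coord_homog sum.neutral)

lemma koszul_lift_add: "koszul_lift (p + q) = koszul_lift p + koszul_lift q"
  by (rule ext) (simp add: koszul_lift_def coord_add sum.distrib[symmetric] if_distrib cong: if_cong)

lemma koszul_lift_zero: "koszul_lift 0 = 0"
  by (rule ext) (simp add: koszul_lift_def cong: if_cong)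

lemma kdiff_koszul_lift: "const_coeff p = 0 \<Longrightarrow> kdiff (koszul_lift p) {} = p"
  by (simp add: kdiff_empty sum_coord)

text \<open>Write \<open>t x_i = t' x_k\<close> with \<open>k\<close> the variable picked by the
  section. If \<open>k \<noteq> i\<close>, then \<open>t = s x_k\<close> and
  \<open>t' = s x_i\<close>, and the difference of the two elements is \<open>s\<close> times the
  Koszul relation between \<open>x_i\<close> and \<open>x_k\<close>.\<close>

lemma koszul_exact_single:
  fixes i :: "'x::finite" and c :: "'k::field" and t :: "'x \<Rightarrow>\<^sub>0 nat"
  defines "m \<equiv> (\<lambda>A. if A = {i} then Poly_Mapping.single t c else 0)"
  assumes q: "int (mono_deg t) = q - 1"
  shows "\<exists>u\<in>koszul 2 q. m - koszul_lift (kdiff m {}) = kdiff u"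
proof -
  have "kdiff m {} = (\<Sum>x\<in>UNIV. if x = i then Poly_Mapping.single (t + expo i) c else 0)"
    unfolding kdiff_empty by (rule sum.cong) (auto simp: m_def single_add_expo mult.commute simp del: One_nat_def)
  then have km: "kdiff m {} = Poly_Mapping.single (t + expo i) c" by simp
  have "mono_deg (t + expo i) \<noteq> 0" by simp
  then have nz: "t + expo i \<noteq> 0" by (metis mono_deg_zero)
  define k where "k = pick_var (t + expo i)"
  obtain t' where t': "t + expo i = t' + expo k"
    "\<And>x (c :: 'k). coord (Poly_Mapping.single (t + expo i) c) x = (if x = k then Poly_Mapping.single t' c else 0)"
    using coord_single[OF nz, where ?'k = 'k] unfolding k_def by blast
  have lift: "koszul_lift (kdiff m {}) = (\<lambda>A. if A = {k} then Poly_Mapping.single t' c else 0)"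
    unfolding km
  proof
    fix A :: "'x set"
    show "koszul_lift (Poly_Mapping.single (t + expo i) c) A = (if A = {k} then Poly_Mapping.single t' c else 0)"
    proof (cases "\<exists>x. A = {x}")
      case True
      then show ?thesis using t'(2) by (auto simp del: One_nat_def split: if_splits)
    next
      case False
      then show ?thesis by (auto intro: koszul_lift_other)
    qed
  qed
  show ?thesis
  proof (cases "k = i")
    case True
    then have "t' = t" using t'(1) by simp
    then have "m - koszul_lift (kdiff m {}) = kdiff 0"
      unfolding lift by (simp add: True m_def fun_eq_iff)
    then show ?thesis using graded_sub_0[OF graded_sub_free_mod] by blast
  next
    case False
    have tk: "Poly_Mapping.lookup t k \<noteq> 0"
      using arg_cong[OF t'(1), of "\<lambda>s. Poly_Mapping.lookup s k"] False
      by (simp add: lookup_add lookup_single)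
    obtain s where s: "t = s + expo k" by (rule split_expo[OF tk])
    have s': "t' = s + expo i"
    proof -
      have "t' + expo k = (s + expo i) + expo k" using t'(1) s by (metis add.assoc add.commute)
      then show ?thesis by (metis add_right_cancel)
    qed
    define u where "u = (\<lambda>A. if A = {i, k} then ksign k {i} * Poly_Mapping.single s c else 0)"
    have "int (mono_deg s) = q - 2" using q s by simp
    then have "u \<in> koszul 2 q"
      using False homog_mult'[OF ksign_homog[of k "{i}"] homog_single[of s c], of "q - 2"]
      by (simp add: free_mod_def u_def)
    moreover have "m - koszul_lift (kdiff m {}) = kdiff u"
    proof
      fix A :: "'x set"
      have summand: "ksign y A * var y * u (insert y A) =
         (if y = k \<and> A = {i} then Poly_Mapping.single t c else if y = i \<and> A = {k} then - Poly_Mapping.single t' c else 0)"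
        if "y \<notin> A" for y
      proof (cases "insert y A = {i, k}")
        case True
        then have "A = {i, k} - {y}" "y = i \<or> y = k" using that by auto
        then consider "y = k" "A = {i}" | "y = i" "A = {k}" using False by auto
        then show ?thesis
        proof cases
          case 1
          have "ksign k {i} * var k * (ksign k {i} * Poly_Mapping.single s c)
            = (ksign k {i} * ksign k {i}) * (Poly_Mapping.single s c * var k)"
            by (simp only: mult_ac)
          then have "ksign k {i} * var k * (ksign k {i} * Poly_Mapping.single s c) = Poly_Mapping.single t c"
            unfolding ksign_square s single_add_expo by simp
          then show ?thesis using 1 by (simp add: u_def insert_commute)
        next
          case 2
          have "ksign i {k} * ksign k {i} = (- 1 :: ('x, 'k) mpoly)"
          proof -
            have "ksign i {k} * ksign k {i} = (- (ksign k {} * ksign i {}) :: ('x, 'k) mpoly)"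
              using False by (intro ksign_swap') auto
            then show ?thesis by (simp only: ksign_empty mult_1)
          qed
          moreover have "ksign i {k} * var i * (ksign k {i} * Poly_Mapping.single s c)
            = (ksign i {k} * ksign k {i}) * (Poly_Mapping.single s c * var i)"
            by (simp only: mult_ac)
          ultimately have "ksign i {k} * var i * (ksign k {i} * Poly_Mapping.single s c) = - Poly_Mapping.single t' c"
            unfolding s' single_add_expo by simp
          then show ?thesis using 2 False by (simp add: u_def)
        qed
      next
        case no: False
        then have "\<not> (y = k \<and> A = {i})" "\<not> (y = i \<and> A = {k})" by auto
        then show ?thesis using no by (simp only: u_def if_False mult_zero_right)
      qed
      have "kdiff u A = (\<Sum>y\<in>-A. if y = k \<and> A = {i} then Poly_Mapping.single t c
         else if y = i \<and> A = {k} then - Poly_Mapping.single t' c else 0)"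
        unfolding kdiff_def using summand by (intro sum.cong) auto
      also have "\<dots> = (if A = {i} then Poly_Mapping.single t c else if A = {k} then - Poly_Mapping.single t' c else 0)"
      proof -
        consider "A = {i}" | "A = {k}" "A \<noteq> {i}" | "A \<noteq> {i}" "A \<noteq> {k}" by blast
        then show ?thesis
        proof cases
          case 1
          then have "A \<noteq> {k}" using False by simp
          then show ?thesis using 1 False by (simp only: simp_thms if_True if_False sum.delta finite) simp
        next
          case 2
          then show ?thesis using False by (simp only: simp_thms if_True if_False sum.delta finite) simp
        next
          case 3
          then show ?thesis by (simp only: simp_thms if_False sum.neutral_const)
        qed
      qed
      finally show "(m - koszul_lift (kdiff m {})) A = kdiff u A"
        unfolding lift using False by (simp add: m_def)
    qed
    ultimately show ?thesis by blast
  qed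
qed

text \<open>Both sides are additive in \<open>v\<close>, which reduces the claim to one monomial in
  one component. If \<open>kdiff v {} = 0\<close>, the section contributes nothing and
  \<open>v\<close> is a boundary.\<close>

lemma koszul_exact_1:
  fixes v :: "('x::finite, 'k::field) kvec"
  assumes v: "v \<in> koszul 1 q"
  shows "\<exists>u\<in>koszul 2 q. v - koszul_lift (kdiff v {}) = kdiff u"
proof -
  define P where "P = {v :: ('x, 'k) kvec. \<exists>u\<in>koszul 2 q. v - koszul_lift (kdiff v {}) = kdiff u}"
  have P0: "0 \<in> P" unfolding P_def
    using graded_sub_0[OF graded_sub_free_mod[of kwt "{A. card A = 2}"]]
    by (auto simp: koszul_lift_zero intro!: bexI[of _ 0])
  have Padd: "v + w \<in> P" if vw: "v \<in> P" "w \<in> P" for v w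
  proof -
    obtain u u' where u: "u \<in> koszul 2 q" "v - koszul_lift (kdiff v {}) = kdiff u"
      "u' \<in> koszul 2 q" "w - koszul_lift (kdiff w {}) = kdiff u'"
      using vw by (auto simp: P_def)
    have "(v + w) - koszul_lift (kdiff (v + w) {}) = (v - koszul_lift (kdiff v {})) + (w - koszul_lift (kdiff w {}))"
      by (simp only: kdiff_add plus_fun_apply koszul_lift_add) (rule add_diff_add)
    also have "\<dots> = kdiff (u + u')" by (simp only: u kdiff_add)
    finally show ?thesis using graded_sub_add[OF graded_sub_free_mod u(1,3)] unfolding P_def by blast
  qed
  have Psum: "sum f S \<in> P" if "finite S" "\<And>a. a \<in> S \<Longrightarrow> f a \<in> P" for f and S :: "'c set"
    using that
  proof (induction S rule: finite_induct)
    case empty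
    then show ?case using P0 by (simp only: sum.empty)
  next
    case (insert a S)
    then have "f a + sum f S \<in> P" by (intro Padd) auto
    then show ?case unfolding sum.insert[OF insert.hyps] .
  qed
  let ?m = "\<lambda>x t A. if A = {x} then Poly_Mapping.single t (Poly_Mapping.lookup (v {x}) t) else 0"
  have "?m x t \<in> P" if "t \<in> Poly_Mapping.keys (v {x})" for x t
  proof -
    have "v {x} \<in> homog (q - 1)" using v by (auto simp: free_mod_def dest: spec[of _ "{x}"])
    then have "int (mono_deg t) = q - 1" using that by (simp add: homog_def)
    then show ?thesis unfolding P_def mem_Collect_eq by (rule koszul_exact_single)
  qed
  then have "(\<Sum>x\<in>UNIV. \<Sum>t\<in>Poly_Mapping.keys (v {x}). ?m x t) \<in> P"
    by (intro Psum) auto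
  moreover have "(\<Sum>x\<in>UNIV. \<Sum>t\<in>Poly_Mapping.keys (v {x}). ?m x t) = v"
  proof
    fix A
    have "(\<Sum>x\<in>UNIV. \<Sum>t\<in>Poly_Mapping.keys (v {x}). ?m x t) A
       = (\<Sum>x\<in>UNIV. if A = {x} then v {x} else 0)"
      unfolding sum_fun_apply by (intro sum.cong refl) (auto simp: sum_monomials)
    also have "\<dots> = v A"
    proof (cases "\<exists>x. A = {x}")
      case False
      then have "v A = 0" using v by (auto simp: free_mod_def card_1_singleton_iff)
      then show ?thesis using False by simp
    qed auto
    finally show "(\<Sum>x\<in>UNIV. \<Sum>t\<in>Poly_Mapping.keys (v {x}). ?m x t) A = v A" .
  qed
  ultimately have "v \<in> P" by (simp only:)
  then show ?thesis by (simp add: P_def)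
qed

subsection \<open>Koszul homology modulo the ideal\<close>

context graded_ideal
begin

abbreviation koszul_ideal :: "nat \<Rightarrow> int \<Rightarrow> ('x, 'k) kvec set" where
  "koszul_ideal p \<equiv> ideal_mod kwt {A. card A = p}"

text \<open>Cycles and boundaries of \<open>K\<close> tensored with \<open>R\<close> are pulled back
  to the Koszul complex over \<open>S\<close>. Both contain \<open>I K_p\<close>, and
  \<open>koszul_cycles p\<close> modulo \<open>koszul_bounds p\<close> is
  \<open>H_p(K)\<close>.\<close>

definition koszul_cycles :: "nat \<Rightarrow> int \<Rightarrow> ('x, 'k) kvec set" where
  "koszul_cycles p q = {v \<in> koszul p q. \<forall>A. kdiff v A \<in> I}"

definition koszul_bounds :: "nat \<Rightarrow> int \<Rightarrow> ('x, 'k) kvec set" where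
  "koszul_bounds p q = {kdiff u + w | u w. u \<in> koszul (Suc p) q \<and> w \<in> koszul_ideal p q}"

lemma kdiff_mem_ideal: "(\<And>A. v A \<in> I) \<Longrightarrow> kdiff v A \<in> I"
  unfolding kdiff_def by (intro sum_mem mult_mem)

lemma graded_sub_koszul_cycles: "graded_sub (koszul_cycles p)"
  using graded_sub_free_mod[of kwt "{A. card A = p}"]
  by (auto simp: graded_sub_def koszul_cycles_def kdiff_add kdiff_smul zero_mem intro: add_mem mult_mem)

lemma graded_sub_koszul_bounds: "graded_sub (koszul_bounds p)"
  unfolding graded_sub_def
proof (intro conjI allI ballI)
  note K = graded_sub_free_mod[of kwt "{A. card A = Suc p}"]
    and J = graded_sub_ideal_mod[of kwt "{A. card A = p}"]
  show "0 \<in> koszul_bounds p q" for q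
  proof -
    have "0 = kdiff 0 + 0" by simp
    then show ?thesis unfolding koszul_bounds_def using graded_sub_0[OF K] graded_sub_0[OF J] by blast
  qed
  show "v + w \<in> koszul_bounds p q" if vw: "v \<in> koszul_bounds p q" "w \<in> koszul_bounds p q" for v w q
  proof -
    obtain a b c d where "v = kdiff a + b" "w = kdiff c + d" "a \<in> koszul (Suc p) q" "b \<in> koszul_ideal p q"
      "c \<in> koszul (Suc p) q" "d \<in> koszul_ideal p q"
      using vw unfolding koszul_bounds_def by blast
    moreover from this have "v + w = kdiff (a + c) + (b + d)"
      by (simp only: kdiff_add ac_simps)
    ultimately show ?thesis unfolding koszul_bounds_def
      using graded_sub_add[OF K] graded_sub_add[OF J] by blast
  qed
  show "smul r v \<in> koszul_bounds p (s + q)" if r: "r \<in> homog s" and v: "v \<in> koszul_bounds p q" for r s v q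
  proof -
    obtain a b where "v = kdiff a + b" "a \<in> koszul (Suc p) q" "b \<in> koszul_ideal p q"
      using v unfolding koszul_bounds_def by blast
    moreover from this have "smul r v = kdiff (smul r a) + smul r b"
      by (simp only: kdiff_smul smul_add_right)
    ultimately show ?thesis unfolding koszul_bounds_def
      using graded_sub_smul[OF K r _ refl] graded_sub_smul[OF J r _ refl] by blast
  qed
qed

lemma koszul_ideal_subset_bounds: "koszul_ideal p q \<subseteq> koszul_bounds p q"
proof
  fix w assume "w \<in> koszul_ideal p q"
  moreover have "w = kdiff 0 + w" by simp
  ultimately show "w \<in> koszul_bounds p q"
    unfolding koszul_bounds_def using graded_sub_0[OF graded_sub_free_mod] by blast
qed

lemma koszul_bounds_subset_cycles: "koszul_bounds p q \<subseteq> koszul_cycles p q"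
proof
  fix v assume "v \<in> koszul_bounds p q"
  then obtain u w where uw: "v = kdiff u + w" "u \<in> koszul (Suc p) q" "w \<in> koszul_ideal p q"
    unfolding koszul_bounds_def by blast
  have "v \<in> koszul p q"
    unfolding uw(1) using uw(3) by (intro graded_sub_add[OF graded_sub_free_mod] kdiff_koszul uw(2)) (simp add: ideal_mod_def)
  moreover have "kdiff v A \<in> I" for A
    using uw(3) kdiff_mem_ideal[of w] by (simp add: uw(1) kdiff_add kdiff_kdiff ideal_mod_def)
  ultimately show "v \<in> koszul_cycles p q" by (simp add: koszul_cycles_def)
qed

lemma koszul_bounds_subset: "koszul_bounds p q \<subseteq> koszul p q"
  using koszul_bounds_subset_cycles by (fastforce simp: koszul_cycles_def)

text \<open>By the homotopy, \<open>x v\<close> is the boundary of \<open>khom x v\<close> plus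
  \<open>khom x (kdiff v)\<close>, and the latter has coefficients in \<open>I\<close> because
  \<open>v\<close> is a cycle modulo \<open>I\<close>.\<close>

lemma var_smul_koszul_cycles:
  assumes "v \<in> koszul_cycles p q"
  shows "smul (var x) v \<in> koszul_bounds p (q + 1)"
proof -
  have v: "v \<in> koszul p q" "\<And>A. kdiff v A \<in> I" using assms by (auto simp: koszul_cycles_def)
  have "smul (var x) v \<in> koszul p (q + 1)"
    by (rule graded_sub_smul[OF graded_sub_free_mod homog_var v(1)]) simp
  moreover have "kdiff (khom x v) \<in> koszul p (q + 1)" by (rule kdiff_koszul[OF khom_koszul[OF v(1)]])
  ultimately have "smul (var x) v - kdiff (khom x v) \<in> koszul p (q + 1)"
    by (rule graded_sub_diff[OF graded_sub_free_mod])
  then have "khom x (kdiff v) \<in> koszul p (q + 1)"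
    by (metis add_diff_cancel_left' khom_homotopy)
  moreover have "khom x (kdiff v) A \<in> I" for A
    using v(2) by (simp add: khom_def mult_mem zero_mem)
  ultimately have "khom x (kdiff v) \<in> koszul_ideal p (q + 1)" by (simp add: ideal_mod_def)
  then show ?thesis
    unfolding koszul_bounds_def khom_homotopy[symmetric] using khom_koszul[OF v(1), of x] by blast
qed

lemma smul_koszul_cycles:
  assumes r: "r \<in> homog s" "s \<noteq> 0" and v: "v \<in> koszul_cycles p q"
  shows "smul r v \<in> koszul_bounds p (s + q)"
proof -
  have "r = (\<Sum>x\<in>UNIV. var x * coord r x)"
    using const_coeff_homog[OF r] by (simp add: sum_coord)
  then have "smul r v = (\<Sum>x\<in>UNIV. smul (coord r x) (smul (var x) v))"
    by (metis (no_types, lifting) mult.commute smul_smul smul_sum_left sum.cong)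
  also have "\<dots> \<in> koszul_bounds p (s + q)"
    by (intro graded_sub_sum[OF graded_sub_koszul_bounds]
        graded_sub_smul[OF graded_sub_koszul_bounds coord_homog[OF r(1)] var_smul_koszul_cycles[OF v]]) auto
  finally show ?thesis .
qed

lemma koszul_0: "koszul 0 = free_mod (\<lambda>_. 0) {{} :: 'x set}"
proof -
  have E: "{A :: 'x set. card A = 0} = {{}}" by auto
  show ?thesis unfolding E by (rule free_mod_cong) simp
qed

text \<open>Boundaries of exterior degree 0 are the combinations of the variables, and
  \<open>I\<close> has no constant terms. So \<open>K_0\<close> modulo boundaries is
  \<open>k\<close>, the start of the dimension shift.\<close>

lemma koszul_bounds_0:
  assumes "\<And>p. p \<in> I \<Longrightarrow> const_coeff p = 0"
  shows "koszul_bounds 0 q = max_line {} q"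
proof
  show "koszul_bounds 0 q \<subseteq> max_line {} q"
  proof
    fix v assume v: "v \<in> koszul_bounds 0 q"
    then obtain u w where uw: "v = kdiff u + w" "w \<in> koszul_ideal 0 q"
      unfolding koszul_bounds_def by blast
    have "const_coeff (var x) = (0 :: 'k)" for x :: 'x
      by (rule const_coeff_homog[OF homog_var]) simp
    then have "const_coeff (kdiff u {}) = 0"
      by (simp add: kdiff_empty const_coeff_sum)
    moreover have "const_coeff (w {}) = 0" using uw(2) assms by (simp add: ideal_mod_def)
    ultimately have "const_coeff (v {}) = 0" using uw(1) by simp
    then show "v \<in> max_line {} q"
      using v koszul_bounds_subset unfolding max_line_def koszul_0[symmetric] by blast
  qed
  show "max_line {} q \<subseteq> koszul_bounds 0 q"
  proof
    fix v :: "('x, 'k) kvec" assume v: "v \<in> max_line {} q"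
    then have v0: "v {} \<in> homog q" "const_coeff (v {}) = 0" "\<And>A. A \<noteq> {} \<Longrightarrow> v A = 0"
      by (auto simp: max_line_def free_mod_def dest: spec[of _ "{}"])
    have K: "koszul_lift (v {}) \<in> koszul (Suc 0) q" using koszul_lift_koszul[OF v0(1)] by simp
    have "kdiff (koszul_lift (v {})) A = v A" for A
    proof (cases "A = {}")
      case True
      then show ?thesis using kdiff_koszul_lift[OF v0(2)] by simp
    next
      case False
      then show ?thesis using kdiff_koszul[OF K] v0(3) by (simp add: free_mod_def)
    qed
    then have "v = kdiff (koszul_lift (v {})) + 0" by (simp add: fun_eq_iff)
    then show "v \<in> koszul_bounds 0 q"
      unfolding koszul_bounds_def using K graded_sub_0[OF graded_sub_ideal_mod] by blast
  qed
qed

end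

subsection \<open>Bounding the degrees of Tor\<close>

context resolution
begin

abbreviation tor_k_zero :: "nat \<Rightarrow> int \<Rightarrow> bool" where
  "tor_k_zero i j \<equiv> tor_zero i j (free_mod (\<lambda>_. 0) {{} :: 'x set}) (max_line {})"

lemma ideal_kills_koszul:
  "(\<And>q. A q \<subseteq> koszul p q) \<Longrightarrow> (\<And>q. koszul_ideal p q \<subseteq> B q) \<Longrightarrow> ideal_kills A B"
  by (rule ideal_kills_mono[OF ideal_kills_free_mod])

lemma koszul_cycles_subset: "koszul_cycles p q \<subseteq> koszul p q"
  by (auto simp: koszul_cycles_def)

lemma koszul_ideal_subset_cycles: "koszul_ideal p q \<subseteq> koszul_cycles p q"
  using koszul_ideal_subset_bounds koszul_bounds_subset_cycles by blast

text \<open>\<open>kdiff\<close> maps \<open>K_(p+1)\<close> onto the boundaries modulo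
  \<open>I\<close>, and its kernel modulo \<open>I\<close> is
  \<open>koszul_cycles (Suc p)\<close>.\<close>

lemma koszul_bounds_iso:
  shows "tor_zero i j (koszul (Suc p)) (koszul_cycles (Suc p)) \<Longrightarrow> tor_zero i j (koszul_bounds p) (koszul_ideal p)"
    and "tor_zero i j (koszul_bounds p) (koszul_ideal p) \<Longrightarrow> tor_zero i j (koszul (Suc p)) (koszul_cycles (Suc p))"
proof -
  have img: "kdiff v \<in> koszul_bounds p q" if "v \<in> koszul (Suc p) q" for v q
  proof -
    have "kdiff v = kdiff v + 0" by simp
    then show ?thesis unfolding koszul_bounds_def using that graded_sub_0[OF graded_sub_ideal_mod] by blast
  qed
  have lift: "\<exists>u\<in>koszul (Suc p) q. v - kdiff u \<in> koszul_ideal p q" if v: "v \<in> koszul_bounds p q" for v q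
  proof -
    obtain u w where "v = kdiff u + w" "u \<in> koszul (Suc p) q" "w \<in> koszul_ideal p q"
      using v unfolding koszul_bounds_def by blast
    then have "u \<in> koszul (Suc p) q" "v - kdiff u \<in> koszul_ideal p q" by auto
    then show ?thesis by (intro bexI[of _ u])
  qed
  have iff: "kdiff v \<in> koszul_ideal p q \<longleftrightarrow> v \<in> koszul_cycles (Suc p) q" if "v \<in> koszul (Suc p) q" for v q
    using that kdiff_koszul by (auto simp: ideal_mod_def koszul_cycles_def)
  note iso = graded_sub_free_mod graded_sub_koszul_cycles graded_sub_koszul_bounds graded_sub_ideal_mod
    kdiff_add kdiff_smul img lift iff koszul_cycles_subset koszul_ideal_subset_bounds
  show "tor_zero i j (koszul (Suc p)) (koszul_cycles (Suc p)) \<Longrightarrow> tor_zero i j (koszul_bounds p) (koszul_ideal p)"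
    by (rule tor_zero_iso1[where \<phi> = kdiff]) (rule iso | assumption)+
  show "tor_zero i j (koszul_bounds p) (koszul_ideal p) \<Longrightarrow> tor_zero i j (koszul (Suc p)) (koszul_cycles (Suc p))"
    by (rule tor_zero_iso2[where \<phi> = kdiff]) (rule iso | assumption)+
qed

text \<open>Write \<open>Z_p\<close> and \<open>B_p\<close> for cycles and boundaries over
  \<open>R\<close>. As \<open>B_p\<close> is \<open>K_(p+1)/Z_(p+1)\<close>,
  \<open>Tor_(i+1)(k, B_p)\<close> embeds into \<open>Tor_i(k, Z_(p+1))\<close>, and
  \<open>Z_(p+1)\<close> is an extension of the vector space \<open>H_(p+1)\<close> by
  \<open>B_(p+1)\<close>. Iteration ends at \<open>Tor_0(k, B_(p+i))\<close>, a quotient of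
  \<open>Tor_0(k, K_(p+i+1))\<close>, which lives in degree \<open>p + i + 1\<close>.\<close>

lemma tor_zero_koszul_bounds:
  assumes "\<And>s q. 1 \<le> s \<Longrightarrow> s \<le> i \<Longrightarrow> \<not> koszul_cycles (p + s) q \<subseteq> koszul_bounds (p + s) q \<Longrightarrow>
      tor_k_zero (i - s) (j - q)"
    and "j \<noteq> int p + 1 + int i"
  shows "tor_zero i j (koszul_bounds p) (koszul_ideal p)"
  using assms
proof (induction i arbitrary: p)
  case 0
  have "tor_zero 0 j (koszul (Suc p)) (koszul_ideal (Suc p))"
    using 0 by (intro tor_zero_free_mod) auto
  then have "tor_zero 0 j (koszul (Suc p)) (koszul_cycles (Suc p))"
    by (intro tor_zero_quotient[OF graded_sub_free_mod graded_sub_koszul_cycles graded_sub_ideal_mod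
        koszul_cycles_subset koszul_ideal_subset_cycles ideal_kills_free_mod]) auto
  then show ?case by (rule koszul_bounds_iso(1))
next
  case (Suc i)
  let ?p = "Suc p"
  have 1: "tor_zero i j (koszul_bounds ?p) (koszul_ideal ?p)"
  proof (rule Suc.IH)
    show "tor_k_zero (i - s) (j - q)" if "1 \<le> s" "s \<le> i" "\<not> koszul_cycles (?p + s) q \<subseteq> koszul_bounds (?p + s) q" for s q
      using Suc.prems(1)[of "Suc s" q] that by simp
    show "j \<noteq> int ?p + 1 + int i" using Suc.prems(2) by simp
  qed
  have 2: "tor_zero i j (koszul_cycles ?p) (koszul_bounds ?p)"
  proof (rule tor_zero_killed[where ?e0.0 = "{} :: 'x set"])
    show "smul r v \<in> koszul_bounds ?p (s + q)"
      if "s \<noteq> 0" "r \<in> homog s" "v \<in> koszul_cycles ?p q" for s r v q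
      by (rule smul_koszul_cycles) (use that in auto)
    show "tor_k_zero i (j - q)" if "\<not> koszul_cycles ?p q \<subseteq> koszul_bounds ?p q" for q
      using Suc.prems(1)[of 1 q] that by simp
    show "ideal_kills (koszul_cycles ?p) (koszul_bounds ?p)"
      by (rule ideal_kills_koszul[OF koszul_cycles_subset koszul_ideal_subset_bounds])
  qed (rule graded_sub_koszul_cycles graded_sub_koszul_bounds koszul_bounds_subset_cycles)+
  have 3: "tor_zero i j (koszul_cycles ?p) (koszul_ideal ?p)"
    by (rule tor_zero_extension[OF graded_sub_koszul_cycles graded_sub_koszul_bounds graded_sub_ideal_mod
       koszul_bounds_subset_cycles koszul_ideal_subset_bounds
       ideal_kills_koszul[OF koszul_cycles_subset subset_refl] 2 1])
  have 4: "tor_zero (Suc i) j (koszul ?p) (koszul_ideal ?p)"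
    by (intro tor_zero_free_mod) auto
  have "tor_zero (Suc i) j (koszul ?p) (koszul_cycles ?p)"
    by (rule tor_zero_quotient[OF graded_sub_free_mod graded_sub_koszul_cycles graded_sub_ideal_mod
        koszul_cycles_subset koszul_ideal_subset_cycles ideal_kills_free_mod 4]) (use 3 in auto)
  then show ?case by (rule koszul_bounds_iso(1))
qed

text \<open>As \<open>k\<close> is \<open>K_0/B_0\<close>, its \<open>Tor_i\<close> is enclosed by
  \<open>Tor_i(k, K_0)\<close> and \<open>Tor_(i-1)(k, B_0)\<close>. The excluded degree
  \<open>j = i\<close> is where \<open>Tor_0\<close> of the free module \<open>K_i\<close>
  sits.\<close>

lemma tor_k_zero_step:
  assumes I: "\<And>p. p \<in> I \<Longrightarrow> const_coeff p = 0"
    and H: "\<And>s q. 1 \<le> s \<Longrightarrow> s < i \<Longrightarrow> \<not> koszul_cycles s q \<subseteq> koszul_bounds s q \<Longrightarrow>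
      tor_k_zero (i - 1 - s) (j - q)"
    and j: "j \<noteq> int i"
  shows "tor_k_zero i j"
proof -
  have 1: "tor_zero i j (koszul 0) (koszul_ideal 0)"
    using j by (intro tor_zero_free_mod) (auto simp: image_iff)
  have 2: "tor_zero i' j (koszul_bounds 0) (koszul_ideal 0)" if "i = Suc i'" for i'
    by (rule tor_zero_koszul_bounds) (use H j that in auto)
  have "tor_zero i j (koszul 0) (koszul_bounds 0)"
    by (rule tor_zero_quotient[OF graded_sub_free_mod graded_sub_koszul_bounds graded_sub_ideal_mod
        koszul_bounds_subset koszul_ideal_subset_bounds ideal_kills_free_mod 1 2])
  moreover have "koszul_bounds 0 = (max_line {} :: int \<Rightarrow> ('x, 'k) kvec set)"
    using koszul_bounds_0[OF I] by blast
  ultimately show ?thesis by (simp only: koszul_0)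
qed

text \<open>Induction on \<open>i\<close>, with \<open>\<beta>\<close> any function that dominates
  the recursion. It is real-valued because the line needed for the slant has slope
  \<open>d/2\<close>.\<close>

lemma tor_k_zero_bound:
  fixes \<beta> :: "nat \<Rightarrow> real" and h :: "nat \<Rightarrow> real"
  assumes I: "\<And>p. p \<in> I \<Longrightarrow> const_coeff p = 0"
    and h: "\<And>s q. 1 \<le> s \<Longrightarrow> \<not> koszul_cycles s q \<subseteq> koszul_bounds s q \<Longrightarrow> real_of_int q \<le> h s"
    and \<beta>: "\<And>i. real i \<le> \<beta> i" "\<And>i s. 1 \<le> s \<Longrightarrow> s < i \<Longrightarrow> h s + \<beta> (i - 1 - s) \<le> \<beta> i"
    and "real_of_int j > \<beta> i"
  shows "tor_k_zero i j"
  using assms(5)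
proof (induction i arbitrary: j rule: less_induct)
  case (less i)
  show ?case
  proof (rule tor_k_zero_step[OF I])
    show "j \<noteq> int i" using less.prems \<beta>(1)[of i] by auto
    show "tor_k_zero (i - 1 - s) (j - q)"
      if s: "1 \<le> s" "s < i" "\<not> koszul_cycles s q \<subseteq> koszul_bounds s q" for s q
    proof (rule less.IH)
      show "i - 1 - s < i" using s by simp
      show "\<beta> (i - 1 - s) < real_of_int (j - q)"
        using h[OF s(1,3)] \<beta>(2)[OF s(1,2)] less.prems by simp
    qed
  qed
qed

end

subsection \<open>Syzygies\<close>

text \<open>\<open>s\<close> is the degree of the coefficients, so for forms of degree
  \<open>d\<close> the relation itself lives in degree \<open>s + d\<close>.\<close>

definition syzygy :: "(nat \<Rightarrow> ('x::finite, 'k::field) mpoly) \<Rightarrow> nat \<Rightarrow> int \<Rightarrow> (nat \<Rightarrow> ('x, 'k) mpoly) \<Rightarrow> bool" where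
  "syzygy f N s a \<longleftrightarrow> (\<forall>l<N. a l \<in> homog s) \<and> (\<Sum>l<N. a l * f l) = 0"

text \<open>Koszul syzygies come from the alternating matrices \<open>c l m - c m l\<close>; this form is also
  correct in characteristic 2.\<close>

definition koszul_syzygy :: "(nat \<Rightarrow> ('x::finite, 'k::field) mpoly) \<Rightarrow> int \<Rightarrow> nat \<Rightarrow> int \<Rightarrow> (nat \<Rightarrow> ('x, 'k) mpoly) \<Rightarrow> bool" where
  "koszul_syzygy f d N s a \<longleftrightarrow> (\<exists>c. (\<forall>l m. c l m \<in> homog (s - d)) \<and>
     (\<forall>l<N. a l = (\<Sum>m<N. (c l m - c m l) * f m)))"

lemma koszul_syzygy_sum:
  assumes "\<And>x. koszul_syzygy f d N (s - 1) (a x)"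
  shows "koszul_syzygy f d N s (\<lambda>l. \<Sum>x\<in>UNIV. var x * a x l)"
proof -
  have "\<exists>c. \<forall>x. (\<forall>l m. c x l m \<in> homog (s - 1 - d)) \<and>
     (\<forall>l<N. a x l = (\<Sum>m<N. (c x l m - c x m l) * f m))"
    by (rule choice, rule allI, rule assms[unfolded koszul_syzygy_def])
  then obtain c where c: "\<And>x l m. c x l m \<in> homog (s - 1 - d)"
    "\<And>x l. l < N \<Longrightarrow> a x l = (\<Sum>m<N. (c x l m - c x m l) * f m)"
    by blast
  define C where "C = (\<lambda>l m. \<Sum>x\<in>UNIV. var x * c x l m)"
  have "C l m \<in> homog (s - d)" for l m
    unfolding C_def by (intro homog_sum homog_mult'[OF homog_var c(1)]) simp
  moreover have "(\<Sum>x\<in>UNIV. var x * a x l) = (\<Sum>m<N. (C l m - C m l) * f m)" if "l < N" for l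
  proof -
    have "(\<Sum>x\<in>UNIV. var x * a x l) = (\<Sum>x\<in>UNIV. \<Sum>m<N. (var x * c x l m - var x * c x m l) * f m)"
      using c(2)[OF that] by (simp add: sum_distrib_left algebra_simps)
    also have "\<dots> = (\<Sum>m<N. \<Sum>x\<in>UNIV. (var x * c x l m - var x * c x m l) * f m)"
      by (rule sum.swap)
    also have "\<dots> = (\<Sum>m<N. (C l m - C m l) * f m)"
      by (simp add: C_def sum_distrib_right sum_subtractf left_diff_distrib)
    finally show ?thesis .
  qed
  ultimately show ?thesis unfolding koszul_syzygy_def by blast
qed

lemma koszul_syzygy_add:
  assumes "koszul_syzygy f d N s a" "koszul_syzygy f d N s b"
  shows "koszul_syzygy f d N s (\<lambda>l. a l + b l)"
proof -
  obtain c where c: "\<And>l m. c l m \<in> homog (s - d)" "\<And>l. l < N \<Longrightarrow> a l = (\<Sum>m<N. (c l m - c m l) * f m)"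
    using assms(1) unfolding koszul_syzygy_def by blast
  obtain c' where c': "\<And>l m. c' l m \<in> homog (s - d)" "\<And>l. l < N \<Longrightarrow> b l = (\<Sum>m<N. (c' l m - c' m l) * f m)"
    using assms(2) unfolding koszul_syzygy_def by blast
  show ?thesis unfolding koszul_syzygy_def
    by (rule exI[of _ "\<lambda>l m. c l m + c' l m"])
       (auto simp: c(2) c'(2) sum.distrib[symmetric] algebra_simps intro!: homog_add c(1) c'(1))
qed

lemma koszul_syzygy_cong: "(\<And>l. l < N \<Longrightarrow> a l = b l) \<Longrightarrow> koszul_syzygy f d N s a \<Longrightarrow> koszul_syzygy f d N s b"
  unfolding koszul_syzygy_def by auto

text \<open>If the first Koszul homology of \<open>f_0, ..., f_N\<close> vanishes, then so does that of
  \<open>f_0, ..., f_(N-1)\<close>, by induction on the degree.\<close>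

lemma koszul_syzygies_Suc:
  assumes f: "\<And>l. l \<le> N \<Longrightarrow> f l \<in> homog d" and d: "d > 0"
    and Kos: "\<And>s a. syzygy f (Suc N) s a \<Longrightarrow> koszul_syzygy f d (Suc N) s a"
    and a: "syzygy f N s a"
  shows "koszul_syzygy f d N s a"
  using a
proof (induction "nat (s + 1)" arbitrary: s a rule: less_induct)
  case less
  show ?case
  proof (cases "s < 0")
    case True
    then have "a l = 0" if "l < N" for l
      using less.prems that by (auto simp: syzygy_def homog_neg)
    then show ?thesis unfolding koszul_syzygy_def by (intro exI[of _ "\<lambda>l m. 0"]) auto
  next
    case False
    let ?a = "\<lambda>l. if l < N then a l else 0"
    have "syzygy f (Suc N) s ?a"
      using less.prems by (auto simp: syzygy_def)
    then obtain c where c: "\<And>l m. c l m \<in> homog (s - d)"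
      "\<And>l. l < Suc N \<Longrightarrow> ?a l = (\<Sum>m<Suc N. (c l m - c m l) * f m)"
      using Kos unfolding koszul_syzygy_def by blast
    \<comment> \<open>The last row of the alternating matrix. The entry of \<open>?a\<close> at
      \<open>N\<close> is 0, so \<open>b\<close> is a syzygy of the first \<open>N\<close> forms, of
      degree \<open>s - d\<close>, and the induction applies.\<close>
    define b where "b = (\<lambda>m. c N m - c m N)"
    have "(\<Sum>m<N. b m * f m) = 0" using c(2)[of N] by (simp add: b_def)
    then have "syzygy f N (s - d) b"
      by (simp add: syzygy_def b_def homog_diff c(1))
    moreover have "nat (s - d + 1) < nat (s + 1)" using d False by simp
    ultimately obtain k where k: "\<And>l m. k l m \<in> homog (s - d - d)"
      "\<And>l. l < N \<Longrightarrow> b l = (\<Sum>m<N. (k l m - k m l) * f m)"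
      using less.hyps unfolding koszul_syzygy_def by blast
    \<comment> \<open>The terms \<open>b l * f N\<close> left over in the equations for
      \<open>a l\<close> are absorbed by changing the matrix by multiples of
      \<open>f N\<close>.\<close>
    define C where "C = (\<lambda>l m. c l m - k l m * f N)"
    have "C l m \<in> homog (s - d)" for l m
      unfolding C_def by (intro homog_diff c(1) homog_mult'[OF k(1) f]) auto
    moreover have "a l = (\<Sum>m<N. (C l m - C m l) * f m)" if l: "l < N" for l
    proof -
      have "a l = (\<Sum>m<N. (c l m - c m l) * f m) - b l * f N"
        using c(2)[of l] l by (simp add: b_def algebra_simps)
      also have "\<dots> = (\<Sum>m<N. (c l m - c m l) * f m) - (\<Sum>m<N. (k l m - k m l) * f m * f N)"
        by (simp add: k(2)[OF l] sum_distrib_right)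
      also have "\<dots> = (\<Sum>m<N. (C l m - C m l) * f m)"
        unfolding sum_subtractf[symmetric] by (rule sum.cong) (auto simp: C_def algebra_simps)
      finally show ?thesis .
    qed
    ultimately show ?thesis unfolding koszul_syzygy_def by blast
  qed
qed

lemma koszul_syzygies_le:
  assumes f: "\<And>l. l < N \<Longrightarrow> f l \<in> homog d" and d: "d > 0"
    and Kos: "\<And>s a. syzygy f N s a \<Longrightarrow> koszul_syzygy f d N s a"
    and "M \<le> N" and a: "syzygy f M s a"
  shows "koszul_syzygy f d M s a"
  using assms(4,5)
proof (induction arbitrary: s a rule: inc_induct)
  case base
  then show ?case by (rule Kos)
next
  case (step M)
  show ?case
    by (rule koszul_syzygies_Suc[OF _ d step.IH step.prems]) (use f step.hyps in auto)
qed

section \<open>Homogeneous representations by generators, and regular sequences\<close>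

lemma ideal_gen_image_repr:
  assumes "p \<in> ideal_gen (f ` {..<N :: nat})"
  shows "\<exists>g. p = (\<Sum>l<N. g l * f l)"
  using assms
proof (induction rule: ideal_gen_induct)
  case base
  show ?case by (rule exI[of _ "\<lambda>l. 0"]) simp
next
  case (step c x y)
  obtain g l where "y = (\<Sum>l<N. g l * f l)" "l < N" "x = f l" using step by auto
  moreover have "(\<Sum>m<N. (if m = l then c else 0) * f m) = (\<Sum>m<N. if m = l then c * f m else 0)"
    by (rule sum.cong) auto
  ultimately have "c * x + y = (\<Sum>m<N. ((if m = l then c else 0) + g m) * f m)"
    by (simp add: distrib_right sum.distrib)
  then show ?case by (intro exI[of _ "\<lambda>m. (if m = l then c else 0) + g m"])
qed

lemma ideal_gen_image_repr_homog:
  fixes f :: "nat \<Rightarrow> ('x::finite, 'k::field) mpoly"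
  assumes f: "\<And>l. l < N \<Longrightarrow> f l \<in> homog d" and p: "p \<in> ideal_gen (f ` {..<N})" "p \<in> homog q"
  obtains g where "\<And>l. g l \<in> homog (q - d)" "p = (\<Sum>l<N. g l * f l)"
proof -
  obtain g where g: "p = (\<Sum>l<N. g l * f l)" using ideal_gen_image_repr[OF p(1)] by blast
  have "p = hcomp q p" using p(2) by (simp add: hcomp_id)
  also have "\<dots> = (\<Sum>l<N. hcomp (q - d) (g l) * f l)"
    unfolding g hcomp_sum by (intro sum.cong) (auto simp: hcomp_mult_right[OF f])
  finally show thesis using that[of "\<lambda>l. hcomp (q - d) (g l)"] hcomp_homog by blast
qed

lemma ideal_gen_sum_mem: "(\<And>l. l \<in> S \<Longrightarrow> p l \<in> G) \<Longrightarrow> (\<Sum>l\<in>S. g l * p l) \<in> ideal_gen G"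
  by (intro module.span_sum[OF module_mult] ideal_gen_scale ideal_gen_base)

text \<open>A relation \<open>g f_M = \<Sum> h_l f_l\<close> is a syzygy of the first
  \<open>M + 1\<close> forms, hence Koszul. Its last entry is \<open>g\<close>, and an alternating
  matrix has zero diagonal, so \<open>g\<close> is a combination of the earlier forms.\<close>

lemma koszul_syzygies_regular:
  fixes f :: "nat \<Rightarrow> ('x::finite, 'k::field) mpoly"
  assumes f: "\<And>l. l < N \<Longrightarrow> f l \<in> homog d" and d: "d > 0"
    and Kos: "\<And>s a. syzygy f N s a \<Longrightarrow> koszul_syzygy f d N s a"
    and M: "M < N" and g: "g \<in> homog s" "g * f M \<in> ideal_gen (f ` {..<M})"
  shows "g \<in> ideal_gen (f ` {..<M})"
proof -
  have "g * f M \<in> homog (s + d)" by (rule homog_mult[OF g(1) f[OF M]])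
  moreover have "f l \<in> homog d" if "l < M" for l using f M that by simp
  ultimately obtain h where h: "\<And>l. h l \<in> homog (s + d - d)" "g * f M = (\<Sum>l<M. h l * f l)"
    using ideal_gen_image_repr_homog[OF _ g(2), of d "s + d"] by blast
  define a where "a = (\<lambda>l. if l < M then - h l else g)"
  have "syzygy f (Suc M) s a"
    using h g(1) by (auto simp: syzygy_def a_def homog_uminus sum_negf)
  then have "koszul_syzygy f d (Suc M) s a"
    using koszul_syzygies_le[OF f d Kos, of "Suc M"] M by simp
  then obtain c where c: "\<And>l. l < Suc M \<Longrightarrow> a l = (\<Sum>m<Suc M. (c l m - c m l) * f m)"
    unfolding koszul_syzygy_def by blast
  have "g = (\<Sum>m<M. (c M m - c m M) * f m)"
    using c[of M] by (simp add: a_def)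
  also have "\<dots> \<in> ideal_gen (f ` {..<M})" by (rule ideal_gen_sum_mem) auto
  finally show ?thesis .
qed

lemma kdiff_koszul_1: "v \<in> koszul 1 q \<Longrightarrow> kdiff v \<in> koszul 0 q"
  by (rule kdiff_koszul) (simp only: One_nat_def)

section \<open>Ideals generated by forms of one degree, and the degrees of their Koszul
  homology\<close>

locale generated_ideal = graded_ideal I for I :: "('x::finite, 'k::field) mpoly set" +
  fixes f :: "nat \<Rightarrow> ('x, 'k) mpoly" and N d :: nat
  assumes f_homog: "l < N \<Longrightarrow> f l \<in> homog (int d)"
    and I_eq: "I = ideal_gen (f ` {..<N})" and d_pos: "d > 0"
begin

lemma f_mem: "l < N \<Longrightarrow> f l \<in> I"
  unfolding I_eq by (rule ideal_gen_base) simp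

lemma I_repr:
  assumes "p \<in> I" "p \<in> homog q"
  obtains g where "\<And>l. g l \<in> homog (q - int d)" "p = (\<Sum>l<N. g l * f l)"
  using ideal_gen_image_repr_homog[of N f "int d" p q] f_homog assms I_eq by metis

lemma I_low: "p \<in> I \<Longrightarrow> p \<in> homog q \<Longrightarrow> q < int d \<Longrightarrow> p = 0"
  by (rule I_repr) (auto simp: homog_neg)

lemma I_const: "p \<in> I \<Longrightarrow> const_coeff p = 0"
proof -
  assume "p \<in> I"
  then have "hcomp 0 p = 0" using I_low[OF hcomp_mem hcomp_homog] d_pos by simp
  then have "Poly_Mapping.lookup (hcomp 0 p) 0 = 0" by simp
  then show ?thesis by (simp add: lookup_hcomp const_coeff_def)
qed

text \<open>\<open>H_1(K)\<close> is \<open>I\<close> modulo its multiples by the variables. Above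
  degree \<open>d\<close> the coefficients \<open>g l\<close> have positive degree, so their lifts
  times \<open>f l\<close> give an element of \<open>I K_1\<close> with the same boundary as
  \<open>v\<close>; the difference is a cycle over \<open>S\<close>, hence a boundary.\<close>

lemma koszul_cycles_1_bound:
  assumes "\<not> koszul_cycles 1 q \<subseteq> koszul_bounds 1 q"
  shows "q \<le> int d"
proof (rule ccontr)
  assume q: "\<not> q \<le> int d"
  have "v \<in> koszul_bounds 1 q" if v: "v \<in> koszul_cycles 1 q" for v
  proof -
    have vK: "v \<in> koszul 1 q" "kdiff v {} \<in> I" using v by (auto simp: koszul_cycles_def)
    have "kdiff v \<in> koszul 0 q" by (rule kdiff_koszul_1[OF vK(1)])
    then have "kdiff v {} \<in> homog q" by (auto simp: free_mod_def dest: spec[of _ "{}"])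
    then obtain g where g: "\<And>l. g l \<in> homog (q - int d)" "kdiff v {} = (\<Sum>l<N. g l * f l)"
      using I_repr[OF vK(2)] by blast
    define w where "w = (\<lambda>A. \<Sum>l<N. koszul_lift (g l) A * f l)"
    have "w \<in> koszul_ideal 1 q"
    proof -
      have K: "koszul_lift (g l) \<in> koszul 1 (q - int d)" for l by (rule koszul_lift_koszul[OF g(1)])
      have "koszul_lift (g l) A * f l \<in> homog (q - int (card A))" if "l < N" for l A
        using K[of l] f_homog[OF that] by (auto simp: free_mod_def intro: homog_mult')
      moreover have "koszul_lift (g l) A = 0" if "card A \<noteq> 1" for l A
        using K[of l] that by (auto simp: free_mod_def)
      moreover have "w A \<in> I" for A unfolding w_def by (intro sum_mem mult_mem f_mem) auto
      ultimately show ?thesis by (auto simp: ideal_mod_def free_mod_def w_def intro!: homog_sum sum.neutral)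
    qed
    have "kdiff w {} = (\<Sum>l<N. (\<Sum>x\<in>UNIV. var x * coord (g l) x) * f l)"
      unfolding kdiff_empty w_def koszul_lift_singleton sum_distrib_left sum_distrib_right mult.assoc
      by (rule sum.swap)
    also have "\<dots> = (\<Sum>l<N. g l * f l)"
    proof (rule sum.cong[OF refl])
      fix l
      have "const_coeff (g l) = 0" by (rule const_coeff_homog[OF g(1)]) (use q in simp)
      then show "(\<Sum>x\<in>UNIV. var x * coord (g l) x) * f l = g l * f l" by (simp add: sum_coord)
    qed
    finally have "kdiff (v - w) {} = 0" by (simp add: kdiff_diff g(2))
    moreover have "v - w \<in> koszul 1 q"
      using graded_sub_diff[OF graded_sub_free_mod vK(1)] \<open>w \<in> koszul_ideal 1 q\<close> by (simp add: ideal_mod_def)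
    ultimately obtain u where "u \<in> koszul 2 q" "v - w = kdiff u"
      using koszul_exact_1[of "v - w" q] by (auto simp: koszul_lift_zero)
    moreover from this have "v = kdiff u + w" by (metis diff_add_cancel)
    ultimately show ?thesis
      unfolding koszul_bounds_def using \<open>w \<in> koszul_ideal 1 q\<close> by (auto simp: numeral_2_eq_2)
  qed
  then show False using assms by blast
qed

text \<open>In degree at least \<open>s + e\<close> a coefficient at a set of \<open>s\<close>
  variables has degree at least \<open>e\<close>, so there all of \<open>K_s\<close> vanishes over
  \<open>R\<close>.\<close>

lemma koszul_cycles_bound:
  assumes "\<And>p q. p \<in> homog q \<Longrightarrow> q \<ge> int e \<Longrightarrow> p \<in> I" and "\<not> koszul_cycles s q \<subseteq> koszul_bounds s q"
  shows "q < int s + int e"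
proof (rule ccontr)
  assume q: "\<not> q < int s + int e"
  have "v \<in> koszul_bounds s q" if "v \<in> koszul_cycles s q" for v
  proof -
    have v: "v \<in> koszul s q" using that by (simp add: koszul_cycles_def)
    have "v A \<in> I" for A
    proof (cases "card A = s")
      case True
      have "v A \<in> homog (q - int (card A))" using v unfolding free_mod_def by blast
      then show ?thesis by (rule assms(1)) (use q True in simp)
    next
      case False
      then have "v A = 0" using v unfolding free_mod_def by blast
      then show ?thesis by (simp add: zero_mem)
    qed
    then have "v \<in> koszul_ideal s q" using v by (simp add: ideal_mod_def)
    then show ?thesis using koszul_ideal_subset_bounds by blast
  qed
  then show False using assms(2) by blast
qed

end

locale generated_resolution = generated_ideal I f N d + resolution I F
  for I :: "('x::finite, 'k::field) mpoly set" and f N d and F :: "('x, 'k) free_cx"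
begin

text \<open>The shift run backwards: the cycles of exterior degree 1 are the second syzygy module of
  \<open>k\<close> over \<open>R\<close>. The degree excluded for \<open>i = 0\<close> is that of
  the generators of \<open>K_1\<close>.\<close>

lemma tor_zero_koszul_cycles_1:
  assumes "tor_k_zero (Suc (Suc i)) j" and "i \<noteq> 0 \<or> j \<noteq> 1"
  shows "tor_zero i j (koszul_cycles 1) (koszul_ideal 1)"
proof -
  have "koszul_bounds 0 = (max_line {} :: int \<Rightarrow> ('x, 'k) kvec set)"
    using koszul_bounds_0[OF I_const] by blast
  then have 1: "tor_zero (Suc (Suc i)) j (koszul 0) (koszul_bounds 0)"
    using assms(1) by (simp only: koszul_0)
  have "tor_zero (Suc i) j (koszul_bounds 0) (koszul_ideal 0)"
    by (rule tor_zero_sub[OF graded_sub_free_mod graded_sub_koszul_bounds graded_sub_ideal_mod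
        koszul_bounds_subset koszul_ideal_subset_bounds ideal_kills_free_mod 1])
       (intro tor_zero_free_mod, auto)
  then have 2: "tor_zero (Suc i) j (koszul (Suc 0)) (koszul_cycles (Suc 0))"
    by (rule koszul_bounds_iso(2))
  have "tor_zero i j (koszul_cycles (Suc 0)) (koszul_ideal (Suc 0))"
    by (rule tor_zero_sub[OF graded_sub_free_mod graded_sub_koszul_cycles graded_sub_ideal_mod
        koszul_cycles_subset koszul_ideal_subset_cycles ideal_kills_free_mod 2])
       (intro tor_zero_free_mod, use assms(2) in auto)
  then show ?thesis by simp
qed

text \<open>Otherwise the lift of \<open>g\<close> would be a combination of cycles of degree
  \<open>d - 1\<close> with the variables as coefficients, up to \<open>I K_1\<close>. As
  \<open>I\<close> is zero below degree \<open>d\<close>, these cycles have boundary 0 and the error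
  in \<open>I K_1\<close> vanishes, whereas the boundary of the lift is \<open>g\<close>.\<close>

lemma tor_2_nonzero:
  assumes "d \<ge> 2" and g: "g \<in> I" "g \<in> homog (int d)" "g \<noteq> 0"
  shows "\<not> tor_k_zero 2 (int d)"
proof
  assume "tor_k_zero 2 (int d)"
  then have V: "tor_zero 0 (int d) (koszul_cycles 1) (koszul_ideal 1)"
    using tor_zero_koszul_cycles_1[of 0 "int d"] assms(1) by (simp add: numeral_2_eq_2)
  have lift: "kdiff (koszul_lift g) {} = g"
    by (rule kdiff_koszul_lift[OF I_const[OF g(1)]])
  have K: "koszul_lift g \<in> koszul 1 (int d)" by (rule koszul_lift_koszul[OF g(2)])
  have "kdiff (koszul_lift g) A \<in> I" for A
  proof (cases "A = {}")
    case True
    then show ?thesis using lift g(1) by simp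
  next
    case False
    have "kdiff (koszul_lift g) \<in> koszul 0 (int d)" by (rule kdiff_koszul_1[OF K])
    then show ?thesis using False zero_mem by (simp add: free_mod_def)
  qed
  then have "koszul_lift g \<in> koszul_cycles 1 (int d)" using K by (simp add: koszul_cycles_def)
  then obtain y b where yb: "\<And>x. y x \<in> koszul_cycles 1 (int d - 1)" "b \<in> koszul_ideal 1 (int d)"
    "koszul_lift g = (\<Sum>x\<in>UNIV. smul (var x) (y x)) + b"
    using tor_zero_0_generated[OF graded_sub_koszul_cycles graded_sub_ideal_mod koszul_ideal_subset_cycles V]
    by blast
  have "kdiff (y x) {} = 0" for x
  proof (rule I_low)
    show "kdiff (y x) {} \<in> I" using yb(1) by (simp add: koszul_cycles_def)
    have "kdiff (y x) \<in> koszul 0 (int d - 1)" using kdiff_koszul_1 yb(1)[of x] unfolding koszul_cycles_def by blast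
    then show "kdiff (y x) {} \<in> homog (int d - 1)" by (auto simp: free_mod_def dest: spec[of _ "{}"])
  qed simp
  moreover have "b {x} = 0" for x
  proof (rule I_low)
    show "b {x} \<in> I" using yb(2) by (simp add: ideal_mod_def)
    show "b {x} \<in> homog (int d - 1)" using yb(2) by (auto simp: ideal_mod_def free_mod_def dest: spec[of _ "{x}"])
  qed simp
  then have "kdiff b {} = 0" by (simp add: kdiff_empty)
  ultimately have "kdiff (koszul_lift g) {} = 0"
    unfolding yb(3) by (simp add: kdiff_add kdiff_sum kdiff_smul sum_fun_apply)
  then show False using lift g(3) by simp
qed

end

subsection \<open>Non-vanishing of the third Tor\<close>

context generated_resolution
begin

text \<open>The second syzygy module of \<open>k\<close> over \<open>S/I\<close> is generated by the lifts of the generators of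
  \<open>I\<close> and by the Koszul relations. Its relations form \<open>syz_rel\<close>; the relations that hold for trivial
  reasons lie in \<open>triv_rel\<close>. If all minimal relations have low degree, then there are no others, and
  every syzygy of the generators is a Koszul syzygy.\<close>

definition gen_wt :: "nat + 'x set \<Rightarrow> int" where
  "gen_wt s = (case s of Inl l \<Rightarrow> int d | Inr A \<Rightarrow> int (card A))"

definition gen_idx :: "(nat + 'x set) set" where
  "gen_idx = Inl ` {..<N} \<union> Inr ` {A. card A = 2}"

abbreviation gen_mod :: "int \<Rightarrow> (nat + 'x set \<Rightarrow> ('x, 'k) mpoly) set" where
  "gen_mod \<equiv> free_mod gen_wt gen_idx"

definition gen_map :: "(nat + 'x set \<Rightarrow> ('x, 'k) mpoly) \<Rightarrow> ('x, 'k) kvec" where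
  "gen_map v = (\<Sum>l<N. smul (v (Inl l)) (koszul_lift (f l))) + kdiff (\<lambda>A. v (Inr A))"

definition syz_rel :: "int \<Rightarrow> (nat + 'x set \<Rightarrow> ('x, 'k) mpoly) set" where
  "syz_rel q = {v \<in> gen_mod q. \<forall>A. gen_map v A \<in> I}"

text \<open>Let \<open>\<tau>_l\<close> be the lift of \<open>f l\<close>, and \<open>P_l\<close>
  the element of \<open>K_1\<close> with entries \<open>P l y\<close>. By the Leibniz rule the
  boundary of the exterior product of \<open>P_l\<close> and \<open>\<tau>_l\<close> is
  \<open>d(P_l) \<tau>_l - f_l P_l\<close>. So \<open>- d(P_l)\<close> at \<open>l\<close>, together
  with this product in the Koszul part, is a relation modulo \<open>I\<close>. The Koszul part is
  prescribed only through its boundary, the other coefficients only modulo \<open>I\<close>.\<close>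

definition triv_rel :: "(nat + 'x set \<Rightarrow> ('x, 'k) mpoly) set" where
  "triv_rel = {v. \<exists>P. (\<forall>l<N. v (Inl l) + (\<Sum>y\<in>UNIV. var y * P l y) \<in> I) \<and>
     (\<forall>x. kdiff (\<lambda>A. v (Inr A)) {x} =
        (\<Sum>l<N. (\<Sum>y\<in>UNIV. var y * P l y) * coord (f l) x - P l x * f l))}"

lemma gen_mod_Inl: "v \<in> gen_mod q \<Longrightarrow> v (Inl l) \<in> homog (q - int d)"
  by (auto simp: free_mod_def gen_wt_def dest: spec[of _ "Inl l"])

lemma gen_mod_Inr: "v \<in> gen_mod q \<Longrightarrow> (\<lambda>A. v (Inr A)) \<in> koszul 2 q"
  by (auto simp: free_mod_def gen_wt_def gen_idx_def split: sum.splits)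

lemma gen_map_add: "gen_map (v + w) = gen_map v + gen_map w"
proof -
  have "(\<lambda>A. (v + w) (Inr A)) = (\<lambda>A. v (Inr A)) + (\<lambda>A. w (Inr A))" by (simp add: fun_eq_iff)
  then have "kdiff (\<lambda>A. (v + w) (Inr A)) = kdiff (\<lambda>A. v (Inr A)) + kdiff (\<lambda>A. w (Inr A))"
    by (simp only: kdiff_add)
  then show ?thesis
    unfolding gen_map_def by (simp only: plus_fun_apply smul_add_left sum.distrib ac_simps)
qed

lemma gen_map_smul: "gen_map (smul r v) = smul r (gen_map v)"
proof -
  have "(\<lambda>A. smul r v (Inr A)) = smul r (\<lambda>A. v (Inr A))" by (simp add: fun_eq_iff)
  then have "kdiff (\<lambda>A. smul r v (Inr A)) = smul r (kdiff (\<lambda>A. v (Inr A)))"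
    by (simp only: kdiff_smul)
  then show ?thesis
    unfolding gen_map_def by (simp only: smul_apply smul_add_right smul_sum_right smul_smul)
qed

lemma gen_map_singleton:
  "gen_map v {x} = (\<Sum>l<N. v (Inl l) * coord (f l) x) + kdiff (\<lambda>A. v (Inr A)) {x}"
  by (simp add: gen_map_def sum_fun_apply)

lemma koszul_lift_f: "l < N \<Longrightarrow> koszul_lift (f l) \<in> koszul 1 (int d)"
  by (rule koszul_lift_koszul[OF f_homog])

lemma kdiff_koszul_lift_f: "l < N \<Longrightarrow> kdiff (koszul_lift (f l)) {} = f l"
  by (rule kdiff_koszul_lift[OF I_const[OF f_mem]])

lemma lift_sum_koszul:
  assumes "\<And>l. l < N \<Longrightarrow> a l \<in> homog (q - int d)"
  shows "(\<Sum>l<N. smul (a l) (koszul_lift (f l))) \<in> koszul 1 q"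
  by (intro graded_sub_sum[OF graded_sub_free_mod] graded_sub_smul[OF graded_sub_free_mod assms koszul_lift_f]) auto

lemma kdiff_lift_sum: "kdiff (\<Sum>l<N. smul (a l) (koszul_lift (f l))) {} = (\<Sum>l<N. a l * f l)"
  by (simp add: kdiff_sum kdiff_smul sum_fun_apply kdiff_koszul_lift_f)

lemma gen_map_koszul: "v \<in> gen_mod q \<Longrightarrow> gen_map v \<in> koszul 1 q"
  unfolding gen_map_def
  by (intro graded_sub_add[OF graded_sub_free_mod] lift_sum_koszul gen_mod_Inl kdiff_koszul)
     (auto dest: gen_mod_Inr simp: numeral_2_eq_2)

lemma koszul_cycles_1I:
  assumes "v \<in> koszul 1 q" "kdiff v {} \<in> I"
  shows "v \<in> koszul_cycles 1 q"
proof -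
  have "kdiff v A \<in> I" for A
  proof (cases "A = {}")
    case False
    then show ?thesis using kdiff_koszul_1[OF assms(1)] zero_mem by (simp add: free_mod_def)
  qed (use assms(2) in simp)
  then show ?thesis using assms(1) by (simp add: koszul_cycles_def)
qed

lemma gen_map_cycles:
  assumes "v \<in> gen_mod q"
  shows "gen_map v \<in> koszul_cycles 1 q"
proof (rule koszul_cycles_1I[OF gen_map_koszul[OF assms]])
  have "kdiff (gen_map v) {} = (\<Sum>l<N. v (Inl l) * f l)"
    unfolding gen_map_def by (simp add: kdiff_add kdiff_kdiff kdiff_lift_sum)
  also have "\<dots> \<in> I" by (intro sum_mem mult_mem f_mem) auto
  finally show "kdiff (gen_map v) {} \<in> I" .
qed

lemma gen_modI:
  assumes "\<And>l. l < N \<Longrightarrow> a l \<in> homog (q - int d)" "\<kappa> \<in> koszul 2 q"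
  shows "case_sum (\<lambda>l. if l < N then a l else 0) \<kappa> \<in> gen_mod q"
  using assms by (auto simp: free_mod_def gen_wt_def gen_idx_def split: sum.splits)

lemma gen_map_case_sum:
  "gen_map (case_sum (\<lambda>l. if l < N then a l else 0) \<kappa>) = (\<Sum>l<N. smul (a l) (koszul_lift (f l))) + kdiff \<kappa>"
  by (simp add: gen_map_def)

text \<open>Subtracting suitable multiples of the lifted generators removes the boundary; what
  remains is a cycle over \<open>S\<close>, hence a combination of Koszul relations.\<close>

lemma gen_map_lift:
  assumes v: "v \<in> koszul_cycles 1 q"
  shows "\<exists>u\<in>gen_mod q. v = gen_map u"
proof -
  have vK: "v \<in> koszul 1 q" "kdiff v {} \<in> I" using v by (auto simp: koszul_cycles_def)
  have "kdiff v {} \<in> homog q"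
    using kdiff_koszul_1[OF vK(1)] by (auto simp: free_mod_def dest: spec[of _ "{}"])
  then obtain g where g: "\<And>l. g l \<in> homog (q - int d)" "kdiff v {} = (\<Sum>l<N. g l * f l)"
    using I_repr[OF vK(2)] by blast
  let ?w = "\<Sum>l<N. smul (g l) (koszul_lift (f l))"
  have "v - ?w \<in> koszul 1 q"
    by (rule graded_sub_diff[OF graded_sub_free_mod vK(1) lift_sum_koszul[OF g(1)]])
  moreover have "kdiff (v - ?w) {} = 0"
    using g(2) kdiff_lift_sum by (simp only: kdiff_diff minus_apply) simp
  ultimately obtain \<kappa> where \<kappa>: "\<kappa> \<in> koszul 2 q" "v - ?w = kdiff \<kappa>"
    using koszul_exact_1[of "v - ?w" q] by (auto simp: koszul_lift_zero)
  have "?w + (v - ?w) = v" by simp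
  then have "gen_map (case_sum (\<lambda>l. if l < N then g l else 0) \<kappa>) = v"
    by (simp only: gen_map_case_sum \<kappa>(2))
  moreover have "case_sum (\<lambda>l. if l < N then g l else 0) \<kappa> \<in> gen_mod q"
    by (rule gen_modI[OF g(1) \<kappa>(1)])
  ultimately show ?thesis by metis
qed

lemma graded_sub_syz_rel: "graded_sub syz_rel"
  using graded_sub_free_mod[of gen_wt gen_idx]
  by (auto simp: graded_sub_def syz_rel_def gen_map_add gen_map_smul intro: add_mem mult_mem)
     (use gen_map_smul[of 0 0] zero_mem in simp)

lemma gen_ideal_subset_syz_rel: "ideal_mod gen_wt gen_idx q \<subseteq> syz_rel q"
proof
  fix v assume v: "v \<in> ideal_mod gen_wt gen_idx q"
  have "gen_map v A \<in> I" for A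
    using v unfolding gen_map_def
    by (auto simp: sum_fun_apply ideal_mod_def intro!: add_mem sum_mem mult_mem_right kdiff_mem_ideal)
  then show "v \<in> syz_rel q" using v by (simp add: syz_rel_def ideal_mod_def)
qed

text \<open>\<open>Tor_3(k, k)\<close> controls \<open>Tor_1\<close> of the second syzygy module,
  and this controls \<open>Tor_0\<close> of its relations. The last step asks \<open>Tor_0\<close>
  of \<open>gen_mod\<close> to vanish, so \<open>j\<close> must avoid the generator degrees
  \<open>d\<close> and \<open>2\<close>.\<close>

lemma syz_rel_generated:
  assumes V: "tor_k_zero 3 j" and j: "j > int d" "j > 2" and v: "v \<in> syz_rel j"
  obtains y b where "\<And>x. y x \<in> syz_rel (j - 1)" "b \<in> ideal_mod gen_wt gen_idx j"
    "v = (\<Sum>x\<in>UNIV. smul (var x) (y x)) + b"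
proof -
  have V1: "tor_zero (Suc 0) j (koszul_cycles 1) (koszul_ideal 1)"
    using tor_zero_koszul_cycles_1[of "Suc 0" j] V by (simp add: numeral_3_eq_3)
  have "tor_zero (Suc 0) j gen_mod syz_rel"
  proof (rule tor_zero_iso2[where \<phi> = gen_map, OF _ _ _ _ _ _ _ _ _ _ _ V1])
    show "\<exists>u\<in>gen_mod q. v - gen_map u \<in> koszul_ideal 1 q" if v: "v \<in> koszul_cycles 1 q" for q v
    proof -
      obtain u where u: "u \<in> gen_mod q" "v = gen_map u" using gen_map_lift[OF v] by blast
      have "v - gen_map u \<in> koszul_ideal 1 q"
        using graded_sub_0[OF graded_sub_ideal_mod] u(2) by simp
      then show ?thesis using u(1) by (intro bexI[of _ u])
    qed
    show "gen_map u \<in> koszul_ideal 1 q \<longleftrightarrow> u \<in> syz_rel q" if "u \<in> gen_mod q" for q u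
      using that gen_map_koszul[OF that] by (simp add: syz_rel_def ideal_mod_def)
    show "syz_rel q \<subseteq> gen_mod q" for q by (auto simp: syz_rel_def)
  qed (rule graded_sub_free_mod graded_sub_syz_rel graded_sub_koszul_cycles graded_sub_ideal_mod
      gen_map_add gen_map_smul gen_map_cycles koszul_ideal_subset_cycles | assumption)+
  moreover have "tor_zero 0 j gen_mod (ideal_mod gen_wt gen_idx)"
  proof (rule tor_zero_free_mod)
    show "finite gen_idx" by (simp add: gen_idx_def)
    show "0 \<noteq> (0::nat) \<or> j \<notin> gen_wt ` gen_idx" using j by (auto simp: gen_wt_def gen_idx_def)
  qed
  moreover have "syz_rel q \<subseteq> gen_mod q" for q by (auto simp: syz_rel_def)
  ultimately have "tor_zero 0 j syz_rel (ideal_mod gen_wt gen_idx)"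
    by (intro tor_zero_sub[OF graded_sub_free_mod graded_sub_syz_rel graded_sub_ideal_mod
        _ gen_ideal_subset_syz_rel ideal_kills_free_mod])
  then show thesis
    using tor_zero_0_generated[OF graded_sub_syz_rel graded_sub_ideal_mod gen_ideal_subset_syz_rel _ v] that
    by blast
qed

lemma triv_rel_add:
  assumes "v \<in> triv_rel" "w \<in> triv_rel"
  shows "v + w \<in> triv_rel"
proof -
  obtain P where P: "\<And>l. l < N \<Longrightarrow> v (Inl l) + (\<Sum>y\<in>UNIV. var y * P l y) \<in> I"
    "\<And>x. kdiff (\<lambda>A. v (Inr A)) {x} = (\<Sum>l<N. (\<Sum>y\<in>UNIV. var y * P l y) * coord (f l) x - P l x * f l)"
    using assms(1) unfolding triv_rel_def by blast
  obtain Q where Q: "\<And>l. l < N \<Longrightarrow> w (Inl l) + (\<Sum>y\<in>UNIV. var y * Q l y) \<in> I"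
    "\<And>x. kdiff (\<lambda>A. w (Inr A)) {x} = (\<Sum>l<N. (\<Sum>y\<in>UNIV. var y * Q l y) * coord (f l) x - Q l x * f l)"
    using assms(2) unfolding triv_rel_def by blast
  have "(v + w) (Inl l) + (\<Sum>y\<in>UNIV. var y * (P l y + Q l y)) \<in> I" if "l < N" for l
    using add_mem[OF P(1)[OF that] Q(1)[OF that]] by (simp add: distrib_left sum.distrib ac_simps)
  moreover have "kdiff (\<lambda>A. (v + w) (Inr A)) {x} =
     (\<Sum>l<N. (\<Sum>y\<in>UNIV. var y * (P l y + Q l y)) * coord (f l) x - (P l x + Q l x) * f l)" for x
  proof -
    have "(\<lambda>A. (v + w) (Inr A)) = (\<lambda>A. v (Inr A)) + (\<lambda>A. w (Inr A))" by (simp add: fun_eq_iff)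
    then have "kdiff (\<lambda>A. (v + w) (Inr A)) {x} = kdiff (\<lambda>A. v (Inr A)) {x} + kdiff (\<lambda>A. w (Inr A)) {x}"
      by (simp only: kdiff_add plus_fun_apply)
    then show ?thesis unfolding P(2) Q(2)
      by (simp add: distrib_left distrib_right sum.distrib sum_subtractf)
  qed
  ultimately show ?thesis unfolding triv_rel_def by (intro CollectI exI[of _ "\<lambda>l y. P l y + Q l y"]) blast
qed

lemma triv_rel_smul:
  assumes "v \<in> triv_rel"
  shows "smul r v \<in> triv_rel"
proof -
  obtain P where P: "\<And>l. l < N \<Longrightarrow> v (Inl l) + (\<Sum>y\<in>UNIV. var y * P l y) \<in> I"
    "\<And>x. kdiff (\<lambda>A. v (Inr A)) {x} = (\<Sum>l<N. (\<Sum>y\<in>UNIV. var y * P l y) * coord (f l) x - P l x * f l)"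
    using assms(1) unfolding triv_rel_def by blast
  have sum: "(\<Sum>y\<in>UNIV. var y * (r * P l y)) = r * (\<Sum>y\<in>UNIV. var y * P l y)" for l
    by (simp add: sum_distrib_left mult.left_commute)
  have "smul r v (Inl l) + (\<Sum>y\<in>UNIV. var y * (r * P l y)) \<in> I" if "l < N" for l
    using mult_mem[OF P(1)[OF that], of r] unfolding sum by (simp add: distrib_left)
  moreover have "kdiff (\<lambda>A. smul r v (Inr A)) {x} =
     (\<Sum>l<N. (\<Sum>y\<in>UNIV. var y * (r * P l y)) * coord (f l) x - (r * P l x) * f l)" for x
  proof -
    have "(\<lambda>A. smul r v (Inr A)) = smul r (\<lambda>A. v (Inr A))" by (simp add: fun_eq_iff)
    then have "kdiff (\<lambda>A. smul r v (Inr A)) {x} = r * kdiff (\<lambda>A. v (Inr A)) {x}"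
      by (simp only: kdiff_smul smul_apply)
    then show ?thesis unfolding P(2) sum
      by (simp only: sum_distrib_left[where A = "{..<N}"] right_diff_distrib mult.assoc)
  qed
  ultimately show ?thesis unfolding triv_rel_def by (intro CollectI exI[of _ "\<lambda>l y. r * P l y"]) blast
qed

text \<open>Write the Koszul part as \<open>\<Sum> f_l \<kappa>_l\<close> and take minus the
  boundary of \<open>\<kappa>_l\<close> for \<open>P_l\<close>. Then \<open>P_l\<close> has boundary
  0, so the first condition only asks for membership in \<open>I\<close>.\<close>

lemma gen_ideal_subset_triv_rel:
  assumes "v \<in> ideal_mod gen_wt gen_idx q"
  shows "v \<in> triv_rel"
proof -
  have "\<exists>c. \<forall>A. v (Inr A) = (\<Sum>l<N. c A l * f l)"
  proof (rule choice, rule allI)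
    fix A
    have "v (Inr A) \<in> I" using assms by (simp add: ideal_mod_def)
    then show "\<exists>g. v (Inr A) = (\<Sum>l<N. g l * f l)" unfolding I_eq by (rule ideal_gen_image_repr)
  qed
  then obtain c where c: "\<And>A. v (Inr A) = (\<Sum>l<N. c A l * f l)" by blast
  define \<kappa> where "\<kappa> = (\<lambda>l A. c A l)"
  have "(\<lambda>A. v (Inr A)) = (\<Sum>l<N. smul (f l) (\<kappa> l))"
    by (rule ext) (simp add: c \<kappa>_def sum_fun_apply mult.commute)
  then have \<kappa>: "kdiff (\<lambda>A. v (Inr A)) {x} = (\<Sum>l<N. kdiff (\<kappa> l) {x} * f l)" for x
    by (simp add: kdiff_sum kdiff_smul sum_fun_apply mult.commute)
  define P where "P = (\<lambda>l x. - kdiff (\<kappa> l) {x})"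
  have "(\<Sum>y\<in>UNIV. var y * kdiff (\<kappa> l) {y}) = 0" for l
    unfolding kdiff_empty[symmetric] kdiff_kdiff by simp
  then have P: "(\<Sum>y\<in>UNIV. var y * P l y) = 0" for l
    by (simp add: P_def sum_negf)
  have "v (Inl l) + (\<Sum>y\<in>UNIV. var y * P l y) \<in> I" for l
    using assms unfolding P by (simp add: ideal_mod_def)
  moreover have "kdiff (\<lambda>A. v (Inr A)) {x} = (\<Sum>l<N. (\<Sum>y\<in>UNIV. var y * P l y) * coord (f l) x - P l x * f l)" for x
    unfolding P \<kappa> by (simp add: P_def)
  ultimately show ?thesis unfolding triv_rel_def by blast
qed

text \<open>The image of \<open>v\<close> in \<open>K_1\<close> has entries
  \<open>\<Sum> g_l f_l\<close> in \<open>I\<close>. Its boundary gives two representations of one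
  element by the forms; without syzygies in this degree they coincide, and then
  \<open>P = - g\<close> works.\<close>

lemma syz_rel_low:
  assumes inj: "\<And>a. syzygy f N (j - int d) a \<Longrightarrow> \<forall>l<N. a l = 0" and v: "v \<in> syz_rel j"
  shows "v \<in> triv_rel"
proof -
  have vG: "v \<in> gen_mod j" "\<And>A. gen_map v A \<in> I" using v by (auto simp: syz_rel_def)
  have "\<exists>g. \<forall>x. (\<forall>l. g x l \<in> homog (j - 1 - int d)) \<and> gen_map v {x} = (\<Sum>l<N. g x l * f l)"
  proof (rule choice, rule allI)
    fix x
    have "gen_map v {x} \<in> homog (j - 1)"
      using gen_map_koszul[OF vG(1)] by (auto simp: free_mod_def dest: spec[of _ "{x}"])
    then obtain g where "\<And>l. g l \<in> homog (j - 1 - int d)" "gen_map v {x} = (\<Sum>l<N. g l * f l)"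
      using I_repr[OF vG(2)] by blast
    then show "\<exists>g. (\<forall>l. g l \<in> homog (j - 1 - int d)) \<and> gen_map v {x} = (\<Sum>l<N. g l * f l)" by blast
  qed
  then obtain g where g: "\<And>x l. g x l \<in> homog (j - 1 - int d)"
    "\<And>x. gen_map v {x} = (\<Sum>l<N. g x l * f l)" by blast
  define G where "G = (\<lambda>l. \<Sum>x\<in>UNIV. var x * g x l)"
  have G: "G l \<in> homog (j - int d)" for l
    unfolding G_def by (intro homog_sum homog_mult'[OF homog_var g(1)]) simp
  have "(\<Sum>l<N. v (Inl l) * f l) = kdiff (gen_map v) {}"
    unfolding gen_map_def by (simp add: kdiff_add kdiff_kdiff kdiff_lift_sum)
  also have "\<dots> = (\<Sum>x\<in>UNIV. \<Sum>l<N. var x * g x l * f l)"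
    by (simp add: kdiff_empty g(2) sum_distrib_left mult.assoc)
  also have "\<dots> = (\<Sum>l<N. G l * f l)"
    unfolding G_def sum_distrib_right by (rule sum.swap)
  finally have "syzygy f N (j - int d) (\<lambda>l. v (Inl l) - G l)"
    using gen_mod_Inl[OF vG(1)] G by (simp add: syzygy_def left_diff_distrib sum_subtractf homog_diff)
  then have vG': "v (Inl l) = G l" if "l < N" for l using inj that by fastforce
  have P: "(\<Sum>y\<in>UNIV. var y * - g y l) = - G l" for l
    by (simp add: G_def sum_negf)
  have "v (Inl l) + (\<Sum>y\<in>UNIV. var y * - g y l) \<in> I" if "l < N" for l
    unfolding P using vG'[OF that] zero_mem by simp
  moreover have "kdiff (\<lambda>A. v (Inr A)) {x} =
      (\<Sum>l<N. (\<Sum>y\<in>UNIV. var y * - g y l) * coord (f l) x - (- g x l) * f l)" for x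
  proof -
    have "kdiff (\<lambda>A. v (Inr A)) {x} = gen_map v {x} - (\<Sum>l<N. v (Inl l) * coord (f l) x)"
      by (simp add: gen_map_singleton)
    also have "\<dots> = (\<Sum>l<N. g x l * f l - G l * coord (f l) x)"
      by (simp add: g(2) vG' sum_subtractf)
    also have "\<dots> = (\<Sum>l<N. (- G l) * coord (f l) x - (- g x l) * f l)"
      by (rule sum.cong) (auto simp: algebra_simps)
    finally show ?thesis unfolding P .
  qed
  ultimately show ?thesis unfolding triv_rel_def by (intro CollectI exI[of _ "\<lambda>l y. - g y l"]) blast
qed

text \<open>Up to degree \<open>e\<close> the absence of syzygies applies. Above \<open>e\<close>,
  modulo \<open>I\<close>, a relation is a combination of relations of degree one less with the
  variables as coefficients, and \<open>triv_rel\<close> is closed under these operations.\<close>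

lemma syz_rel_triv:
  assumes inj: "\<And>s a. s \<le> e - int d \<Longrightarrow> syzygy f N s a \<Longrightarrow> \<forall>l<N. a l = 0"
    and e: "e \<ge> int d" "e \<ge> 2"
    and V: "\<And>j. j > e \<Longrightarrow> tor_k_zero 3 j"
  shows "v \<in> syz_rel j \<Longrightarrow> v \<in> triv_rel"
proof (induction "nat (j - e)" arbitrary: j v)
  case 0
  then show ?case by (intro syz_rel_low[OF inj]) auto
next
  case (Suc n)
  then have j: "j > e" by simp
  obtain y b where yb: "\<And>x. y x \<in> syz_rel (j - 1)" "b \<in> ideal_mod gen_wt gen_idx j"
    "v = (\<Sum>x\<in>UNIV. smul (var x) (y x)) + b"
  proof -
    have "j > int d" "j > 2" using j e by auto
    then show thesis by (rule syz_rel_generated[OF V[OF j] _ _ Suc.prems]) (rule that)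
  qed
  have y: "y x \<in> triv_rel" for x
    by (rule Suc.hyps(1)[OF _ yb(1)]) (use Suc.hyps(2) in simp)
  have b: "b \<in> triv_rel" by (rule gen_ideal_subset_triv_rel[OF yb(2)])
  have "(\<Sum>x\<in>X. smul (var x) (y x)) + b \<in> triv_rel" if "finite X" for X
    using that
  proof (induction X rule: finite_induct)
    case empty
    then show ?case using b by (simp only: sum.empty add_0)
  next
    case (insert x X)
    have "smul (var x) (y x) + ((\<Sum>x\<in>X. smul (var x) (y x)) + b) \<in> triv_rel"
      by (intro triv_rel_add triv_rel_smul y insert.IH)
    then show ?case unfolding sum.insert[OF insert.hyps] by (simp only: add.assoc)
  qed
  then show ?case unfolding yb(3) by simp
qed

text \<open>Induction on the degree. A syzygy \<open>a\<close> lifts to a relation on the second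
  syzygy module, and its triviality expresses \<open>a\<close> through a matrix \<open>c\<close> and
  the elements \<open>P_l\<close>. Antisymmetrising \<open>c\<close> leaves the error
  \<open>\<Sum> x T_x\<close>, and each \<open>T_x\<close> is again a syzygy, one degree
  lower.\<close>

lemma syzygies_koszul:
  assumes triv: "\<And>j v. v \<in> syz_rel j \<Longrightarrow> v \<in> triv_rel"
  shows "syzygy f N s a \<Longrightarrow> koszul_syzygy f (int d) N s a"
proof (induction "nat (s + 1)" arbitrary: s a rule: less_induct)
  case less
  show ?case
  proof (cases "s < 0")
    case True
    then have "a l = 0" if "l < N" for l
      using less.prems that by (auto simp: syzygy_def homog_neg)
    then show ?thesis unfolding koszul_syzygy_def by (intro exI[of _ "\<lambda>l m. 0"]) auto
  next
    case False
    define z where "z = (\<Sum>l<N. smul (a l) (koszul_lift (f l)))"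
    have a: "\<And>l. l < N \<Longrightarrow> a l \<in> homog s" "(\<Sum>l<N. a l * f l) = 0"
      using less.prems by (auto simp: syzygy_def)
    have z: "z \<in> koszul 1 (s + int d)"
      unfolding z_def by (rule lift_sum_koszul) (use a(1) in simp)
    have "kdiff z {} = 0" unfolding z_def kdiff_lift_sum by (rule a(2))
    then obtain \<kappa> where \<kappa>: "\<kappa> \<in> koszul 2 (s + int d)" "z = kdiff \<kappa>"
      using koszul_exact_1[OF z] by (auto simp: koszul_lift_zero)
    \<comment> \<open>The sign makes the two parts of \<open>gen_map v\<close>, which are
      \<open>z\<close> and \<open>- kdiff \<kappa>\<close>, cancel.\<close>
    define v where "v = case_sum (\<lambda>l. if l < N then a l else 0) (- \<kappa>)"
    have "v \<in> gen_mod (s + int d)"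
      unfolding v_def by (rule gen_modI) (use a(1) graded_sub_uminus[OF graded_sub_free_mod \<kappa>(1)] in auto)
    moreover have "gen_map v = 0"
      unfolding v_def gen_map_case_sum z_def[symmetric] \<kappa>(2) kdiff_uminus by simp
    ultimately have "v \<in> triv_rel" using zero_mem by (intro triv[of v "s + int d"]) (simp add: syz_rel_def)
    then obtain P where P: "\<And>l. l < N \<Longrightarrow> v (Inl l) + (\<Sum>y\<in>UNIV. var y * P l y) \<in> I"
      "\<And>x. kdiff (\<lambda>A. v (Inr A)) {x} = (\<Sum>l<N. (\<Sum>y\<in>UNIV. var y * P l y) * coord (f l) x - P l x * f l)"
      unfolding triv_rel_def by blast
    define p where "p = (\<lambda>l. \<Sum>y\<in>UNIV. var y * P l y)"
    have "\<exists>c. \<forall>l. l < N \<longrightarrow> a l + p l = (\<Sum>m<N. c l m * f m)"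
    proof (rule choice, rule allI)
      fix l
      show "\<exists>g. l < N \<longrightarrow> a l + p l = (\<Sum>m<N. g m * f m)"
      proof (cases "l < N")
        case True
        then have "a l + p l \<in> I" using P(1)[OF True] by (simp add: v_def p_def)
        then show ?thesis unfolding I_eq using ideal_gen_image_repr by blast
      qed simp
    qed
    then obtain c where c: "\<And>l. l < N \<Longrightarrow> a l + p l = (\<Sum>m<N. c l m * f m)" by blast
    \<comment> \<open>The relation for the Koszul part reads
      \<open>\<Sum> (a_l + p_l) \<tau>_l = \<Sum> f_l P_l\<close>, with \<open>\<tau>_l\<close> the
      lift of \<open>f l\<close>. Inserting \<open>c\<close> for \<open>a_l + p_l\<close> and
      collecting the coefficient of \<open>f m\<close> makes \<open>T x\<close> a syzygy.\<close>
    define T where "T = (\<lambda>x m. (\<Sum>l<N. c l m * coord (f l) x) - P m x)"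
    have T0: "(\<Sum>m<N. T x m * f m) = 0" for x
    proof -
      have "(\<Sum>l<N. a l * coord (f l) x) = z {x}" by (simp add: z_def sum_fun_apply)
      also have "\<dots> = - kdiff (\<lambda>A. v (Inr A)) {x}"
      proof -
        have "(\<lambda>A. v (Inr A)) = - \<kappa>" by (simp add: v_def fun_eq_iff)
        then show ?thesis by (simp only: kdiff_uminus \<kappa>(2) uminus_apply minus_minus)
      qed
      finally have az: "(\<Sum>l<N. (a l + p l) * coord (f l) x) = (\<Sum>l<N. P l x * f l)"
        unfolding P(2) by (simp add: p_def distrib_right sum.distrib sum_subtractf)
      have "(\<Sum>m<N. T x m * f m) = (\<Sum>m<N. \<Sum>l<N. c l m * f m * coord (f l) x) - (\<Sum>m<N. P m x * f m)"
      proof -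
        have "T x m * f m = (\<Sum>l<N. c l m * f m * coord (f l) x) - P m x * f m" for m
          unfolding T_def left_diff_distrib sum_distrib_right by (simp only: mult_ac)
        then show ?thesis by (simp only: sum_subtractf)
      qed
      also have "(\<Sum>m<N. \<Sum>l<N. c l m * f m * coord (f l) x) = (\<Sum>l<N. (\<Sum>m<N. c l m * f m) * coord (f l) x)"
        unfolding sum_distrib_right by (rule sum.swap)
      also have "\<dots> = (\<Sum>l<N. (a l + p l) * coord (f l) x)"
        by (rule sum.cong) (auto simp: c)
      finally show ?thesis using az by simp
    qed
    \<comment> \<open>Neither \<open>c\<close> nor \<open>P\<close> has to be homogeneous; from here
      on their contributions in the expected degrees are used.\<close>
    define T' where "T' = (\<lambda>x m. hcomp (s - 1) (T x m))"
    have "koszul_syzygy f (int d) N (s - 1) (T' x)" for x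
    proof (rule less.hyps)
      show "nat (s - 1 + 1) < nat (s + 1)" using False by simp
      have "(\<Sum>m<N. T' x m * f m) = hcomp (s - 1 + int d) (\<Sum>m<N. T x m * f m)"
        unfolding hcomp_sum T'_def by (intro sum.cong) (auto simp: hcomp_mult_right[OF f_homog])
      then show "syzygy f N (s - 1) (T' x)"
        using T0 by (simp add: syzygy_def T'_def hcomp_homog)
    qed
    then have K1: "koszul_syzygy f (int d) N s (\<lambda>m. \<Sum>x\<in>UNIV. var x * T' x m)"
      by (rule koszul_syzygy_sum)
    define c' where "c' = (\<lambda>l m. hcomp (s - int d) (c l m))"
    have K2: "koszul_syzygy f (int d) N s (\<lambda>l. \<Sum>m<N. (c' l m - c' m l) * f m)"
      unfolding koszul_syzygy_def by (rule exI[of _ c']) (simp add: c'_def hcomp_homog)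
    have "(\<Sum>m<N. (c' l m - c' m l) * f m) + (\<Sum>x\<in>UNIV. var x * T' x l) = a l" if l: "l < N" for l
    proof -
      \<comment> \<open>Summing \<open>T x\<close> against the variables turns the coordinates of
        \<open>f m\<close> back into \<open>f m\<close>; this produces the transpose of
        \<open>c\<close>.\<close>
      have "(\<Sum>x\<in>UNIV. var x * T x l) = (\<Sum>x\<in>UNIV. \<Sum>m<N. c m l * (var x * coord (f m) x)) - p l"
        by (simp add: T_def p_def right_diff_distrib sum_subtractf sum_distrib_left mult.left_commute)
      also have "(\<Sum>x\<in>UNIV. \<Sum>m<N. c m l * (var x * coord (f m) x)) = (\<Sum>m<N. c m l * (\<Sum>x\<in>UNIV. var x * coord (f m) x))"
        unfolding sum_distrib_left by (rule sum.swap)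
      also have "\<dots> = (\<Sum>m<N. c m l * f m)"
        by (rule sum.cong) (auto simp: sum_coord I_const[OF f_mem])
      finally have cf: "(\<Sum>m<N. c m l * f m) = p l + (\<Sum>x\<in>UNIV. var x * T x l)"
        by simp
      have "a l = (\<Sum>m<N. (c l m - c m l) * f m) + (\<Sum>x\<in>UNIV. var x * T x l)"
        unfolding left_diff_distrib sum_subtractf cf c[OF l, symmetric] by simp
      then have "hcomp s (a l) = hcomp s ((\<Sum>m<N. (c l m - c m l) * f m) + (\<Sum>x\<in>UNIV. var x * T x l))"
        by (rule arg_cong)
      also have "\<dots> = (\<Sum>m<N. (c' l m - c' m l) * f m) + (\<Sum>x\<in>UNIV. var x * T' x l)"
        unfolding hcomp_add hcomp_sum c'_def T'_def
        by (intro arg_cong2[where f = "(+)"] sum.cong refl)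
           (auto simp: hcomp_mult_right[OF f_homog] hcomp_mult[OF homog_var] hcomp_diff)
      finally show ?thesis using hcomp_id[OF a(1)[OF l]] by simp
    qed
    then show ?thesis by (rule koszul_syzygy_cong[OF _ koszul_syzygy_add[OF K2 K1]])
  qed
qed

lemma regular_if_tor_3_zero:
  assumes inj: "\<And>s a. s \<le> e - int d \<Longrightarrow> syzygy f N s a \<Longrightarrow> \<forall>l<N. a l = 0"
    and e: "e \<ge> int d" "e \<ge> 2"
    and V: "\<And>j. j > e \<Longrightarrow> tor_k_zero 3 j"
    and M: "M < N" and g: "g \<in> homog s" "g * f M \<in> ideal_gen (f ` {..<M})"
  shows "g \<in> ideal_gen (f ` {..<M})"
  by (rule koszul_syzygies_regular[OF f_homog _ syzygies_koszul[OF syz_rel_triv[OF inj e V]] M g])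
     (use d_pos in auto)

end

subsection \<open>Dimensions of finite-dimensional subspaces\<close>

context vector_space
begin

text \<open>The spaces of interest lie in an infinite-dimensional one; the finite set
  \<open>W\<close> certifies that \<open>V\<close> has finite dimension.\<close>

lemma finite_basis_exists:
  assumes "V \<subseteq> span W" "finite W"
  obtains B where "B \<subseteq> V" "independent B" "V \<subseteq> span B" "card B = dim V" "finite B"
proof -
  obtain B where B: "B \<subseteq> V" "independent B" "V \<subseteq> span B" "card B = dim V"
    using basis_exists[of V] .
  have "B \<subseteq> span W" using B(1) assms(1) by (rule subset_trans)
  then have "finite B" using independent_span_bound[OF assms(2) B(2)] by blast
  then show thesis using that B by blast
qed

lemma dim_mono_finite:
  assumes "U \<subseteq> V" "V \<subseteq> span W" "finite W"
  shows "dim U \<le> dim V"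
proof -
  obtain B where B: "V \<subseteq> span B" "card B = dim V" "finite B"
    using finite_basis_exists[OF assms(2,3)] by metis
  have "U \<subseteq> span B" using assms(1) B(1) by (rule subset_trans)
  then show ?thesis using dim_le_card[OF _ B(3)] B(2) by metis
qed

lemma subset_if_dim_le:
  assumes "subspace U" "U \<subseteq> V" "V \<subseteq> span W" "finite W" "dim V \<le> dim U"
  shows "V \<subseteq> U"
proof
  fix v assume v: "v \<in> V"
  show "v \<in> U"
  proof (rule ccontr)
    assume "v \<notin> U"
    obtain C where C: "V \<subseteq> span C" "card C = dim V" "finite C"
      using finite_basis_exists[OF assms(3,4)] by metis
    have "U \<subseteq> span C" using assms(2) C(1) by (rule subset_trans)
    then obtain B where B: "B \<subseteq> U" "independent B" "card B = dim U" "finite B"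
      using finite_basis_exists[OF _ C(3)] by metis
    have "span B \<subseteq> U" by (rule span_minimal[OF B(1) assms(1)])
    then have nB: "v \<notin> span B" using \<open>v \<notin> U\<close> by blast
    then have "independent (insert v B)" by (rule independent_insertI[OF _ B(2)])
    moreover have "insert v B \<subseteq> span C" using v B(1) assms(2) C(1) by blast
    ultimately have "card (insert v B) \<le> card C" using independent_span_bound[OF C(3)] by blast
    moreover have "v \<notin> B" using nB span_base by blast
    ultimately show False using B C(2) assms(5) by simp
  qed
qed

text \<open>Dropping an index with nonzero coefficient would leave fewer than \<open>dim V\<close>
  elements spanning \<open>V\<close>. The family is indexed by \<open>P\<close>, so coinciding
  values are excluded as well.\<close>

lemma coeffs_zero_if_dim_ge_card:
  assumes P: "finite P" and V: "V \<subseteq> span (g ` P)" "card P \<le> dim V"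
    and sum: "(\<Sum>p\<in>P. c p *s g p) = 0" and p: "p \<in> P"
  shows "c p = 0"
proof (rule ccontr)
  assume c: "c p \<noteq> 0"
  let ?Q = "P - {p}"
  have "c p *s g p = - (\<Sum>q\<in>?Q. c q *s g q)"
    using sum by (simp add: sum.remove[OF P p] eq_neg_iff_add_eq_0)
  also have "\<dots> \<in> span (g ` ?Q)"
    by (intro span_neg span_sum span_scale span_base) auto
  finally have "inverse (c p) *s (c p *s g p) \<in> span (g ` ?Q)" by (rule span_scale)
  then have gp: "g p \<in> span (g ` ?Q)" using c by simp
  have "g ` P \<subseteq> span (g ` ?Q)"
  proof
    fix y assume "y \<in> g ` P"
    then obtain q where q: "q \<in> P" "y = g q" by blast
    show "y \<in> span (g ` ?Q)"
    proof (cases "q = p")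
      case False
      then have "y \<in> g ` ?Q" using q by blast
      then show ?thesis by (rule span_base)
    qed (use gp q in simp)
  qed
  then have "V \<subseteq> span (g ` ?Q)" using V(1) span_minimal[OF _ subspace_span] by blast
  then have "dim V \<le> card (g ` ?Q)" by (rule dim_le_card) (use P in simp)
  also have "\<dots> \<le> card ?Q" using P by (intro card_image_le) simp
  also have "\<dots> < card P" using P p by (rule card_Diff1_less)
  finally show False using V(2) by simp
qed

text \<open>Rank-nullity for the map induced by \<open>\<phi>\<close> from \<open>X\<close> to the
  ambient space modulo \<open>Y\<close>. A basis \<open>B\<close> of the kernel is extended to one
  of \<open>X\<close>, and the images of the added elements \<open>C\<close> are independent modulo
  \<open>Y\<close>.\<close>

lemma dim_add_image:
  assumes \<phi>: "\<And>u v. \<phi> (u + v) = \<phi> u + \<phi> v" "\<And>c u. \<phi> (c *s u) = c *s \<phi> u"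
    and X: "subspace X" "X \<subseteq> span W" "finite W" and Y: "subspace Y" "Y \<subseteq> span W'" "finite W'"
  shows "dim {y + \<phi> x | y x. y \<in> Y \<and> x \<in> X} + dim {x \<in> X. \<phi> x \<in> Y} = dim Y + dim X"
proof -
  let ?K = "{x \<in> X. \<phi> x \<in> Y}" and ?Z = "{y + \<phi> x | y x. y \<in> Y \<and> x \<in> X}"
  have \<phi>0: "\<phi> 0 = 0" using \<phi>(2)[of 0 0] by simp
  have KW: "?K \<subseteq> span W" using X(2) by blast
  obtain B where B: "B \<subseteq> ?K" "independent B" "?K \<subseteq> span B" "card B = dim ?K" "finite B"
    by (rule finite_basis_exists[OF KW X(3)])
  have "B \<subseteq> X" using B(1) by blast
  then obtain BC where BC: "B \<subseteq> BC" "BC \<subseteq> X" "independent BC" "X \<subseteq> span BC"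
    using maximal_independent_subset_extend[OF _ B(2)] by metis
  have "BC \<subseteq> span W" using BC(2) X(2) by (rule subset_trans)
  then have finBC: "finite BC" using independent_span_bound[OF X(3) BC(3)] by blast
  have dimX: "card BC = dim X" by (rule basis_card_eq_dim[OF BC(2,4,3)])
  define C where "C = BC - B"
  have C: "finite C" "C \<subseteq> X" "C \<inter> B = {}" "BC = B \<union> C" using finBC BC by (auto simp: C_def)
  obtain D where D: "D \<subseteq> Y" "independent D" "Y \<subseteq> span D" "card D = dim Y" "finite D"
    using finite_basis_exists[OF Y(2,3)] by metis
  have spanD: "span D = Y" using D(1,3) span_minimal[OF D(1) Y(1)] by blast
  have sub\<phi>: "subspace (\<phi> ` span C')" for C'
    unfolding subspace_def
  proof (intro conjI ballI allI)
    show "0 \<in> \<phi> ` span C'" using span_zero \<phi>0 by (metis imageI)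
    show "a + b \<in> \<phi> ` span C'" if ab: "a \<in> \<phi> ` span C'" "b \<in> \<phi> ` span C'" for a b
    proof -
      obtain u v where "a = \<phi> u" "b = \<phi> v" "u \<in> span C'" "v \<in> span C'" using ab by blast
      then show ?thesis using \<phi>(1)[of u v] span_add[of u C' v] by (metis imageI)
    qed
    show "c *s a \<in> \<phi> ` span C'" if a: "a \<in> \<phi> ` span C'" for c a
    proof -
      obtain u where "a = \<phi> u" "u \<in> span C'" using a by blast
      then show ?thesis using \<phi>(2)[of c u] span_scale[of u C' c] by (metis imageI)
    qed
  qed
  have span\<phi>: "span (\<phi> ` C') \<subseteq> \<phi> ` span C'" for C'
    by (rule span_minimal[OF _ sub\<phi>]) (use span_base in blast)
  have ind: "independent (D \<union> \<phi> ` C') \<and> card (D \<union> \<phi> ` C') = card D + card C'" if "C' \<subseteq> C" for C'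
    using finite_subset[OF that C(1)] that
  proof (induction C' rule: finite_induct)
    case empty
    then show ?case using D(2) by simp
  next
    case (insert c C')
    have notin: "\<phi> c \<notin> span (D \<union> \<phi> ` C')"
    proof
      assume "\<phi> c \<in> span (D \<union> \<phi> ` C')"
      then obtain y z where yz: "\<phi> c = y + z" "y \<in> Y" "z \<in> span (\<phi> ` C')"
        unfolding span_Un spanD by blast
      obtain x where x: "z = \<phi> x" "x \<in> span C'" using span\<phi> yz(3) by blast
      have xX: "x \<in> X" using x(2) insert.prems C(2) span_minimal[OF _ X(1), of C'] by blast
      have "\<phi> (c - x) = y" using \<phi>(1)[of "c - x" x] yz(1) x(1) by simp
      then have "c - x \<in> ?K"
        using subspace_diff[OF X(1) _ xX] insert.prems C(2) yz(2) by auto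
      then have "c - x \<in> span B" using B(3) by blast
      then have "c - x \<in> span (B \<union> C')" using span_mono[of B "B \<union> C'"] by blast
      moreover have "x \<in> span (B \<union> C')" using x(2) span_mono[of C' "B \<union> C'"] by blast
      ultimately have "(c - x) + x \<in> span (B \<union> C')" by (rule span_add)
      then have "c \<in> span (B \<union> C')" by simp
      moreover have "B \<union> C' \<subseteq> BC - {c}" using C insert by blast
      ultimately have "c \<in> span (BC - {c})" using span_mono by blast
      moreover have "c \<in> BC" using C insert by blast
      ultimately show False using BC(3) by (auto simp: dependent_def)
    qed
    have IH: "independent (D \<union> \<phi> ` C')" "card (D \<union> \<phi> ` C') = card D + card C'"
      using insert.IH insert.prems by auto
    have eq: "D \<union> \<phi> ` insert c C' = insert (\<phi> c) (D \<union> \<phi> ` C')" by blast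
    have "\<phi> c \<notin> D \<union> \<phi> ` C'" using notin span_superset by (rule contra_subsetD[rotated])
    then have "card (insert (\<phi> c) (D \<union> \<phi> ` C')) = Suc (card D + card C')"
      using IH(2) D(5) insert.hyps(1) by (subst card_insert_disjoint) auto
    then show ?case unfolding eq using independent_insertI[OF notin IH(1)] insert.hyps by simp
  qed
  have E: "independent (D \<union> \<phi> ` C)" "card (D \<union> \<phi> ` C) = card D + card C" using ind by blast+
  have "0 \<in> X" "0 \<in> Y" using subspace_0 X(1) Y(1) by blast+
  then have EZ: "D \<union> \<phi> ` C \<subseteq> ?Z"
  proof -
    have "y \<in> ?Z" if "y \<in> D" for y
    proof -
      have "y = y + \<phi> 0" using \<phi>0 by simp
      then show ?thesis using that D(1) \<open>0 \<in> X\<close> by blast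
    qed
    moreover have "\<phi> c \<in> ?Z" if "c \<in> C" for c
    proof -
      have "\<phi> c = 0 + \<phi> c" by simp
      then show ?thesis using that C(2) \<open>0 \<in> Y\<close> by blast
    qed
    ultimately show ?thesis by blast
  qed
  have "?Z \<subseteq> span (D \<union> \<phi> ` C)"
  proof
    fix z assume "z \<in> ?Z"
    then obtain y x where z: "z = y + \<phi> x" "y \<in> Y" "x \<in> X" by blast
    have "x \<in> span (B \<union> C)" using z(3) BC(4) C(4) by blast
    then obtain b c where bc: "x = b + c" "b \<in> span B" "c \<in> span C" unfolding span_Un by blast
    have "subspace ?K"
      unfolding subspace_def using X(1) Y(1) \<phi> \<phi>0 by (auto simp: subspace_def)
    then have "b \<in> ?K" using bc(2) span_minimal[OF B(1)] by blast
    then have "y + \<phi> b \<in> Y" using z(2) subspace_add[OF Y(1)] by blast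
    then have 1: "y + \<phi> b \<in> span (D \<union> \<phi> ` C)" using spanD span_mono[of D "D \<union> \<phi> ` C"] by blast
    have "subspace {c. \<phi> c \<in> span (D \<union> \<phi> ` C)}"
      unfolding subspace_def by (auto simp: \<phi> \<phi>0 span_zero span_add span_scale)
    then have "span C \<subseteq> {c. \<phi> c \<in> span (D \<union> \<phi> ` C)}"
      by (rule span_minimal[rotated]) (auto intro: span_base)
    then have "\<phi> c \<in> span (D \<union> \<phi> ` C)" using bc(3) by blast
    from span_add[OF 1 this] show "z \<in> span (D \<union> \<phi> ` C)"
      by (simp add: z(1) bc(1) \<phi>(1) add.assoc)
  qed
  then have "dim ?Z = card D + card C" using basis_card_eq_dim[OF EZ _ E(1)] E(2) by simp
  moreover have "card BC = card B + card C" using C B(5) by (simp add: card_Un_disjoint Int_commute)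
  ultimately show ?thesis using B(4) D(4) dimX by simp
qed

end

subsection \<open>Hilbert functions\<close>

interpretation poly_vs: vector_space "scale_poly :: 'k::field \<Rightarrow> ('x::finite, 'k) mpoly \<Rightarrow> ('x, 'k) mpoly"
  by unfold_locales (simp_all add: scale_poly_def distrib_left distrib_right single_add mult_single flip: mult.assoc)

definition monomials :: "'x::finite itself \<Rightarrow> nat \<Rightarrow> ('x \<Rightarrow>\<^sub>0 nat) set" where
  "monomials _ j = {t. mono_deg t = j}"

text \<open>The exponents along a fixed enumeration of the variables form a list with sum
  \<open>j\<close>, and such lists are counted by stars and bars.\<close>

lemma card_monomials:
  "finite (monomials TYPE('x::finite) j)"
  "card (monomials TYPE('x) j) = (j + card (UNIV :: 'x set) - 1) choose j"
proof -
  obtain xs :: "'x list" where xs: "set xs = UNIV" "distinct xs"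
    using finite_distinct_list[OF finite[of "UNIV :: 'x set"]] by blast
  have len: "length xs = card (UNIV :: 'x set)" using distinct_card[OF xs(2)] xs(1) by simp
  let ?L = "{l :: nat list. length l = length xs \<and> sum_list l = j}"
  let ?g = "\<lambda>t :: 'x \<Rightarrow>\<^sub>0 nat. map (Poly_Mapping.lookup t) xs"
  have bij: "bij_betw ?g (monomials TYPE('x) j) ?L"
    unfolding bij_betw_def
  proof
    show "inj_on ?g (monomials TYPE('x) j)"
      using xs(1) by (auto simp: inj_on_def intro!: poly_mapping_eqI)
    have sum: "sum_list (?g t) = mono_deg t" for t
      using xs by (simp add: mono_deg_def sum_list_distinct_conv_sum_set)
    show "?g ` monomials TYPE('x) j = ?L"
    proof
      show "?g ` monomials TYPE('x) j \<subseteq> ?L" using sum by (auto simp: monomials_def)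
      show "?L \<subseteq> ?g ` monomials TYPE('x) j"
      proof
        fix l assume l: "l \<in> ?L"
        define t :: "'x \<Rightarrow>\<^sub>0 nat" where "t = Abs_poly_mapping (\<lambda>x. the (map_of (zip xs l) x))"
        have t: "Poly_Mapping.lookup t = (\<lambda>x. the (map_of (zip xs l) x))"
          unfolding t_def by (rule Abs_poly_mapping_inverse) simp
        have "?g t = l"
          using l xs(2) by (intro nth_equalityI) (auto simp: t map_of_zip_nth)
        moreover from this have "mono_deg t = j" using sum[of t] l by simp
        ultimately show "l \<in> ?g ` monomials TYPE('x) j" by (auto simp: monomials_def)
      qed
    qed
  qed
  have "?L \<subseteq> {l. set l \<subseteq> {..j} \<and> length l = length xs}"
    using member_le_sum_list by fastforce
  then have "finite ?L" using finite_lists_length_eq[of "{..j}" "length xs"] finite_subset by blast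
  then show "finite (monomials TYPE('x) j)" using bij bij_betw_finite by blast
  show "card (monomials TYPE('x) j) = (j + card (UNIV :: 'x set) - 1) choose j"
    using bij_betw_same_card[OF bij] card_length_sum_list[of "length xs" j] len by simp
qed

definition mono_polys :: "nat \<Rightarrow> ('x::finite, 'k::field) mpoly set" where
  "mono_polys j = (\<lambda>t. Poly_Mapping.single t 1) ` monomials TYPE('x) j"

lemma finite_mono_polys: "finite (mono_polys j)"
  by (simp add: mono_polys_def card_monomials)

lemma scale_poly_single: "scale_poly c (Poly_Mapping.single t 1) = Poly_Mapping.single t c"
  by (simp add: scale_poly_def mult_single)

lemma subspace_homog: "poly_vs.subspace (homog q)"
  by (auto simp: poly_vs.subspace_def scale_poly_def intro: homog_add homog_mult'[OF homog_const])

lemma homog_expand: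
  fixes p :: "('x::finite, 'k::field) mpoly"
  assumes "p \<in> homog (int j)"
  shows "p = (\<Sum>t\<in>monomials TYPE('x) j. Poly_Mapping.single t (Poly_Mapping.lookup p t))"
proof -
  have "(\<Sum>t\<in>monomials TYPE('x) j. Poly_Mapping.single t (Poly_Mapping.lookup p t))
     = (\<Sum>t\<in>Poly_Mapping.keys p. Poly_Mapping.single t (Poly_Mapping.lookup p t))"
    by (rule sum.mono_neutral_right)
       (use assms card_monomials in \<open>auto simp: monomials_def homog_def in_keys_iff\<close>)
  then show ?thesis by (simp add: sum_monomials)
qed

lemma homog_span: "homog (int j) \<subseteq> poly_vs.span (mono_polys j)"
proof
  fix p :: "('x::finite, 'k::field) mpoly" assume "p \<in> homog (int j)"
  then have "p = (\<Sum>t\<in>monomials TYPE('x) j. scale_poly (Poly_Mapping.lookup p t) (Poly_Mapping.single t 1))"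
    using homog_expand[of p j] by (simp add: scale_poly_single)
  also have "\<dots> \<in> poly_vs.span (mono_polys j)"
    by (intro poly_vs.span_sum poly_vs.span_scale poly_vs.span_base) (simp add: mono_polys_def)
  finally show "p \<in> poly_vs.span (mono_polys j)" .
qed

lemma dim_homog:
  "poly_vs.dim (homog (int j) :: ('x::finite, 'k::field) mpoly set) = card (monomials TYPE('x) j)"
proof (rule poly_vs.dim_unique)
  show "(mono_polys j :: ('x, 'k) mpoly set) \<subseteq> homog (int j)"
    using homog_single by (fastforce simp: mono_polys_def monomials_def)
  show "homog (int j) \<subseteq> poly_vs.span (mono_polys j :: ('x, 'k) mpoly set)" by (rule homog_span)
  have inj: "inj_on (\<lambda>t. Poly_Mapping.single t (1 :: 'k)) (monomials TYPE('x) j)"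
    by (rule inj_onI) (metis lookup_single_eq lookup_single_not_eq zero_neq_one)
  then show "card (mono_polys j :: ('x, 'k) mpoly set) = card (monomials TYPE('x) j)"
    unfolding mono_polys_def by (rule card_image)
  show "poly_vs.independent (mono_polys j :: ('x, 'k) mpoly set)"
  proof (rule poly_vs.independent_if_scalars_zero[OF finite_mono_polys])
    fix c :: "('x, 'k) mpoly \<Rightarrow> 'k" and p :: "('x, 'k) mpoly"
    assume sum: "(\<Sum>p\<in>mono_polys j. scale_poly (c p) p) = 0" and p: "p \<in> mono_polys j"
    obtain t where t: "t \<in> monomials TYPE('x) j" "p = Poly_Mapping.single t 1" using p by (auto simp: mono_polys_def)
    have "(\<Sum>p\<in>mono_polys j. scale_poly (c p) p)
       = (\<Sum>s\<in>monomials TYPE('x) j. Poly_Mapping.single s (c (Poly_Mapping.single s 1)))"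
      unfolding mono_polys_def sum.reindex[OF inj] by (simp add: scale_poly_single)
    then have "0 = Poly_Mapping.lookup (\<Sum>s\<in>monomials TYPE('x) j. Poly_Mapping.single s (c (Poly_Mapping.single s 1))) t"
      using sum by simp
    also have "\<dots> = (\<Sum>s\<in>monomials TYPE('x) j. if s = t then c (Poly_Mapping.single t 1) else 0)"
      unfolding lookup_sum by (rule sum.cong) (auto simp: lookup_single when_def)
    also have "\<dots> = c p" using t card_monomials(1)[where ?'x = 'x] by simp
    finally show "c p = 0" by simp
  qed
qed

context graded_ideal
begin

lemma subspace_I: "poly_vs.subspace (I \<inter> homog q)"
  using subspace_homog by (auto simp: poly_vs.subspace_def scale_poly_def intro: zero_mem add_mem mult_mem)

lemma hilbert_fun_eq:
  "hilbert_fun I j = card (monomials TYPE('x) j) - poly_vs.dim (I \<inter> homog (int j))"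
  by (simp add: hilbert_fun_def homog_int[symmetric] dim_homog)

lemma dim_I_le: "poly_vs.dim (I \<inter> homog (int j)) \<le> card (monomials TYPE('x) j)"
  unfolding dim_homog[where ?'k = 'k, symmetric]
  by (rule poly_vs.dim_mono_finite[OF _ homog_span finite_mono_polys]) auto

text \<open>A form of positive degree is a combination of its coordinates, of one degree less, with
  the variables; so the vanishing of \<open>R\<close> propagates upwards from degree
  \<open>e\<close>.\<close>

lemma homog_subset_if_hilbert_fun_0:
  assumes "hilbert_fun I e = 0"
  shows "p \<in> homog (int e + int k) \<Longrightarrow> p \<in> I"
proof (induction k arbitrary: p)
  case 0
  have "homog (int e) \<subseteq> I \<inter> homog (int e)"
    by (rule poly_vs.subset_if_dim_le[OF subspace_I _ homog_span finite_mono_polys])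
       (use assms in \<open>auto simp: hilbert_fun_eq dim_homog\<close>)
  then show ?case using 0 by auto
next
  case (Suc k)
  have "coord p x \<in> I" for x
    using Suc.IH coord_homog[OF Suc.prems, of x] by (simp add: add_diff_eq)
  moreover have "p = (\<Sum>x\<in>UNIV. var x * coord p x)"
    using const_coeff_homog[OF Suc.prems] by (simp add: sum_coord)
  ultimately show ?case using sum_mem mult_mem by (metis (no_types, lifting))
qed

end

context generated_ideal
begin

lemma I_homog_span:
  assumes "d \<le> e"
  shows "I \<inter> homog (int e) \<subseteq> poly_vs.span
     ((\<lambda>(l, t). Poly_Mapping.single t 1 * f l) ` ({..<N} \<times> monomials TYPE('x) (e - d)))" (is "_ \<subseteq> poly_vs.span ?W")
proof
  fix p assume "p \<in> I \<inter> homog (int e)"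
  then obtain g where g: "\<And>l. g l \<in> homog (int e - int d)" "p = (\<Sum>l<N. g l * f l)"
    using I_repr[of p "int e"] by blast
  have "g l * f l \<in> poly_vs.span ?W" if l: "l < N" for l
  proof -
    have "g l \<in> homog (int (e - d))" using g(1) assms by (simp add: of_nat_diff)
    then have "g l * f l = (\<Sum>t\<in>monomials TYPE('x) (e - d). Poly_Mapping.single t (Poly_Mapping.lookup (g l) t)) * f l"
      using homog_expand by metis
    also have "\<dots> = (\<Sum>t\<in>monomials TYPE('x) (e - d). scale_poly (Poly_Mapping.lookup (g l) t) (Poly_Mapping.single t 1 * f l))"
      by (simp add: sum_distrib_right scale_poly_def mult_single flip: mult.assoc)
    also have "\<dots> \<in> poly_vs.span ?W"
      by (intro poly_vs.span_sum poly_vs.span_scale poly_vs.span_base) (use l in auto)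
    finally show ?thesis .
  qed
  then show "p \<in> poly_vs.span ?W"
    unfolding g(2) by (intro poly_vs.span_sum) auto
qed

lemma dim_I_le_generators:
  assumes "d \<le> e"
  shows "poly_vs.dim (I \<inter> homog (int e)) \<le> N * card (monomials TYPE('x) (e - d))"
proof -
  let ?P = "{..<N} \<times> monomials TYPE('x) (e - d)"
  have "poly_vs.dim (I \<inter> homog (int e)) \<le> card ((\<lambda>(l, t). Poly_Mapping.single t 1 * f l) ` ?P)"
    by (rule poly_vs.dim_le_card[OF I_homog_span[OF assms]]) (simp add: card_monomials)
  also have "\<dots> \<le> card ?P" by (rule card_image_le) (simp add: card_monomials)
  finally show ?thesis by (simp add: card_cartesian_product)
qed

text \<open>The products of the forms with the monomials of degree \<open>e - d\<close> span
  \<open>I_e\<close>; if its dimension reaches their number, they are independent. A syzygy with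
  coefficients of smaller degree is multiplied by a variable until it reaches that degree.\<close>

lemma no_syzygies:
  assumes e: "d \<le> e" and dim: "N * card (monomials TYPE('x) (e - d)) \<le> poly_vs.dim (I \<inter> homog (int e))"
    and s: "s \<le> int e - int d" and a: "syzygy f N s a"
  shows "\<forall>l<N. a l = 0"
  using s a
proof (induction "nat (int e - int d - s)" arbitrary: s a)
  case 0
  then have s: "s = int (e - d)" using e by (simp add: of_nat_diff)
  let ?P = "{..<N} \<times> monomials TYPE('x) (e - d)"
  let ?c = "\<lambda>(l, t). Poly_Mapping.lookup (a l) t" and ?g = "\<lambda>(l, t). Poly_Mapping.single t 1 * f l"
  have "(\<Sum>p\<in>?P. scale_poly (?c p) (?g p))
     = (\<Sum>(l, t)\<in>?P. Poly_Mapping.single t (Poly_Mapping.lookup (a l) t) * f l)"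
    by (rule sum.cong) (auto simp: scale_poly_def mult_single simp flip: mult.assoc)
  also have "\<dots> = (\<Sum>l<N. \<Sum>t\<in>monomials TYPE('x) (e - d). Poly_Mapping.single t (Poly_Mapping.lookup (a l) t) * f l)"
    by (rule sum.cartesian_product[symmetric])
  also have "\<dots> = (\<Sum>l<N. a l * f l)"
  proof (rule sum.cong[OF refl])
    fix l assume "l \<in> {..<N}"
    then have "a l \<in> homog (int (e - d))" using 0(3) s by (auto simp: syzygy_def)
    from homog_expand[OF this, symmetric]
    show "(\<Sum>t\<in>monomials TYPE('x) (e - d). Poly_Mapping.single t (Poly_Mapping.lookup (a l) t) * f l) = a l * f l"
      by (simp only: sum_distrib_right[symmetric])
  qed
  finally have sum: "(\<Sum>p\<in>?P. scale_poly (?c p) (?g p)) = 0" using 0(3) by (simp add: syzygy_def)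
  have "?c p = 0" if "p \<in> ?P" for p
  proof (rule poly_vs.coeffs_zero_if_dim_ge_card[OF _ I_homog_span[OF e] _ sum that])
    show "finite ?P" by (simp add: card_monomials)
    show "card ?P \<le> poly_vs.dim (I \<inter> homog (int e))" using dim by (simp add: card_cartesian_product)
  qed
  then have c: "Poly_Mapping.lookup (a l) t = 0" if "l < N" "t \<in> monomials TYPE('x) (e - d)" for l t
    using that by fastforce
  show ?case
  proof (intro allI impI)
    fix l assume l: "l < N"
    then have "a l \<in> homog (int (e - d))" using 0(3) s by (simp add: syzygy_def)
    then show "a l = 0" using homog_expand[of "a l" "e - d"] c[OF l] by simp
  qed
next
  case (Suc n)
  define x where "x = (SOME x :: 'x. True)"
  have "syzygy f N (s + 1) (\<lambda>l. var x * a l)"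
    using Suc.prems(2)
    by (auto simp: syzygy_def mult.assoc sum_distrib_left[symmetric] intro!: homog_mult'[OF homog_var])
  then have "\<forall>l<N. var x * a l = 0"
    using Suc.hyps(2) by (intro Suc.hyps(1)[of "s + 1"]) auto
  then show ?case by (simp add: var_mult_eq_0_iff)
qed

end

subsection \<open>Hilbert series\<close>

unbundle fps_syntax

text \<open>The expansion of \<open>1/(1 - z)^n\<close>. With truncated subtraction the formula is
  right for \<open>n = 0\<close> too, where only \<open>j = 0\<close> gives a nonzero
  coefficient.\<close>

definition binom_series :: "nat \<Rightarrow> rat fps" where
  "binom_series n = Abs_fps (\<lambda>j. of_nat ((j + n - 1) choose j))"

lemma binom_series_mult: "binom_series n * (1 - fps_X) ^ n = 1"
proof (induction n)
  case 0
  show ?case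
  proof (rule fps_ext)
    fix j
    show "(binom_series 0 * (1 - fps_X) ^ 0) $ j = 1 $ j"
      by (cases j) (auto simp: binom_series_def)
  qed
next
  case (Suc n)
  have "binom_series (Suc n) * (1 - fps_X) = binom_series n"
  proof (rule fps_ext)
    fix j
    have "(binom_series (Suc n) * (1 - fps_X)) $ j = binom_series (Suc n) $ j - (fps_X * binom_series (Suc n)) $ j"
      by (simp only: right_diff_distrib mult_1_right mult.commute[of fps_X] fps_sub_nth)
    also have "\<dots> = binom_series n $ j"
      by (cases j) (auto simp: binom_series_def)
    finally show "(binom_series (Suc n) * (1 - fps_X)) $ j = binom_series n $ j" .
  qed
  then have "binom_series (Suc n) * (1 - fps_X) ^ Suc n = binom_series n * (1 - fps_X) ^ n"
    by (simp add: mult.assoc[symmetric])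
  then show ?case using Suc.IH by simp
qed

lemma one_minus_X_power_low:
  assumes "d > 0" "j < 2 * d"
  shows "((1 - fps_X ^ d) ^ N :: rat fps) $ j = (if j = 0 then 1 else if j = d then - of_nat N else 0)"
  using assms(2)
proof (induction N arbitrary: j)
  case 0
  then show ?case by simp
next
  case (Suc N)
  have "((1 - fps_X ^ d) ^ Suc N :: rat fps) $ j
     = ((1 - fps_X ^ d) ^ N) $ j - (fps_X ^ d * (1 - fps_X ^ d) ^ N) $ j"
    by (simp add: left_diff_distrib)
  also have "\<dots> = ((1 - fps_X ^ d) ^ N) $ j - (if j < d then 0 else ((1 - fps_X ^ d) ^ N) $ (j - d))"
    by (simp only: fps_X_power_mult_nth)
  also have "\<dots> = (if j = 0 then 1 else if j = d then - of_nat (Suc N) else 0)"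
    using Suc.IH[of j] Suc.IH[of "j - d"] Suc.prems assms(1) by auto
  finally show ?case .
qed

text \<open>Below degree \<open>2 d\<close> the numerator is \<open>1 - N z^d\<close>, so only two
  terms of the Cauchy product survive.\<close>

lemma expected_series_nth:
  assumes d: "d > 0" "d \<le> e" "e < 2 * d"
  shows "((1 - fps_X ^ d) ^ N / (1 - fps_X) ^ n :: rat fps) $ e
    = of_nat ((e + n - 1) choose e) - of_nat N * of_nat ((e - d + n - 1) choose (e - d))"
proof -
  have "(1 - fps_X) ^ n * binom_series n = 1" using binom_series_mult by (simp add: mult.commute)
  then have inv: "inverse ((1 - fps_X) ^ n :: rat fps) = binom_series n" by (rule fps_inverse_unique)
  have "((1 - fps_X) ^ n :: rat fps) $ 0 \<noteq> 0" by (simp add: fps_power_zeroth)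
  then have "((1 - fps_X ^ d) ^ N / (1 - fps_X) ^ n :: rat fps) = (1 - fps_X ^ d) ^ N * binom_series n"
    by (simp add: fps_divide_unit inv)
  then have "((1 - fps_X ^ d) ^ N / (1 - fps_X) ^ n :: rat fps) $ e
     = (\<Sum>i=0..e. ((1 - fps_X ^ d) ^ N) $ i * binom_series n $ (e - i))"
    by (simp add: fps_mult_nth)
  also have "\<dots> = (\<Sum>i=0..e. (if i = 0 then binom_series n $ e else 0) +
       (if i = d then - of_nat N * binom_series n $ (e - d) else 0))"
    using d by (intro sum.cong) (auto simp: one_minus_X_power_low)
  also have "\<dots> = binom_series n $ e - of_nat N * binom_series n $ (e - d)"
    using d by (simp add: sum.distrib)
  finally show ?thesis by (simp add: binom_series_def)
qed

text \<open>Over a regular sequence the Hilbert series is multiplied by \<open>1 - z^d\<close> for every form. If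
  there are more forms than variables, then the result is divisible by \<open>1 - z\<close>, and its partial sums
  are positive although they are the coefficients of a polynomial.\<close>

lemma polynomial_series_contradiction:
  assumes h: "\<And>j. h j \<ge> 0" "h 0 = (1 :: rat)" and N: "N > n"
    and eq: "Abs_fps h * (1 - fps_X) ^ n = (1 - fps_X ^ d) ^ N"
  shows False
proof -
  \<comment> \<open>\<open>q\<close> is \<open>1 - z^d\<close> divided by \<open>1 - z\<close>, and
    \<open>w\<close> is what remains of the right-hand side after cancelling \<open>n + 1\<close>
    factors \<open>1 - z\<close>; its coefficients are the partial sums of \<open>h\<close>.\<close>
  define q :: "rat poly" where "q = (\<Sum>i<d. monom 1 i)"
  define w :: "rat poly" where "w = (1 - [:0, 1:]) ^ (N - n - 1) * q ^ N"
  have q: "fps_of_poly q = (\<Sum>i<d. fps_X ^ i)"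
    by (simp add: q_def fps_of_poly_sum fps_of_poly_monom')
  have X: "(1 - fps_X ^ d :: rat fps) = (1 - fps_X) * (\<Sum>i<d. fps_X ^ i)"
    by (rule one_diff_power_eq)
  have w: "fps_of_poly w = (1 - fps_X) ^ (N - n - 1) * (\<Sum>i<d. fps_X ^ i) ^ N"
    by (simp add: w_def fps_of_poly_mult fps_of_poly_power fps_of_poly_diff q)
  have N': "N = n + Suc (N - n - 1)" using N by simp
  have "(1 - fps_X ^ d :: rat fps) ^ N = (1 - fps_X) ^ N * (\<Sum>i<d. fps_X ^ i) ^ N"
    unfolding X by (rule power_mult_distrib)
  also have "(1 - fps_X :: rat fps) ^ N = (1 - fps_X) ^ n * ((1 - fps_X) * (1 - fps_X) ^ (N - n - 1))"
    by (subst N') (simp only: power_add power_Suc)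
  finally have "(1 - fps_X) ^ n * Abs_fps h = (1 - fps_X) ^ n * ((1 - fps_X) * fps_of_poly w)"
    using eq unfolding w by (simp only: mult_ac)
  moreover have "(1 - fps_X :: rat fps) ^ n \<noteq> 0"
  proof -
    have "((1 - fps_X :: rat fps) ^ n) $ 0 \<noteq> 0" by (simp add: fps_power_zeroth)
    then show ?thesis by force
  qed
  ultimately have hw: "Abs_fps h = (1 - fps_X) * fps_of_poly w" by simp
  have step: "h (Suc j) = coeff w (Suc j) - coeff w j" for j
    using arg_cong[OF hw, of "\<lambda>F. F $ Suc j"] by (simp add: left_diff_distrib)
  have "coeff w j \<ge> 1" for j
  proof (induction j)
    case 0
    show ?case using arg_cong[OF hw, of "\<lambda>F. F $ 0"] h(2) by (simp add: left_diff_distrib)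
  next
    case (Suc j)
    then show ?case using step[of j] h(1)[of "Suc j"] by simp
  qed
  from this[of "Suc (degree w)"] show False by (simp add: coeff_eq_0)
qed

section \<open>Hilbert series of the partial ideals along a regular sequence\<close>

context generated_ideal
begin

abbreviation partial_ideal :: "nat \<Rightarrow> ('x, 'k) mpoly set" where
  "partial_ideal M \<equiv> ideal_gen (f ` {..<M})"

lemma partial_generated:
  assumes "M \<le> N"
  shows "generated_ideal (partial_ideal M) f M d"
proof -
  have "\<exists>j. is_form j g" if "g \<in> f ` {..<M}" for g
  proof -
    obtain l where l: "l < M" "g = f l" using \<open>g \<in> f ` {..<M}\<close> by blast
    then have "is_form d g" using f_homog[of l] assms by (simp add: is_form_iff_homog)
    then show ?thesis by blast
  qed
  then have "graded_ideal (partial_ideal M)" by (rule graded_ideal_ideal_gen)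
  then show ?thesis
    unfolding generated_ideal_def generated_ideal_axioms_def using f_homog assms d_pos by auto
qed

lemma partial_Suc:
  assumes "M < N"
  shows "partial_ideal (Suc M) \<inter> homog (int d + q) =
     {y + x * f M | y x. y \<in> partial_ideal M \<inter> homog (int d + q) \<and> x \<in> homog q}"
proof -
  interpret M: generated_ideal "partial_ideal M" f M d by (rule partial_generated) (use assms in simp)
  interpret S: generated_ideal "partial_ideal (Suc M)" f "Suc M" d by (rule partial_generated) (use assms in simp)
  have mono: "partial_ideal M \<subseteq> partial_ideal (Suc M)"
    by (rule module.span_mono[OF module_mult]) auto
  have fM: "f M \<in> homog (int d)" by (rule f_homog[OF assms])
  show ?thesis
  proof (intro equalityI subsetI)
    fix p assume p: "p \<in> partial_ideal (Suc M) \<inter> homog (int d + q)"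
    then obtain g where g: "\<And>l. g l \<in> homog (int d + q - int d)" "p = (\<Sum>l<Suc M. g l * f l)"
      using S.I_repr[of p "int d + q"] by blast
    have "(\<Sum>l<M. g l * f l) \<in> partial_ideal M"
      by (intro M.sum_mem M.mult_mem M.f_mem) auto
    moreover have "(\<Sum>l<M. g l * f l) \<in> homog (int d + q)"
      by (intro homog_sum homog_mult'[OF g(1) f_homog]) (use assms in auto)
    moreover have "g M \<in> homog q" using g(1)[of M] by simp
    moreover have "p = (\<Sum>l<M. g l * f l) + g M * f M" using g(2) by simp
    ultimately show "p \<in> {y + x * f M | y x. y \<in> partial_ideal M \<inter> homog (int d + q) \<and> x \<in> homog q}"
      by blast
  next
    fix p assume "p \<in> {y + x * f M | y x. y \<in> partial_ideal M \<inter> homog (int d + q) \<and> x \<in> homog q}"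
    then obtain y x where yx: "p = y + x * f M" "y \<in> partial_ideal M" "y \<in> homog (int d + q)" "x \<in> homog q"
      by blast
    have "p \<in> partial_ideal (Suc M)"
      unfolding yx(1) using mono yx(2) by (intro S.add_mem S.mult_mem S.f_mem) auto
    moreover have "p \<in> homog (int d + q)"
      unfolding yx(1) by (intro homog_add yx(3) homog_mult'[OF yx(4) fM]) simp
    ultimately show "p \<in> partial_ideal (Suc M) \<inter> homog (int d + q)" by blast
  qed
qed

text \<open>The larger ideal is the sum of the smaller one and the multiples of \<open>f M\<close>.
  By regularity, multiplication by \<open>f M\<close> pulls the smaller ideal back to itself, and
  counting dimensions gives the recursion. The second claim makes the truncated subtraction
  exact.\<close>

lemma hilbert_partial_Suc:
  assumes M: "M < N" and reg: "\<And>s g. g \<in> homog s \<Longrightarrow> g * f M \<in> partial_ideal M \<Longrightarrow> g \<in> partial_ideal M"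
  shows "hilbert_fun (partial_ideal (Suc M)) j =
    (if j < d then hilbert_fun (partial_ideal M) j
     else hilbert_fun (partial_ideal M) j - hilbert_fun (partial_ideal M) (j - d))"
    and "d \<le> j \<Longrightarrow> hilbert_fun (partial_ideal M) (j - d) \<le> hilbert_fun (partial_ideal M) j"
proof -
  interpret M: generated_ideal "partial_ideal M" f M d by (rule partial_generated) (use assms in simp)
  interpret S: generated_ideal "partial_ideal (Suc M)" f "Suc M" d by (rule partial_generated) (use assms in simp)
  have low: "hilbert_fun (partial_ideal (Suc M)) j = hilbert_fun (partial_ideal M) j" if "j < d"
  proof -
    have "partial_ideal (Suc M) \<inter> homog (int j) = partial_ideal M \<inter> homog (int j)"
      using M.I_low[of _ "int j"] S.I_low[of _ "int j"] that M.zero_mem S.zero_mem by auto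
    then show ?thesis unfolding M.hilbert_fun_eq S.hilbert_fun_eq by simp
  qed
  have high: "hilbert_fun (partial_ideal (Suc M)) j + hilbert_fun (partial_ideal M) (j - d) = hilbert_fun (partial_ideal M) j"
    if "d \<le> j"
  proof -
    define q where "q = int (j - d)"
    have j: "int j = int d + q" using that by (simp add: q_def of_nat_diff)
    let ?Z = "{y + x * f M | y x. y \<in> partial_ideal M \<inter> homog (int j) \<and> x \<in> homog q}"
    have Z: "partial_ideal (Suc M) \<inter> homog (int j) = ?Z" unfolding j by (rule partial_Suc[OF M])
    have "x * f M \<in> homog (int j)" if "x \<in> homog q" for x
      by (rule homog_mult'[OF that f_homog[OF M]]) (simp add: j)
    then have K: "{x \<in> homog q. x * f M \<in> partial_ideal M \<inter> homog (int j)} = partial_ideal M \<inter> homog q"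
      using reg M.mult_mem_right by blast
    have Yspan: "partial_ideal M \<inter> homog (int j) \<subseteq> poly_vs.span (mono_polys j)"
      using homog_span by blast
    have Xspan: "homog q \<subseteq> poly_vs.span (mono_polys (j - d))" unfolding q_def by (rule homog_span)
    have "poly_vs.dim ?Z + poly_vs.dim {x \<in> homog q. x * f M \<in> partial_ideal M \<inter> homog (int j)}
       = poly_vs.dim (partial_ideal M \<inter> homog (int j)) + poly_vs.dim (homog q :: ('x, 'k) mpoly set)"
      by (rule poly_vs.dim_add_image[where \<phi> = "\<lambda>x. x * f M",
            OF _ _ subspace_homog Xspan finite_mono_polys M.subspace_I Yspan finite_mono_polys])
         (simp_all add: distrib_right scale_poly_def mult.assoc)
    note dims = this[unfolded K Z[symmetric], unfolded q_def dim_homog]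
    show ?thesis
      using dims M.dim_I_le[of j] M.dim_I_le[of "j - d"] S.dim_I_le[of j]
      unfolding M.hilbert_fun_eq S.hilbert_fun_eq by linarith
  qed
  show "hilbert_fun (partial_ideal (Suc M)) j =
    (if j < d then hilbert_fun (partial_ideal M) j
     else hilbert_fun (partial_ideal M) j - hilbert_fun (partial_ideal M) (j - d))"
    using low high by auto
  show "d \<le> j \<Longrightarrow> hilbert_fun (partial_ideal M) (j - d) \<le> hilbert_fun (partial_ideal M) j"
    using high by linarith
qed

text \<open>The recursion starts at the zero ideal, whose series is \<open>1/(1 - z)^n\<close>, and
  runs through all \<open>N\<close> forms; for \<open>N > n\<close> the resulting identity of series
  is impossible.\<close>

lemma regular_imp_le:
  assumes reg: "\<And>M s g. M < N \<Longrightarrow> g \<in> homog s \<Longrightarrow> g * f M \<in> partial_ideal M \<Longrightarrow> g \<in> partial_ideal M"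
  shows "N \<le> card (UNIV :: 'x set)"
proof (rule ccontr)
  let ?n = "card (UNIV :: 'x set)"
  assume "\<not> N \<le> ?n"
  then have N: "N > ?n" by simp
  have "hilbert_series (partial_ideal M) * (1 - fps_X) ^ ?n = (1 - fps_X ^ d) ^ M" if "M \<le> N" for M
    using that
  proof (induction M)
    case 0
    interpret Z: generated_ideal "partial_ideal 0" f 0 d by (rule partial_generated) simp
    have "partial_ideal 0 \<inter> homog (int j) = {0}" for j
      by (auto simp: module.span_empty[OF module_mult])
    then have "hilbert_fun (partial_ideal 0) j = card (monomials TYPE('x) j)" for j
      using poly_vs.dim_le_card[of "{0 :: ('x, 'k) mpoly}" "{}"] unfolding Z.hilbert_fun_eq by simp
    then have "hilbert_series (partial_ideal 0) = binom_series ?n"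
      by (intro fps_ext) (simp add: hilbert_series_def binom_series_def card_monomials)
    then show ?case using binom_series_mult by simp
  next
    case (Suc M)
    then have M: "M < N" by simp
    have "hilbert_series (partial_ideal (Suc M)) = (1 - fps_X ^ d) * hilbert_series (partial_ideal M)"
    proof (rule fps_ext)
      fix j
      have "((1 - fps_X ^ d) * hilbert_series (partial_ideal M)) $ j =
        hilbert_series (partial_ideal M) $ j - (fps_X ^ d * hilbert_series (partial_ideal M)) $ j"
        by (simp add: left_diff_distrib)
      also have "\<dots> = hilbert_series (partial_ideal (Suc M)) $ j"
        using hilbert_partial_Suc[OF M reg[OF M], where j = j]
        by (auto simp: fps_X_power_mult_nth hilbert_series_def of_nat_diff)
      finally show "hilbert_series (partial_ideal (Suc M)) $ j = ((1 - fps_X ^ d) * hilbert_series (partial_ideal M)) $ j" ..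
    qed
    then show ?case using Suc by (simp add: mult.assoc)
  qed
  then have eq: "hilbert_series I * (1 - fps_X) ^ ?n = (1 - fps_X ^ d) ^ N" using I_eq by simp
  have "hilbert_fun I 0 = 1"
  proof -
    have "I \<inter> homog (int 0) \<subseteq> poly_vs.span {}"
      using I_low[of _ 0] d_pos by auto
    then have "poly_vs.dim (I \<inter> homog (int 0)) \<le> card ({} :: ('x, 'k) mpoly set)"
      by (rule poly_vs.dim_le_card) simp
    then show ?thesis unfolding hilbert_fun_eq by (simp add: card_monomials)
  qed
  then show False
    using polynomial_series_contradiction[of "\<lambda>j. of_nat (hilbert_fun I j)" ?n N d] N eq
    by (simp add: hilbert_series_def)
qed

end

subsection \<open>Existence of graded free resolutions\<close>

lemma vector_space_smul: "vector_space (\<lambda>c. smul (Poly_Mapping.single 0 c) :: ('e \<Rightarrow> ('x::finite, 'k::field) mpoly) \<Rightarrow> _)"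
  by unfold_locales (auto simp: smul_add_right smul_add_left single_add mult_single fun_eq_iff)

lemma free_vecs_add: "v \<in> free_vecs B \<Longrightarrow> w \<in> free_vecs B \<Longrightarrow> v + w \<in> free_vecs B"
  for v w :: "nat \<Rightarrow> 'a::comm_ring_1"
proof -
  assume vw: "v \<in> free_vecs B" "w \<in> free_vecs B"
  have "{b. (v + w) b \<noteq> 0} \<subseteq> {b. v b \<noteq> 0} \<union> {b. w b \<noteq> 0}" by auto
  then show ?thesis using vw finite_subset[of "{b. (v + w) b \<noteq> 0}"] unfolding free_vecs_def by blast
qed

lemma free_vecs_smul: "v \<in> free_vecs B \<Longrightarrow> smul r v \<in> free_vecs B"
proof -
  assume v: "v \<in> free_vecs B"
  have "{b. smul r v b \<noteq> 0} \<subseteq> {b. v b \<noteq> 0}" by auto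
  then show ?thesis using v finite_subset[of "{b. smul r v b \<noteq> 0}"] unfolding free_vecs_def by blast
qed

lemma free_vecs_zero: "0 \<in> free_vecs B"
  by (simp add: free_vecs_def)

lemma lin_ext_add:
  assumes "v \<in> free_vecs B" "w \<in> free_vecs B"
  shows "lin_ext M (v + w) = lin_ext M v + lin_ext M w"
proof
  fix c
  define T where "T = {b. v b \<noteq> 0} \<union> {b. w b \<noteq> 0}"
  have T: "finite T" "{b. v b \<noteq> 0} \<subseteq> T" "{b. w b \<noteq> 0} \<subseteq> T" "{b. (v + w) b \<noteq> 0} \<subseteq> T"
    using assms by (auto simp: T_def free_vecs_def)
  show "lin_ext M (v + w) c = (lin_ext M v + lin_ext M w) c"
    by (simp add: lin_ext_eq[OF T(1) T(2)] lin_ext_eq[OF T(1) T(3)] lin_ext_eq[OF T(1) T(4)]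
        distrib_right sum.distrib)
qed

lemma lin_ext_smul:
  assumes "v \<in> free_vecs B"
  shows "lin_ext M (smul r v) = smul r (lin_ext M v)"
proof
  fix c
  have "finite {b. v b \<noteq> 0}" "{b. smul r v b \<noteq> 0} \<subseteq> {b. v b \<noteq> 0}" using assms by (auto simp: free_vecs_def)
  from lin_ext_eq[OF this] show "lin_ext M (smul r v) c = smul r (lin_ext M v) c"
    by (simp add: lin_ext_def sum_distrib_left mult.assoc)
qed

definition vec_comp :: "(nat \<Rightarrow> nat) \<Rightarrow> nat \<Rightarrow> (nat \<Rightarrow> ('x::finite, 'k::field) mpoly) \<Rightarrow> nat \<Rightarrow> ('x, 'k) mpoly" where
  "vec_comp dg j v = (\<lambda>b. hcomp (int j - int (dg b)) (v b))"

lemma vec_comp_free_vecs: "v \<in> free_vecs B \<Longrightarrow> vec_comp dg j v \<in> free_vecs B"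
proof -
  assume v: "v \<in> free_vecs B"
  have "{b. vec_comp dg j v b \<noteq> 0} \<subseteq> {b. v b \<noteq> 0}" by (auto simp: vec_comp_def)
  then show ?thesis using v finite_subset[of "{b. vec_comp dg j v b \<noteq> 0}"] unfolding free_vecs_def by blast
qed

lemma sum_vec_comp:
  assumes "v \<in> free_vecs B"
  obtains J where "finite J" "(\<Sum>j\<in>J. vec_comp dg j v) = v"
proof -
  define J where "J = (\<Union>b\<in>{b. v b \<noteq> 0}. (\<lambda>t. dg b + mono_deg t) ` Poly_Mapping.keys (v b))"
  have "finite J" using assms by (auto simp: J_def free_vecs_def)
  moreover have "(\<Sum>j\<in>J. vec_comp dg j v) = v"
  proof
    fix b
    have inj: "inj_on (\<lambda>j. int j - int (dg b)) J" by (auto simp: inj_on_def)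
    have "(\<Sum>j\<in>J. vec_comp dg j v) b = (\<Sum>s\<in>(\<lambda>j. int j - int (dg b)) ` J. hcomp s (v b))"
      unfolding sum.reindex[OF inj] by (simp add: sum_fun_apply vec_comp_def)
    also have "\<dots> = v b"
    proof (rule sum_hcomp)
      fix t assume "t \<in> Poly_Mapping.keys (v b)"
      then have "v b \<noteq> 0" by auto
      then have "dg b + mono_deg t \<in> J" using \<open>t \<in> Poly_Mapping.keys (v b)\<close> by (auto simp: J_def)
      then show "int (mono_deg t) \<in> (\<lambda>j. int j - int (dg b)) ` J" by (intro image_eqI[of _ _ "dg b + mono_deg t"]) auto
    qed (use \<open>finite J\<close> in simp)
    finally show "(\<Sum>j\<in>J. vec_comp dg j v) b = v b" .
  qed
  ultimately show thesis by (rule that)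
qed

text \<open>In degree \<open>j\<close> only the basis elements of degree at most \<open>j\<close>
  can carry a coefficient, and each of them only finitely many monomials.\<close>

lemma homog_vecs_span:
  fixes B :: "nat set" and dg :: "nat \<Rightarrow> nat"
  assumes "\<And>j. finite {b \<in> B. dg b = j}"
  shows "\<exists>W. finite W \<and> {v \<in> free_vecs B. \<forall>b. v b \<in> homog (int j - int (dg b))} \<subseteq>
     module.span (\<lambda>c. smul (Poly_Mapping.single 0 c)) (W :: (nat \<Rightarrow> ('x::finite, 'k::field) mpoly) set)"
proof -
  interpret vs: vector_space "\<lambda>c. smul (Poly_Mapping.single 0 c) :: (nat \<Rightarrow> ('x, 'k) mpoly) \<Rightarrow> _"
    by (rule vector_space_smul)
  define u where "u = (\<lambda>(b :: nat, t). \<lambda>c. if c = b then Poly_Mapping.single t 1 else (0 :: ('x, 'k) mpoly))"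
  define P where "P = (SIGMA b:{b \<in> B. dg b \<le> j}. monomials TYPE('x) (j - dg b))"
  have "{b \<in> B. dg b \<le> j} = (\<Union>i\<le>j. {b \<in> B. dg b = i})" by auto
  then have "finite {b \<in> B. dg b \<le> j}" using assms by simp
  then have "finite P" by (auto simp: P_def card_monomials)
  moreover have "v \<in> vs.span (u ` P)"
    if v: "v \<in> free_vecs B" "\<And>b. v b \<in> homog (int j - int (dg b))" for v
  proof -
    let ?S = "{b. v b \<noteq> 0}"
    have S: "finite ?S" "?S \<subseteq> B" using v(1) by (auto simp: free_vecs_def)
    have "v = (\<Sum>b\<in>?S. \<Sum>t\<in>Poly_Mapping.keys (v b). smul (Poly_Mapping.single 0 (Poly_Mapping.lookup (v b) t)) (u (b, t)))"
    proof
      fix c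
      have "(\<Sum>b\<in>?S. \<Sum>t\<in>Poly_Mapping.keys (v b). smul (Poly_Mapping.single 0 (Poly_Mapping.lookup (v b) t)) (u (b, t))) c
        = (\<Sum>b\<in>?S. if b = c then v c else 0)"
        unfolding sum_fun_apply
        by (intro sum.cong refl) (auto simp: u_def mult_single sum_monomials)
      then show "v c = (\<Sum>b\<in>?S. \<Sum>t\<in>Poly_Mapping.keys (v b). smul (Poly_Mapping.single 0 (Poly_Mapping.lookup (v b) t)) (u (b, t))) c"
        using S(1) by simp
    qed
    also have "\<dots> \<in> vs.span (u ` P)"
    proof (intro vs.span_sum vs.span_scale vs.span_base imageI)
      fix b t assume b: "b \<in> ?S" and t: "t \<in> Poly_Mapping.keys (v b)"
      have "int (mono_deg t) = int j - int (dg b)" using v(2)[of b] t by (auto simp: homog_def)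
      then have "dg b \<le> j" "mono_deg t = j - dg b" by auto
      then show "(b, t) \<in> P" using b S(2) by (auto simp: P_def monomials_def)
    qed
    finally show ?thesis .
  qed
  ultimately show ?thesis by (intro exI[of _ "u ` P"]) auto
qed

context graded_ideal
begin

text \<open>What is passed from one step of the resolution to the next. Finitely many basis elements
  in each degree keep each degree of \<open>K\<close> finite-dimensional, so that the next basis is
  of the same kind.\<close>

definition graded_kernel :: "nat set \<Rightarrow> (nat \<Rightarrow> nat) \<Rightarrow> (nat \<Rightarrow> ('x, 'k) mpoly) set \<Rightarrow> bool" where
  "graded_kernel B dg K \<longleftrightarrow> (\<forall>j. finite {b \<in> B. dg b = j}) \<and> K \<subseteq> free_vecs B \<and>
     (\<forall>v\<in>K. \<forall>w\<in>K. v + w \<in> K) \<and> (\<forall>r. \<forall>v\<in>K. smul r v \<in> K) \<and>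
     (\<forall>v\<in>free_vecs B. (\<forall>b. v b \<in> I) \<longrightarrow> v \<in> K) \<and> (\<forall>j. \<forall>v\<in>K. vec_comp dg j v \<in> K)"

definition next_module :: "nat set \<Rightarrow> (nat \<Rightarrow> nat) \<Rightarrow> (nat \<Rightarrow> ('x, 'k) mpoly) set \<Rightarrow>
    nat set \<Rightarrow> (nat \<Rightarrow> nat) \<Rightarrow> (nat \<Rightarrow> nat \<Rightarrow> ('x, 'k) mpoly) \<Rightarrow> bool" where
  "next_module B dg K B' dg' M \<longleftrightarrow> (\<forall>b\<in>B'. M b \<in> free_vecs B) \<and>
     (\<forall>b\<in>B'. \<forall>c. M b c \<in> homog (int (dg' b) - int (dg c))) \<and>
     (\<forall>v\<in>free_vecs B. v \<in> K \<longleftrightarrow> (\<exists>w\<in>free_vecs B'. vec_cong I v (lin_ext M w)))"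

definition kernel_of :: "nat set \<Rightarrow> (nat \<Rightarrow> nat \<Rightarrow> ('x, 'k) mpoly) \<Rightarrow> (nat \<Rightarrow> ('x, 'k) mpoly) set" where
  "kernel_of B M = {w \<in> free_vecs B. vec_cong I (lin_ext M w) (\<lambda>_. 0)}"

lemma graded_kernel_kernel_of:
  assumes fin: "\<And>j. finite {b \<in> B'. dg' b = j}"
    and M: "\<And>b c. b \<in> B' \<Longrightarrow> M b c \<in> homog (int (dg' b) - int (dg c))"
  shows "graded_kernel B' dg' (kernel_of B' M)"
  unfolding graded_kernel_def
proof (intro conjI allI ballI impI)
  show "finite {b \<in> B'. dg' b = j}" for j by (rule fin)
  show "kernel_of B' M \<subseteq> free_vecs B'" by (auto simp: kernel_of_def)
  show "v + w \<in> kernel_of B' M" if "v \<in> kernel_of B' M" "w \<in> kernel_of B' M" for v w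
    using that by (simp add: kernel_of_def vec_cong_def lin_ext_add[of v B' w] free_vecs_add add_mem)
  show "smul r v \<in> kernel_of B' M" if "v \<in> kernel_of B' M" for r v
    using that by (simp add: kernel_of_def vec_cong_def lin_ext_smul[of v B'] free_vecs_smul mult_mem)
  show "v \<in> kernel_of B' M" if "v \<in> free_vecs B'" "\<forall>b. v b \<in> I" for v
    using that by (auto simp: kernel_of_def vec_cong_def lin_ext_def intro!: sum_mem mult_mem_right)
  show "vec_comp dg' j v \<in> kernel_of B' M" if v: "v \<in> kernel_of B' M" for j v
  proof -
    have vB: "v \<in> free_vecs B'" "\<And>c. lin_ext M v c \<in> I" using v by (auto simp: kernel_of_def vec_cong_def)
    have S: "finite {b. v b \<noteq> 0}" "{b. v b \<noteq> 0} \<subseteq> B'" using vB(1) by (auto simp: free_vecs_def)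
    have "lin_ext M (vec_comp dg' j v) c = hcomp (int j - int (dg c)) (lin_ext M v c)" for c
    proof -
      have "lin_ext M (vec_comp dg' j v) c = (\<Sum>b | v b \<noteq> 0. vec_comp dg' j v b * M b c)"
        using S(1) by (intro lin_ext_eq) (auto simp: vec_comp_def)
      also have "\<dots> = (\<Sum>b | v b \<noteq> 0. hcomp (int j - int (dg c)) (v b * M b c))"
      proof (rule sum.cong[OF refl])
        fix b assume "b \<in> {b. v b \<noteq> 0}"
        then have "b \<in> B'" using S(2) by blast
        then show "vec_comp dg' j v b * M b c = hcomp (int j - int (dg c)) (v b * M b c)"
          by (simp add: hcomp_mult_right[OF M] vec_comp_def)
      qed
      finally show ?thesis by (simp add: lin_ext_def hcomp_sum)
    qed
    then have "lin_ext M (vec_comp dg' j v) c \<in> I" for c using hcomp_mem[OF vB(2)] by metis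
    then show ?thesis using vec_comp_free_vecs[OF vB(1)] by (simp add: kernel_of_def vec_cong_def)
  qed
qed

text \<open>The next basis collects, degree by degree, a vector space basis of that degree of the
  kernel. It generates by construction, at the price of being far from minimal.\<close>

lemma next_module_exists:
  assumes "graded_kernel B dg K"
  shows "\<exists>B' dg' M. (\<forall>j. finite {b \<in> B'. dg' b = j}) \<and> next_module B dg K B' dg' M"
proof -
  have fin: "\<And>j. finite {b \<in> B. dg b = j}" and KB: "K \<subseteq> free_vecs B"
    and Kadd: "\<And>v w. v \<in> K \<Longrightarrow> w \<in> K \<Longrightarrow> v + w \<in> K"
    and Kmul: "\<And>r v. v \<in> K \<Longrightarrow> smul r v \<in> K"
    and KI: "\<And>v. v \<in> free_vecs B \<Longrightarrow> (\<And>b. v b \<in> I) \<Longrightarrow> v \<in> K"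
    and Kcomp: "\<And>j v. v \<in> K \<Longrightarrow> vec_comp dg j v \<in> K"
    using assms unfolding graded_kernel_def by blast+
  interpret vs: vector_space "\<lambda>c. smul (Poly_Mapping.single 0 c) :: (nat \<Rightarrow> ('x, 'k) mpoly) \<Rightarrow> _"
    by (rule vector_space_smul)
  define Kj where "Kj = (\<lambda>j. {v \<in> K. \<forall>b. v b \<in> homog (int j - int (dg b))})"
  have "\<exists>es. \<forall>j. set (es j) \<subseteq> Kj j \<and> Kj j \<subseteq> vs.span (set (es j))"
  proof (rule choice, rule allI)
    fix j
    obtain W where W: "finite W" "{v \<in> free_vecs B. \<forall>b. v b \<in> homog (int j - int (dg b))} \<subseteq> vs.span W"
      using homog_vecs_span[OF fin, where j = j] by blast
    have sub: "Kj j \<subseteq> vs.span W" using W(2) KB by (auto simp: Kj_def)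
    obtain E where E: "E \<subseteq> Kj j" "Kj j \<subseteq> vs.span E" "finite E"
      by (rule vs.finite_basis_exists[OF sub W(1)])
    obtain l where "set l = E" using finite_list[OF E(3)] by blast
    then show "\<exists>l. set l \<subseteq> Kj j \<and> Kj j \<subseteq> vs.span (set l)" using E by blast
  qed
  then obtain es where es: "\<And>j. set (es j) \<subseteq> Kj j" "\<And>j. Kj j \<subseteq> vs.span (set (es j))" by blast
  \<comment> \<open>A degree and a position in the list of that degree are coded as one number,
    since basis elements are natural numbers.\<close>
  define B' where "B' = {prod_encode (j, m) | j m. m < length (es j)}"
  define dg' where "dg' = (\<lambda>b. fst (prod_decode b))"
  define M where "M = (\<lambda>b. es (fst (prod_decode b)) ! snd (prod_decode b))"
  have MK: "M b \<in> Kj (dg' b)" if "b \<in> B'" for b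
  proof -
    obtain j m where "b = prod_encode (j, m)" "m < length (es j)" using \<open>b \<in> B'\<close> by (auto simp: B'_def)
    then have "M b \<in> set (es j)" "dg' b = j" by (auto simp: M_def dg'_def)
    then show ?thesis using es(1) by blast
  qed
  have "finite {b \<in> B'. dg' b = j}" for j
  proof (rule finite_subset)
    show "{b \<in> B'. dg' b = j} \<subseteq> (\<lambda>m. prod_encode (j, m)) ` {..<length (es j)}"
      by (auto simp: B'_def dg'_def)
  qed simp
  moreover have "M b \<in> free_vecs B" if "b \<in> B'" for b using MK[OF that] KB by (auto simp: Kj_def)
  moreover have "M b c \<in> homog (int (dg' b) - int (dg c))" if "b \<in> B'" for b c
    using MK[OF that] by (simp add: Kj_def)
  moreover have "v \<in> K \<longleftrightarrow> (\<exists>w\<in>free_vecs B'. vec_cong I v (lin_ext M w))" if v: "v \<in> free_vecs B" for v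
  proof
    assume "v \<in> K"
    define L where "L = {v. \<exists>w\<in>free_vecs B'. v = lin_ext M w}"
    have L0: "0 \<in> L"
    proof -
      have "lin_ext M (0 :: nat \<Rightarrow> ('x, 'k) mpoly) = 0" by (rule ext) (simp add: lin_ext_def)
      then show ?thesis unfolding L_def using free_vecs_zero by (metis (mono_tags, lifting) mem_Collect_eq)
    qed
    have Ladd: "a + b \<in> L" if ab: "a \<in> L" "b \<in> L" for a b
    proof -
      obtain w w' where "w \<in> free_vecs B'" "w' \<in> free_vecs B'" "a = lin_ext M w" "b = lin_ext M w'"
        using ab by (auto simp: L_def)
      then show ?thesis unfolding L_def mem_Collect_eq
        by (intro bexI[of _ "w + w'"]) (simp_all only: lin_ext_add free_vecs_add)
    qed
    have Lscale: "smul r a \<in> L" if "a \<in> L" for r a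
    proof -
      obtain w where "w \<in> free_vecs B'" "a = lin_ext M w" using \<open>a \<in> L\<close> by (auto simp: L_def)
      then show ?thesis unfolding L_def mem_Collect_eq
        by (intro bexI[of _ "smul r w"]) (simp_all only: lin_ext_smul free_vecs_smul)
    qed
    have "vs.subspace L" using L0 Ladd Lscale by (simp only: vs.subspace_def) blast
    moreover have "set (es j) \<subseteq> L" for j
    proof
      fix e assume "e \<in> set (es j)"
      then obtain m where m: "m < length (es j)" "e = es j ! m" by (auto simp: in_set_conv_nth)
      then have "prod_encode (j, m) \<in> B'" "M (prod_encode (j, m)) = e" by (auto simp: B'_def M_def)
      then show "e \<in> L" unfolding L_def mem_Collect_eq
        by (intro bexI[OF _ unit_free_vecs]) (simp_all only: lin_ext_unit)
    qed
    ultimately have spanL: "vs.span (set (es j)) \<subseteq> L" for j using vs.span_minimal by blast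
    have comp: "vec_comp dg j v \<in> L" for j
    proof -
      have "vec_comp dg j v \<in> Kj j"
        using Kcomp[OF \<open>v \<in> K\<close>] hcomp_homog by (auto simp: Kj_def vec_comp_def)
      then show ?thesis using es(2) spanL by blast
    qed
    obtain J where J: "finite J" "(\<Sum>j\<in>J. vec_comp dg j v) = v" using sum_vec_comp[OF v] .
    have "(\<Sum>j\<in>J. vec_comp dg j v) \<in> L"
      using J(1)
    proof (induction J rule: finite_induct)
      case empty
      then show ?case using L0 by (simp only: sum.empty)
    next
      case (insert j J)
      then show ?case unfolding sum.insert[OF insert.hyps] by (intro Ladd comp)
    qed
    then obtain w where w: "w \<in> free_vecs B'" "v = lin_ext M w" unfolding J(2) by (auto simp: L_def)
    have "vec_cong I v (lin_ext M w)" using w(2) zero_mem by (simp add: vec_cong_def)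
    then show "\<exists>w\<in>free_vecs B'. vec_cong I v (lin_ext M w)" using w(1) by blast
  next
    assume "\<exists>w\<in>free_vecs B'. vec_cong I v (lin_ext M w)"
    then obtain w where w: "w \<in> free_vecs B'" "vec_cong I v (lin_ext M w)" by blast
    have K0: "0 \<in> K" by (rule KI[OF free_vecs_zero]) (simp add: zero_mem)
    have S: "finite {b. w b \<noteq> 0}" "{b. w b \<noteq> 0} \<subseteq> B'" using w(1) by (auto simp: free_vecs_def)
    have sumK: "(\<Sum>b\<in>T. smul (w b) (M b)) \<in> K" if "finite T" "T \<subseteq> B'" for T
      using that
    proof (induction T rule: finite_induct)
      case empty
      then show ?case using K0 by (simp only: sum.empty)
    next
      case (insert b T)
      have "M b \<in> K" using MK insert.prems by (auto simp: Kj_def)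
      moreover have "(\<Sum>b\<in>T. smul (w b) (M b)) \<in> K"
        using insert.prems by (intro insert.IH) blast
      ultimately show ?case unfolding sum.insert[OF insert.hyps] by (intro Kadd Kmul)
    qed
    have "lin_ext M w = (\<Sum>b | w b \<noteq> 0. smul (w b) (M b))"
      by (rule ext) (simp add: lin_ext_def sum_fun_apply)
    then have L: "lin_ext M w \<in> K" using sumK[OF S] by simp
    have "v - lin_ext M w \<in> free_vecs B"
      using free_vecs_add[OF v free_vecs_smul[of "lin_ext M w" B "- 1"]] L KB by auto
    then have "v - lin_ext M w \<in> K" using w(2) by (intro KI) (auto simp: vec_cong_def)
    from Kadd[OF this L] show "v \<in> K" by simp
  qed
  ultimately have "next_module B dg K B' dg' M" unfolding next_module_def by blast
  then show ?thesis using \<open>\<And>j. finite {b \<in> B'. dg' b = j}\<close> by blast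
qed

text \<open>Begins with \<open>F_0 = R\<close>, where the augmentation has the elements without
  constant term as its kernel, and covers each kernel by the next free module.\<close>

lemma resolution_exists:
  assumes I: "\<And>p. p \<in> I \<Longrightarrow> const_coeff p = 0"
  shows "\<exists>F. graded_free_res_of_k I F"
proof -
  define K0 where "K0 = {v \<in> free_vecs {0 :: nat}. const_coeff (v 0 :: ('x, 'k) mpoly) = 0}"
  have K0: "graded_kernel {0} (\<lambda>_. 0) K0"
    unfolding graded_kernel_def
  proof (intro conjI allI ballI impI)
    show "vec_comp (\<lambda>_. 0) j v \<in> K0" if "v \<in> K0" for j v
    proof -
      have "const_coeff (vec_comp (\<lambda>_. 0) j v 0) = 0"
        using that by (simp add: K0_def vec_comp_def const_coeff_def lookup_hcomp)
      then show ?thesis using that vec_comp_free_vecs by (auto simp: K0_def)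
    qed
  qed (auto simp: K0_def free_vecs_add free_vecs_smul I)
  \<comment> \<open>A state consists of a basis, its degrees, a matrix and a kernel.
    \<open>P\<close> is the invariant of a state, including the prescribed start, and
    \<open>Q\<close> links consecutive states for dependent choice.\<close>
  define P where "P = (\<lambda>(n :: nat) (B, dg, M :: nat \<Rightarrow> nat \<Rightarrow> ('x, 'k) mpoly, K).
     graded_kernel B dg K \<and> (n = 0 \<longrightarrow> B = {0} \<and> dg = (\<lambda>_. 0) \<and> K = K0))"
  define Q where "Q = (\<lambda>(n :: nat) (B, dg, M :: nat \<Rightarrow> nat \<Rightarrow> ('x, 'k) mpoly, K) (B', dg', M', K').
     next_module B dg K B' dg' M' \<and> K' = kernel_of B' M')"
  have "\<exists>s. \<forall>n. P n (s n) \<and> Q n (s n) (s (Suc n))"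
  proof (rule dependent_nat_choice)
    show "\<exists>s. P 0 s" using K0 by (intro exI[of _ "({0}, \<lambda>_. 0, \<lambda>_ _. 0, K0)"]) (simp add: P_def)
    show "\<exists>s'. P (Suc n) s' \<and> Q n s s'" if s: "P n s" for s n
    proof -
      obtain B dg M K where sB: "s = (B, dg, M, K)" by (metis prod_cases4)
      then have "graded_kernel B dg K" using s by (simp add: P_def)
      then obtain B' dg' M' where n: "\<And>j. finite {b \<in> B'. dg' b = j}" "next_module B dg K B' dg' M'"
        using next_module_exists by blast
      then have "graded_kernel B' dg' (kernel_of B' M')"
        by (intro graded_kernel_kernel_of[where dg = dg]) (auto simp: next_module_def)
      then show ?thesis using n(2)
        by (intro exI[of _ "(B', dg', M', kernel_of B' M')"]) (simp add: P_def Q_def sB)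
    qed
  qed
  then obtain s where s: "\<And>n. P n (s n)" "\<And>n. Q n (s n) (s (Suc n))" by blast
  define B where "B = (\<lambda>n. fst (s n))"
  define dg where "dg = (\<lambda>n. fst (snd (s n)))"
  define M where "M = (\<lambda>n. fst (snd (snd (s n))))"
  define K where "K = (\<lambda>n. snd (snd (snd (s n))))"
  have sn: "s n = (B n, dg n, M n, K n)" for n by (simp add: B_def dg_def M_def K_def)
  have base: "B 0 = {0}" "dg 0 = (\<lambda>_. 0)" "K 0 = K0"
    using s(1)[of 0] unfolding sn P_def by auto
  have nxt: "next_module (B n) (dg n) (K n) (B (Suc n)) (dg (Suc n)) (M (Suc n))"
    and ker: "K (Suc n) = kernel_of (B (Suc n)) (M (Suc n))" for n
    using s(2)[of n] unfolding sn Q_def by auto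
  define F where "F = \<lparr>cbasis = B, cdeg = dg, cdiff = M, caug = (\<lambda>b :: nat. if b = 0 then (1 :: 'k) else 0)\<rparr>"
  have aug: "aug_map (caug F) v = const_coeff (v 0)" if "v \<in> free_vecs (cbasis F 0)" for v
  proof -
    have "{b. v b \<noteq> 0} \<subseteq> {0}" using that base by (auto simp: F_def free_vecs_def)
    then have "aug_map (caug F) v = (\<Sum>b\<in>{0}. const_coeff (v b) * caug F b)"
      unfolding aug_map_def by (intro sum.mono_neutral_left) auto
    then show ?thesis by (simp add: F_def)
  qed
  have "graded_free_res_of_k I F"
    unfolding graded_free_res_of_k_def
  proof (intro conjI allI ballI)
    show "cdiff F (Suc i) b \<in> free_vecs (cbasis F i)" if "b \<in> cbasis F (Suc i)" for i b
      using nxt[of i] that by (simp add: F_def next_module_def)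
    show "mono_deg t + cdeg F i c = cdeg F (Suc i) b"
      if "b \<in> cbasis F (Suc i)" "t \<in> Poly_Mapping.keys (cdiff F (Suc i) b c)" for i b c t
    proof -
      have "cdiff F (Suc i) b c \<in> homog (int (cdeg F (Suc i) b) - int (cdeg F i c))"
        using nxt[of i] that(1) by (simp add: F_def next_module_def)
      then have "int (mono_deg t) = int (cdeg F (Suc i) b) - int (cdeg F i c)"
        using that(2) by (simp add: homog_def)
      then show ?thesis by linarith
    qed
    show "caug F b \<noteq> 0 \<longrightarrow> cdeg F 0 b = 0" for b by (simp add: F_def base)
    show "\<exists>b\<in>cbasis F 0. caug F b \<noteq> 0" by (simp add: F_def base)
    show "(aug_map (caug F) v = 0) =
        (\<exists>w\<in>free_vecs (cbasis F (Suc 0)). vec_cong I v (lin_ext (cdiff F (Suc 0)) w))"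
      if "v \<in> free_vecs (cbasis F 0)" for v
    proof -
      have "aug_map (caug F) v = 0 \<longleftrightarrow> v \<in> K 0"
        using aug[OF that] that by (simp add: base K0_def F_def)
      also have "\<dots> \<longleftrightarrow> (\<exists>w\<in>free_vecs (B (Suc 0)). vec_cong I v (lin_ext (M (Suc 0)) w))"
        using nxt[of 0] that unfolding next_module_def F_def by simp
      finally show ?thesis by (simp add: F_def)
    qed
    show "vec_cong I (lin_ext (cdiff F (Suc i)) v) (\<lambda>_. 0) =
        (\<exists>w\<in>free_vecs (cbasis F (Suc (Suc i))). vec_cong I v (lin_ext (cdiff F (Suc (Suc i))) w))"
      if "v \<in> free_vecs (cbasis F (Suc i))" for i v
    proof -
      have "vec_cong I (lin_ext (cdiff F (Suc i)) v) (\<lambda>_. 0) \<longleftrightarrow> v \<in> K (Suc i)"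
        using that by (simp add: ker kernel_of_def F_def)
      also have "\<dots> \<longleftrightarrow> (\<exists>w\<in>free_vecs (B (Suc (Suc i))). vec_cong I v (lin_ext (M (Suc (Suc i))) w))"
        using nxt[of "Suc i"] that unfolding next_module_def F_def by simp
      finally show ?thesis by (simp add: F_def)
    qed
  qed
  then show ?thesis by blast
qed

end

subsection \<open>Rate and slant of ideals of semi-regular forms\<close>

abbreviation expected_series :: "nat \<Rightarrow> nat \<Rightarrow> nat \<Rightarrow> rat fps" where
  "expected_series d N n \<equiv> (1 - fps_X ^ d) ^ N / (1 - fps_X) ^ n"

context generated_ideal
begin

text \<open>As \<open>I\<close> is zero below \<open>d\<close>, its elements of degree
  \<open>d\<close> involve only the degree \<open>d\<close> members of a homogeneous generating set.
  These members therefore generate all \<open>f l\<close>, hence \<open>I\<close>, and minimality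
  leaves no others.\<close>

lemma max_gen_deg_eq:
  assumes "I \<noteq> {0}"
  shows "max_gen_deg I = d"
proof -
  have min_deg: "g \<in> homog (int d) \<and> g \<noteq> 0" if G: "min_hom_gens G I" "g \<in> G" for G g
  proof -
    have hom: "\<And>h. h \<in> G \<Longrightarrow> \<exists>j. h \<in> homog (int j)" and gen: "ideal_gen G = I"
      and min: "\<And>H. H \<subset> G \<Longrightarrow> ideal_gen H \<noteq> I"
      using G(1) by (auto simp: min_hom_gens_def is_form_iff_homog)
    have nz: "h \<noteq> 0" if "h \<in> G" for h
    proof
      assume "h = 0"
      have "a \<in> ideal_gen (G - {0})" if "a \<in> G" for a
        using that by (cases "a = 0") (simp_all add: ideal_gen_zero ideal_gen_base)
      then have "ideal_gen G \<subseteq> ideal_gen (G - {0})"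
        by (intro module.span_minimal[OF module_mult _ module.subspace_span[OF module_mult]] subsetI)
      moreover have "ideal_gen (G - {0}) \<subseteq> ideal_gen G"
        by (rule module.span_mono[OF module_mult]) blast
      ultimately have "ideal_gen (G - {0}) = I" using gen by simp
      moreover have "G - {0} \<subset> G" using that \<open>h = 0\<close> by blast
      ultimately show False using min by simp
    qed
    define H where "H = {h \<in> G. h \<in> homog (int d)}"
    interpret H: graded_ideal "ideal_gen H"
      by (rule graded_ideal_ideal_gen) (auto simp: H_def is_form_iff_homog)
    have fH: "f l \<in> ideal_gen H" if "l < N" for l
    proof -
      have span: "p \<in> ideal_gen G \<Longrightarrow> hcomp (int d) p \<in> ideal_gen H" for p
      proof (induction rule: ideal_gen_induct)
        case base
        then show ?case by (simp add: H.zero_mem)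
      next
        case (step c h y)
        obtain j where j: "h \<in> homog (int j)" using hom[OF step(1)] by blast
        have "h \<in> I" using step(1) gen ideal_gen_base by blast
        then have "int d \<le> int j" using I_low[OF _ j] nz[OF step(1)] by fastforce
        have "hcomp (int d) (c * h) = hcomp (int d - int j) c * h"
          by (rule hcomp_mult_right[OF j])
        moreover have "hcomp (int d - int j) c * h \<in> ideal_gen H"
        proof (cases "j = d")
          case True
          then have "h \<in> H" using step(1) j by (simp add: H_def)
          then show ?thesis by (intro ideal_gen_scale ideal_gen_base)
        next
          case False
          then have "hcomp (int d - int j) c = 0"
            using \<open>int d \<le> int j\<close> hcomp_homog[of "int d - int j" c] by (simp add: homog_neg)
          then show ?thesis by (simp add: H.zero_mem)
        qed
        ultimately show ?case using step.IH by (simp add: hcomp_add H.add_mem)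
      qed
      have "f l \<in> ideal_gen G" using f_mem[OF that] gen by simp
      from span[OF this] show ?thesis using hcomp_id[OF f_homog[OF that]] by simp
    qed
    have "I \<subseteq> ideal_gen H"
      unfolding I_eq by (rule module.span_minimal[OF module_mult])
        (use fH in \<open>auto intro: module.subspace_span[OF module_mult]\<close>)
    moreover have "ideal_gen H \<subseteq> I"
      unfolding gen[symmetric] by (rule module.span_mono[OF module_mult]) (auto simp: H_def)
    ultimately have "ideal_gen H = I" by blast
    then have "\<not> H \<subset> G" using min by blast
    then have "H = G" by (auto simp: H_def)
    then have "g \<in> homog (int d)" using G(2) by (auto simp: H_def)
    then show ?thesis using nz[OF G(2)] by blast
  qed
  \<comment> \<open>The maximum in \<open>max_gen_deg\<close> needs at least one minimal generating
    set; a smallest generating subset of the forms provides it.\<close>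
  have "\<exists>G. G \<subseteq> f ` {..<N} \<and> ideal_gen G = I \<and> (\<forall>H. H \<subset> G \<longrightarrow> ideal_gen H \<noteq> I)"
  proof -
    let ?S = "{G. G \<subseteq> f ` {..<N} \<and> ideal_gen G = I}"
    have "finite ?S" by (rule finite_subset[of _ "Pow (f ` {..<N})"]) auto
    moreover have "?S \<noteq> {}" using I_eq by auto
    ultimately have "\<exists>G\<in>?S. \<forall>H\<in>?S. H \<subseteq> G \<longrightarrow> G = H" by (rule finite_has_minimal)
    then obtain G where G: "G \<subseteq> f ` {..<N}" "ideal_gen G = I"
      and min: "\<forall>H\<in>?S. H \<subseteq> G \<longrightarrow> G = H"
    proof (elim bexE)
      fix G assume "G \<in> ?S" "\<forall>H\<in>?S. H \<subseteq> G \<longrightarrow> G = H"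
      then show thesis by (intro that[of G]) auto
    qed
    have "ideal_gen H \<noteq> I" if "H \<subset> G" for H
    proof
      assume "ideal_gen H = I"
      then have "H \<in> ?S" using that G(1) by auto
      from bspec[OF min this] have "H \<subseteq> G \<longrightarrow> G = H" .
      then show False using that by blast
    qed
    then show ?thesis using G by (intro exI[of _ G]) simp
  qed
  then obtain G where G: "G \<subseteq> f ` {..<N}" "ideal_gen G = I" "\<And>H. H \<subset> G \<Longrightarrow> ideal_gen H \<noteq> I" by blast
  have "finite G" using G(1) by (rule finite_subset) simp
  moreover have "\<exists>j. is_form j g" if "g \<in> G" for g
    using that G(1) f_homog by (auto simp: is_form_iff_homog)
  ultimately have "min_hom_gens G I" using G(2,3) by (simp add: min_hom_gens_def)
  moreover have "G \<noteq> {}" using G(2) assms by (auto simp: module.span_empty[OF module_mult])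
  ultimately obtain g where g: "min_hom_gens G I" "g \<in> G" by blast
  have "{j. \<exists>G g. min_hom_gens G I \<and> g \<in> G \<and> is_form j g} = {d}"
  proof (intro equalityI subsetI)
    fix j assume "j \<in> {j. \<exists>G g. min_hom_gens G I \<and> g \<in> G \<and> is_form j g}"
    then obtain G' g' where g': "min_hom_gens G' I" "g' \<in> G'" "g' \<in> homog (int j)"
      by (auto simp: is_form_iff_homog)
    then have "int j = int d" using min_deg[OF g'(1,2)] homog_disjoint by blast
    then show "j \<in> {d}" by simp
  next
    fix j assume "j \<in> {d}"
    then show "j \<in> {j. \<exists>G g. min_hom_gens G I \<and> g \<in> G \<and> is_form j g}"
      using g min_deg[OF g] by (auto simp: is_form_iff_homog)
  qed
  then show ?thesis by (simp add: max_gen_deg_def)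
qed

lemma tor_nonzero_iff:
  "tor_nonzero I i j \<longleftrightarrow> (\<exists>F. resolution I F \<and> \<not> resolution.tor_k_zero F i (int j))"
proof -
  have "graded_free_res_of_k I F \<longleftrightarrow> resolution I F" for F
    using graded_ideal_axioms by (auto simp: resolution_def resolution_axioms_def)
  then show ?thesis
    unfolding tor_nonzero_def using resolution.tor_zero_res_field by metis
qed

lemma resolution_obtain:
  obtains F where "generated_resolution I f N d F"
proof -
  obtain F where "graded_free_res_of_k I F" using resolution_exists[OF I_const] by blast
  then have "generated_resolution I f N d F"
    using graded_ideal_axioms generated_ideal_axioms
    by (simp add: generated_resolution_def resolution_def resolution_axioms_def)
  then show thesis by (rule that)
qed

lemma tor_nonzero_2:
  assumes "d \<ge> 2" "I \<noteq> {0}"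
  shows "tor_nonzero I 2 d"
proof -
  obtain F where "generated_resolution I f N d F" by (rule resolution_obtain)
  then interpret R: generated_resolution I f N d F .
  have "\<exists>l<N. f l \<noteq> 0"
  proof (rule ccontr)
    assume "\<not> (\<exists>l<N. f l \<noteq> 0)"
    then have "f ` {..<N} \<subseteq> {0}" by auto
    then have "I \<subseteq> {0}"
      unfolding I_eq by (rule module.span_minimal[OF module_mult _ module.subspace_single_0[OF module_mult]])
    then show False using assms(2) zero_mem by blast
  qed
  then obtain l where "l < N" "f l \<noteq> 0" by blast
  then have "\<not> R.tor_k_zero 2 (int d)"
    using R.tor_2_nonzero[OF assms(1) f_mem f_homog] by blast
  then show ?thesis using tor_nonzero_iff R.resolution_axioms by blast
qed

text \<open>Common core of (1) and (3): \<open>e\<close> is a degree from which on \<open>R\<close>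
  vanishes, and the line \<open>\<beta>\<close> is left open.\<close>

lemma tor_nonzero_bound:
  fixes \<beta> :: "nat \<Rightarrow> real"
  assumes e: "\<And>p q. p \<in> homog q \<Longrightarrow> q \<ge> int e \<Longrightarrow> p \<in> I"
    and h: "\<And>s. s \<ge> 1 \<Longrightarrow> h s = (if s = 1 then real d else real s + real e - 1)"
    and \<beta>: "\<And>i. real i \<le> \<beta> i" "\<And>i s. 1 \<le> s \<Longrightarrow> s < i \<Longrightarrow> h s + \<beta> (i - 1 - s) \<le> \<beta> i"
    and nz: "tor_nonzero I i j"
  shows "real j \<le> \<beta> i"
proof (rule ccontr)
  assume "\<not> real j \<le> \<beta> i"
  then have j: "real_of_int (int j) > \<beta> i" by simp
  obtain F where F: "resolution I F" "\<not> resolution.tor_k_zero F i (int j)"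
    using nz tor_nonzero_iff by blast
  interpret R: resolution I F by (rule F(1))
  have "R.tor_k_zero i (int j)"
  proof (rule R.tor_k_zero_bound[OF I_const _ \<beta> j])
    fix s :: nat and q assume s: "1 \<le> s" "\<not> koszul_cycles s q \<subseteq> koszul_bounds s q"
    show "real_of_int q \<le> h s"
    proof (cases "s = 1")
      case True
      then have "q \<le> int d" using s(2) koszul_cycles_1_bound by blast
      then show ?thesis using h[OF s(1)] True by simp
    next
      case False
      have "q < int s + int e" by (rule koszul_cycles_bound[OF e s(2)])
      then show ?thesis using h[OF s(1)] False by simp
    qed
  qed
  then show False using F(2) by blast
qed

lemma hilbert_fun_truncate:
  assumes "hilbert_series I = truncate_nonpos (expected_series d N (card (UNIV :: 'x set)))"
  shows "of_nat (hilbert_fun I e) =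
    (if \<forall>i\<le>e. fps_nth (expected_series d N (card (UNIV :: 'x set))) i > 0 then fps_nth (expected_series d N (card (UNIV :: 'x set))) e else 0)"
proof -
  have "of_nat (hilbert_fun I e) = fps_nth (hilbert_series I) e" by (simp add: hilbert_series_def)
  also have "\<dots> = (if \<forall>i\<le>e. fps_nth (expected_series d N (card (UNIV :: 'x set))) i > 0 then fps_nth (expected_series d N (card (UNIV :: 'x set))) e else 0)"
    unfolding assms by (simp add: truncate_nonpos_def)
  finally show ?thesis .
qed

lemma expected_series_card:
  assumes "d \<le> e" "e < 2 * d"
  shows "fps_nth (expected_series d N (card (UNIV :: 'x set))) e = of_nat (card (monomials TYPE('x) e)) - of_nat (N * card (monomials TYPE('x) (e - d)))"
  using expected_series_nth[OF d_pos assms] by (simp add: card_monomials)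

text \<open>The assumption \<open>le\<close> makes the expected coefficient in degree
  \<open>e\<close> non-positive, so the truncation removes it at the latest there.\<close>

lemma hilbert_fun_0:
  assumes semi: "hilbert_series I = truncate_nonpos (expected_series d N (card (UNIV :: 'x set)))" and e: "d \<le> e" "e < 2 * d"
    and le: "card (monomials TYPE('x) e) \<le> N * card (monomials TYPE('x) (e - d))"
  shows "hilbert_fun I e = 0"
proof -
  have "(of_nat (card (monomials TYPE('x) e)) :: rat) \<le> of_nat (N * card (monomials TYPE('x) (e - d)))"
    using le by (simp only: of_nat_le_iff)
  then have "\<not> fps_nth (expected_series d N (card (UNIV :: 'x set))) e > 0"
    unfolding expected_series_card[OF e] by simp
  then have "(of_nat (hilbert_fun I e) :: rat) = 0"
    unfolding hilbert_fun_truncate[OF semi] by (metis order_refl)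
  then show ?thesis by simp
qed

text \<open>The estimate \<open>dim I_e \<le> N dim S_(e-d)\<close> always holds, so a positive expected value cannot be
  cut off by an earlier truncation.\<close>

lemma generators_independent:
  assumes semi: "hilbert_series I = truncate_nonpos (expected_series d N (card (UNIV :: 'x set)))" and e: "d \<le> e" "e < 2 * d"
    and less: "N * card (monomials TYPE('x) (e - d)) < card (monomials TYPE('x) e)"
  shows "N * card (monomials TYPE('x) (e - d)) \<le> poly_vs.dim (I \<inter> homog (int e))"
proof -
  have pos: "hilbert_fun I e > 0"
    using dim_I_le_generators[OF e(1)] less unfolding hilbert_fun_eq by linarith
  then have "(of_nat (hilbert_fun I e) :: rat) \<noteq> 0" by simp
  then have "(of_nat (hilbert_fun I e) :: rat) = fps_nth (expected_series d N (card (UNIV :: 'x set))) e"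
    using hilbert_fun_truncate[OF semi, of e] by (metis (full_types))
  then have "(of_nat (hilbert_fun I e + N * card (monomials TYPE('x) (e - d))) :: rat) = of_nat (card (monomials TYPE('x) e))"
    unfolding expected_series_card[OF e] by simp
  then have "hilbert_fun I e + N * card (monomials TYPE('x) (e - d)) = card (monomials TYPE('x) e)"
    by (simp only: of_nat_eq_iff)
  then show ?thesis using pos unfolding hilbert_fun_eq by linarith
qed

lemma expected_nonpos_if_tor_3_bounded:
  assumes semi: "hilbert_series I = truncate_nonpos (expected_series d N (card (UNIV :: 'x set)))" and e: "d \<le> e" "e < 2 * d" "2 \<le> e"
    and N: "N > card (UNIV :: 'x set)" and V: "\<And>j. tor_nonzero I 3 j \<Longrightarrow> j \<le> e"
  shows "card (monomials TYPE('x) e) \<le> N * card (monomials TYPE('x) (e - d))"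
proof (rule ccontr)
  assume "\<not> ?thesis"
  then have less: "N * card (monomials TYPE('x) (e - d)) < card (monomials TYPE('x) e)" by simp
  obtain F where "generated_resolution I f N d F" by (rule resolution_obtain)
  then interpret R: generated_resolution I f N d F .
  have V3: "R.tor_k_zero 3 j" if "j > int e" for j
  proof (rule ccontr)
    assume nz: "\<not> R.tor_k_zero 3 j"
    have "j = int (nat j)" using that by simp
    then have "tor_nonzero I 3 (nat j)"
      using nz tor_nonzero_iff R.resolution_axioms by metis
    then have "nat j \<le> e" by (rule V)
    then show False using that by simp
  qed
  have inj: "\<forall>l<N. a l = 0" if "s \<le> int e - int d" "syzygy f N s a" for s a
    by (rule no_syzygies[OF e(1) generators_independent[OF semi e(1,2) less] that])
  have "N \<le> card (UNIV :: 'x set)"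
  proof (rule regular_imp_le)
    fix M s g assume "M < N" "g \<in> homog s" "g * f M \<in> partial_ideal M"
    then show "g \<in> partial_ideal M"
      using R.regular_if_tor_3_zero[OF inj _ _ V3] e by simp
  qed
  then show False using N by simp
qed

lemma d_le_t_inv_2: "d \<ge> 2 \<Longrightarrow> I \<noteq> {0} \<Longrightarrow> ereal (real d) \<le> t_inv I 2"
  unfolding t_inv_def by (rule SUP_upper2[of d]) (auto intro: tor_nonzero_2)

lemma t_inv_le: "(\<And>j. tor_nonzero I i j \<Longrightarrow> real j \<le> c) \<Longrightarrow> t_inv I i \<le> ereal c"
  unfolding t_inv_def by (rule SUP_least) auto

lemma rate_ge:
  assumes "d \<ge> 2" "I \<noteq> {0}"
  shows "ereal (real d - 1) \<le> rate I"
  unfolding rate_def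
proof (rule SUP_upper2[of 2])
  have "ereal (real d - 1) = (ereal (real d) - 1) / ereal (real 2 - 1)" by (simp add: one_ereal_def)
  also have "\<dots> \<le> (t_inv I 2 - 1) / ereal (real 2 - 1)"
    by (intro ereal_divide_right_mono ereal_minus_mono d_le_t_inv_2 assms) auto
  finally show "ereal (real d - 1) \<le> (t_inv I 2 - 1) / ereal (real 2 - 1)" .
qed simp

lemma slant_ge:
  assumes "d \<ge> 2" "I \<noteq> {0}"
  shows "ereal (real d / 2) \<le> slant I"
  unfolding slant_def
proof (rule SUP_upper2[of 2])
  have "ereal (real d / 2) = ereal (real d) / ereal (real 2)" by simp
  also have "\<dots> \<le> t_inv I 2 / ereal (real 2)"
    by (intro ereal_divide_right_mono d_le_t_inv_2 assms) auto
  finally show "ereal (real d / 2) \<le> t_inv I 2 / ereal (real 2)" .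
qed simp

lemma minimal_rateI:
  assumes d: "d \<ge> 2" and nz: "I \<noteq> {0}" and e: "hilbert_fun I (2 * d - 2) = 0"
  shows "minimal_rate I"
proof -
  define D where "D = real d - 1"
  have D: "D \<ge> 1" using d by (simp add: D_def)
  let ?e = "2 * d - 2"
  define h where "h = (\<lambda>s :: nat. if s = 1 then real d else real s + real ?e - 1)"
  \<comment> \<open>The line through \<open>t_1 = 1\<close> of slope \<open>d - 1\<close>, the
    values permitted by the rate. \<open>Tor_0(k, k)\<close> lives in degree 0, where the line would
    be \<open>2 - d\<close>, so \<open>i = 0\<close> gets its own value.\<close>
  define \<beta> where "\<beta> = (\<lambda>i. if i = 0 then 0 else 1 + D * (real i - 1))"
  have h_le: "h s \<le> 1 + D * real s" if "s \<ge> 1" for s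
  proof (cases "s = 1")
    case True
    then show ?thesis by (simp add: h_def D_def)
  next
    case False
    \<comment> \<open>Here \<open>e = 2d - 2\<close> enters: the claim amounts to
      \<open>2 (D - 1) \<le> s (D - 1)\<close>, with equality at \<open>s = 2\<close>.\<close>
    then have "(D - 1) * 2 \<le> (D - 1) * real s" using that D by (intro mult_left_mono) auto
    then show ?thesis using False d by (simp add: h_def D_def of_nat_diff algebra_simps)
  qed
  have bound: "real j \<le> \<beta> i" if "tor_nonzero I i j" for i j
  proof (rule tor_nonzero_bound[OF _ _ _ _ that])
    show "p \<in> I" if "p \<in> homog q" "q \<ge> int ?e" for p q
      using homog_subset_if_hilbert_fun_0[OF e, of p "nat (q - int ?e)"] that by simp
    show "h s = (if s = 1 then real d else real s + real ?e - 1)" for s by (simp add: h_def)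
    show "real i \<le> \<beta> i" for i
    proof (cases "i = 0")
      case False
      then have "1 * (real i - 1) \<le> D * (real i - 1)" using D by (intro mult_right_mono) auto
      then show ?thesis using False by (simp add: \<beta>_def)
    qed (simp add: \<beta>_def)
    show "h s + \<beta> (i - 1 - s) \<le> \<beta> i" if s: "1 \<le> s" "s < i" for i s
    proof (cases "i - 1 - s = 0")
      case True
      then have "real i - 1 = real s" using s by linarith
      then show ?thesis using True h_le[OF s(1)] s by (simp add: \<beta>_def)
    next
      case False
      then have "real (i - 1 - s) = real i - 1 - real s" using s by linarith
      then show ?thesis using False h_le[OF s(1)] s D by (simp add: \<beta>_def algebra_simps)
    qed
  qed
  have "rate I \<le> ereal D"
    unfolding rate_def
  proof (rule SUP_least)
    fix i :: nat assume "i \<in> {2..}"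
    then have i: "i \<ge> 2" by simp
    have "t_inv I i \<le> ereal (1 + D * (real i - 1))"
      using bound[of i] i by (intro t_inv_le) (simp add: \<beta>_def)
    then have "(t_inv I i - 1) / ereal (real i - 1) \<le> (ereal (1 + D * (real i - 1)) - 1) / ereal (real i - 1)"
      using i by (intro ereal_divide_right_mono ereal_minus_mono) auto
    also have "\<dots> = ereal D" using i by (simp add: one_ereal_def)
    finally show "(t_inv I i - 1) / ereal (real i - 1) \<le> ereal D" .
  qed
  then show ?thesis
    using rate_ge[OF d nz] unfolding minimal_rate_def max_gen_deg_eq[OF nz] D_def by (rule antisym)
qed

lemma minimal_slantI:
  assumes d: "d \<ge> 2" and nz: "I \<noteq> {0}" and e: "hilbert_fun I ((3 * d - 2) div 2) = 0"
  shows "minimal_slant I"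
proof -
  let ?e = "(3 * d - 2) div 2"
  have "2 * ?e \<le> 3 * d - 2" by simp
  then have e2: "2 * real ?e \<le> 3 * real d - 2" using d by linarith
  define h where "h = (\<lambda>s :: nat. if s = 1 then real d else real s + real ?e - 1)"
  \<comment> \<open>The values permitted by the slant; this line passes through the origin and so
    fits \<open>i = 0\<close> as well.\<close>
  define \<beta> where "\<beta> = (\<lambda>i :: nat. real i * real d / 2)"
  have h_le: "h s \<le> (real s + 1) * real d / 2" if "s \<ge> 1" for s
  proof (cases "s = 1")
    case True
    then show ?thesis by (simp add: h_def)
  next
    case False
    \<comment> \<open>With \<open>2 e \<le> 3 d - 2\<close>, the bound
      \<open>s + e - 1 \<le> (s + 1) d/2\<close> follows from this product being
      non-negative.\<close>
    then have "0 \<le> (real s - 2) * (real d - 2)" using that d by (intro mult_nonneg_nonneg) auto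
    then show ?thesis using False e2 by (simp add: h_def algebra_simps)
  qed
  have bound: "real j \<le> \<beta> i" if "tor_nonzero I i j" for i j
  proof (rule tor_nonzero_bound[OF _ _ _ _ that])
    show "p \<in> I" if "p \<in> homog q" "q \<ge> int ?e" for p q
      using homog_subset_if_hilbert_fun_0[OF e, of p "nat (q - int ?e)"] that by simp
    show "h s = (if s = 1 then real d else real s + real ?e - 1)" for s by (simp add: h_def)
    show "real i \<le> \<beta> i" for i
      using mult_left_mono[of 2 "real d" "real i"] d by (simp add: \<beta>_def)
    show "h s + \<beta> (i - 1 - s) \<le> \<beta> i" if s: "1 \<le> s" "s < i" for i s
    proof -
      have "real (i - 1 - s) = real i - 1 - real s" using s by linarith
      then have "\<beta> (i - 1 - s) = \<beta> i - (real s + 1) * real d / 2"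
        by (simp add: \<beta>_def field_simps)
      then show ?thesis using h_le[OF s(1)] by simp
    qed
  qed
  have "slant I \<le> ereal (real d / 2)"
    unfolding slant_def
  proof (rule SUP_least)
    fix i :: nat assume "i \<in> {1..}"
    then have i: "i \<ge> 1" by simp
    have "t_inv I i \<le> ereal (\<beta> i)" using bound by (rule t_inv_le)
    then have "t_inv I i / ereal (real i) \<le> ereal (\<beta> i) / ereal (real i)"
      using i by (intro ereal_divide_right_mono) auto
    also have "\<dots> = ereal (real d / 2)" using i by (simp add: \<beta>_def)
    finally show "t_inv I i / ereal (real i) \<le> ereal (real d / 2)" .
  qed
  then show ?thesis
    using slant_ge[OF d nz] unfolding minimal_slant_def max_gen_deg_eq[OF nz] by (rule antisym)
qed

text \<open>Read off from the term \<open>i = 3\<close> of the supremum: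
  \<open>(t_3 - 1)/2 \<le> d - 1\<close>.\<close>

lemma tor_3_bound_if_minimal_rate:
  assumes "I \<noteq> {0}" "minimal_rate I" "tor_nonzero I 3 j"
  shows "j \<le> 2 * d - 1"
proof -
  have "(ereal (real j) - 1) / ereal (real 3 - 1) \<le> (t_inv I 3 - 1) / ereal (real 3 - 1)"
    unfolding t_inv_def using assms(3)
    by (intro ereal_divide_right_mono ereal_minus_mono SUP_upper2[of j]) auto
  also have "\<dots> \<le> rate I" unfolding rate_def by (rule SUP_upper) simp
  also have "\<dots> = ereal (real d - 1)"
    using assms(2) unfolding minimal_rate_def max_gen_deg_eq[OF assms(1)] .
  finally have "(real j - 1) / 2 \<le> real d - 1" by (simp add: one_ereal_def)
  then have "real (j + 1) \<le> real (2 * d)" by simp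
  then have "j + 1 \<le> 2 * d" by (simp only: of_nat_le_iff)
  then show ?thesis by simp
qed

lemma tor_3_bound_if_minimal_slant:
  assumes "I \<noteq> {0}" "minimal_slant I" "tor_nonzero I 3 j"
  shows "j \<le> 3 * d div 2"
proof -
  have "ereal (real j) / ereal (real 3) \<le> t_inv I 3 / ereal (real 3)"
    unfolding t_inv_def using assms(3)
    by (intro ereal_divide_right_mono SUP_upper2[of j]) auto
  also have "\<dots> \<le> slant I" unfolding slant_def by (rule SUP_upper) simp
  also have "\<dots> = ereal (real d / 2)"
    using assms(2) unfolding minimal_slant_def max_gen_deg_eq[OF assms(1)] .
  finally have "real j / 3 \<le> real d / 2" by simp
  then have "2 * j \<le> 3 * d" by linarith
  then show ?thesis by linarith
qed

end

lemma real_ge_quotient_iff: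
  fixes a b N :: nat
  assumes "b > 0"
  shows "real N \<ge> real a / real b \<longleftrightarrow> a \<le> N * b"
proof -
  have "real N \<ge> real a / real b \<longleftrightarrow> real a \<le> real (N * b)"
    using assms by (simp add: pos_divide_le_eq)
  then show ?thesis by (simp only: of_nat_le_iff)
qed

theorem corollary5p6:
  fixes I :: "('x::finite, 'k::field) mpoly set"
    and n N d :: nat
  assumes n_def: "n = card (UNIV :: 'x set)"
    and n_ge: "n \<ge> 2"
    and hom: "homogeneous_ideal I"
    and nonzero: "I \<noteq> {0}"
    and sub: "I \<subseteq> ideal_prod max_ideal max_ideal"
    and d_ge: "d \<ge> 2"
    and type: "of_type I N d"
    and semireg: "\<exists>fs. length fs = N \<and> semi_regular d fs \<and> ideal_gen (set fs) = I"
  shows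
    "(real N \<ge> real ((n + 2*d - 3) choose (2*d - 2)) / real ((n + d - 3) choose (d - 2))
        \<longrightarrow> minimal_rate I) \<and>
     (minimal_rate I \<and> N > n
        \<longrightarrow> real N \<ge> real ((n + 2*d - 2) choose (2*d - 1)) / real ((n + d - 2) choose (d - 1))) \<and>
     (real N \<ge> real (nat (int n + (3 * int d - 4) div 2) choose nat ((3 * int d - 2) div 2))
                 / real (nat (int n + (int d - 4) div 2) choose nat ((int d - 2) div 2))
        \<longrightarrow> minimal_slant I) \<and>
     (minimal_slant I \<and> N > n
        \<longrightarrow> real N \<ge> real (nat (int n + (3 * int d - 2) div 2) choose nat ((3 * int d) div 2))
                     / real (nat (int n + (int d - 2) div 2) choose nat (int d div 2)))"
proof -
  obtain fs where fs: "length fs = N" "semi_regular d fs" "ideal_gen (set fs) = I"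
    using semireg by blast
  define f where "f = (\<lambda>l. fs ! l)"
  have set_fs: "f ` {..<N} = set fs"
    using fs(1) by (auto simp: f_def set_conv_nth)
  have forms: "is_form d g" if "g \<in> set fs" for g
    using fs(2) that by (simp add: semi_regular_def)
  have "graded_ideal I"
    unfolding fs(3)[symmetric] by (rule graded_ideal_ideal_gen) (use forms in blast)
  moreover have "f l \<in> homog (int d)" if "l < N" for l
    using forms[of "f l"] that fs(1) by (simp add: f_def is_form_iff_homog)
  ultimately interpret G: generated_ideal I f N d
    using fs(3) set_fs d_ge by (simp add: generated_ideal_def generated_ideal_axioms_def)
  have semi: "hilbert_series I = truncate_nonpos (expected_series d N (card (UNIV :: 'x set)))"
    using fs by (simp add: semi_regular_def)
  define c where "c = (\<lambda>j. card (monomials TYPE('x) j))"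
  have c: "c j = (n + j - 1) choose j" for j
    by (simp add: c_def card_monomials n_def add.commute)
  have c_pos: "c j > 0" for j
    unfolding c using n_ge by simp
  \<comment> \<open>All four quotients have this shape: the dimension of \<open>S_e\<close> over
    that of \<open>S_(e-d)\<close>.\<close>
  have quot: "real N \<ge> real ((n + e - 1) choose e) / real ((n + (e - d) - 1) choose (e - d)) \<longleftrightarrow> c e \<le> N * c (e - d)" for e
    unfolding c[symmetric] by (rule real_ge_quotient_iff[OF c_pos])
  have zero: "hilbert_fun I e = 0" if "d \<le> e" "e < 2 * d" "c e \<le> N * c (e - d)" for e
    using G.hilbert_fun_0[OF semi that(1,2)] that(3) by (simp add: c_def)
  have nonpos: "c e \<le> N * c (e - d)"
    if "d \<le> e" "e < 2 * d" "2 \<le> e" "N > n" "\<And>j. tor_nonzero I 3 j \<Longrightarrow> j \<le> e" for e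
    using G.expected_nonpos_if_tor_3_bounded[OF semi that(1-3)] that(4,5) by (simp add: c_def n_def)
  have e1: "n + 2 * d - 3 = n + (2 * d - 2) - 1" "n + d - 3 = n + (2 * d - 2 - d) - 1" "d - 2 = 2 * d - 2 - d"
    using d_ge by auto
  have e2: "n + 2 * d - 2 = n + (2 * d - 1) - 1" "n + d - 2 = n + (2 * d - 1 - d) - 1" "d - 1 = 2 * d - 1 - d"
    using d_ge by auto
  \<comment> \<open>The floors are taken over the integers because \<open>d - 4\<close> is negative
    for \<open>d < 4\<close>. For either parity of \<open>d\<close> they become
    \<open>e = (3 d - 2) div 2\<close> and \<open>e - d\<close>.\<close>
  have e3: "nat (int n + (3 * int d - 4) div 2) = n + (3 * d - 2) div 2 - 1"
    "nat ((3 * int d - 2) div 2) = (3 * d - 2) div 2"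
    "nat (int n + (int d - 4) div 2) = n + ((3 * d - 2) div 2 - d) - 1"
    "nat ((int d - 2) div 2) = (3 * d - 2) div 2 - d"
    using d_ge n_ge by auto
  have e4: "nat (int n + (3 * int d - 2) div 2) = n + 3 * d div 2 - 1"
    "nat ((3 * int d) div 2) = 3 * d div 2"
    "nat (int n + (int d - 2) div 2) = n + (3 * d div 2 - d) - 1"
    "nat (int d div 2) = 3 * d div 2 - d"
    using d_ge n_ge by auto
  show ?thesis
    unfolding e1 e2 e3 e4 quot
  proof (intro conjI impI)
    show "minimal_rate I" if "c (2 * d - 2) \<le> N * c (2 * d - 2 - d)"
      using d_ge that by (intro G.minimal_rateI nonzero zero) auto
    show "c (2 * d - 1) \<le> N * c (2 * d - 1 - d)" if "minimal_rate I \<and> n < N"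
      using d_ge that G.tor_3_bound_if_minimal_rate[OF nonzero] by (intro nonpos) auto
    show "minimal_slant I" if "c ((3 * d - 2) div 2) \<le> N * c ((3 * d - 2) div 2 - d)"
      using d_ge that by (intro G.minimal_slantI nonzero zero) auto
    show "c (3 * d div 2) \<le> N * c (3 * d div 2 - d)" if "minimal_slant I \<and> n < N"
      using d_ge that G.tor_3_bound_if_minimal_slant[OF nonzero] by (intro nonpos) auto
  qed
qed

end
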